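(* Let $\mathcal W_1,\mathcal W_2$ be complex Hilbert spaces, let $L_1$ be a closed, densely defined (not necessarily bounded) linear operator on $\mathcal W_1$, and let $L_2$ be a bounded, everywhere defined linear operator on $\mathcal W_2$. Suppose that $\sigma(L_1)$ and $\sigma(L_2)$ are disjoint. Then for every $M\in\mathcal L(\mathcal W_2,\mathcal W_1)$ the operator equation $$L_1S-SL_2=M$$ has a unique solution $S$ that is a bounded linear transformation from $\mathcal W_2$ to $\mathrm{Dom}(L_1)\subset\mathcal W_1$; that is, $\mathcal T(S)=L_1S-SL_2$ is bijective. Moreover: (a) $S$ has the representation $$S=\frac1{2\pi i}\int_{\Gamma_2}(L_1-z)^{-1}M(z-L_2)^{-1}\,dz,$$ where $\Gamma_2$ consists of a finite number of positively oriented closed rectifiable Jordan curves enclosing all points of $\sigma(L_2)$ and no points of $\sigma(L_1)$. (b) Let $\epsilon_1,\epsilon_2>0$ be chosen so that $\Lambda_{\epsilon_1}(L_1)\cap\Gamma_2=\emptyset$ and $\Lambda_{\epsilon_2}(L_2)\cap\Gamma_2=\emptyset$ (that is, $\Lambda_{\epsilon_1}(L_1)$ lies entirely outside $\Gamma_2$ and $\Lambda_{\epsilon_2}(L_2)$ lies entirely inside $\Gamma_2$). Then $$\mathrm{sep}(L_1,L_2)\ge\frac{2\pi\epsilon_1\epsilon_2}{\mathrm{length}(\Gamma_2)},$$ where $\mathrm{length}(\Gamma_2)$ is the arc length of $\Gamma_2$. (c) If the numerical ranges $\mathfrak w(L_1)$ and $\mathfrak w(L_2)$ are disjoint sets in $\mathbb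 C$ and $\Delta=\mathrm{dist}(\mathfrak w(L_1),\mathfrak w(L_2))>0$, then $$\mathrm{sep}(L_1,L_2)\ge\Delta .$$
   Context: $\mathcal L(\mathcal W_2,\mathcal W_1)$ is the Banach space of bounded linear transformations from $\mathcal W_2$ to $\mathcal W_1$ with operator norm $\|\cdot\|_{\mathcal W_2\to\mathcal W_1}$, and $\mathcal L(\mathcal W_2,\mathrm{Dom}(L_1))$ denotes those $S\in \mathcal L(\mathcal W_2,\mathcal W_1)$ with range in $\mathrm{Dom}(L_1)$. The map $\mathcal T$ sends $S\in\mathcal L(\mathcal W_2,\mathrm{Dom}(L_1))$ to $\mathcal T(S)=L_1S-SL_2\in\mathcal L(\mathcal W_2,\mathcal W_1)$, and $$\mathrm{sep}(L_1,L_2)=\inf_{0\ne S\in\mathcal L(\mathcal W_2,\mathrm{Dom}(L_1))}\frac{\|\mathcal T(S)\|_{\mathcal W_2\to\mathcal W_1}}{\|S\|_{\mathcal W_2\to\mathcal W_1}} .$$ For $\epsilon>0$ the pseudospectral set is $\Lambda_\epsilon(L)=\{z\in\mathbb C:\ \|(z-L)^{-1}\|\ge 1/\epsilon\}$, with the convention $\|(z-L)^{-1}\|=\infty$ for $z\in\sigma(L)$. The numerical range is $\mathfrak w(L)=\{\langle x,Lx\rangle/\langle x,x\rangle:\ 0\ne x\in\mathrm{Dom}(L)\}$. "Positively oriented, enclosing all points of $\sigma(L_2)$ and no points of $\sigma(L_1)$" means that $\Gamma_2$ avoids both spectra and has total winding number $1$ about each point of $\sigma(L_2)$ and $0$ about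 each point of $\sigma(L_1)$. *)

theory Defs
  imports "HOL-Complex_Analysis.Complex_Analysis"
begin

text \<open>
  Complex Hilbert spaces. The real Banach space structure is the one underlying the complex
  structure. The inner product is antilinear in its first and linear in its second argument.
  Positive definiteness follows from the last axiom and the norm axioms; the zero space is
  admitted.
\<close>

class chilbert_space = banach +
  fixes scaleC :: "complex \<Rightarrow> 'a \<Rightarrow> 'a" (infixr \<open>*\<^sub>C\<close> 75)
    and cinner :: "'a \<Rightarrow> 'a \<Rightarrow> complex"
  assumes scaleC_add_right: "c *\<^sub>C (x + y) = c *\<^sub>C x + c *\<^sub>C y"
    and scaleC_add_left: "(c + d) *\<^sub>C x = c *\<^sub>C x + d *\<^sub>C x"
    and scaleC_scaleC: "c *\<^sub>C (d *\<^sub>C x) = (c * d) *\<^sub>C x"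
    and scaleC_of_real: "complex_of_real r *\<^sub>C x = r *\<^sub>R x"
    and cinner_commute: "cinner x y = cnj (cinner y x)"
    and cinner_add_right: "cinner x (y + z) = cinner x y + cinner x z"
    and cinner_scaleC_right: "cinner x (c *\<^sub>C y) = c * cinner x y"
    and cinner_self: "cinner x x = complex_of_real ((norm x)\<^sup>2)"

instantiation complex :: chilbert_space
begin

definition scaleC_complex :: "complex \<Rightarrow> complex \<Rightarrow> complex"
  where "scaleC_complex c x = c * x"

definition cinner_complex :: "complex \<Rightarrow> complex \<Rightarrow> complex"
  where "cinner_complex x y = cnj x * y"

instance
proof
  fix x :: complex
  show "cinner x x = complex_of_real ((norm x)\<^sup>2)"
    unfolding cinner_complex_def by (metis complex_norm_square mult.commute)
qed (simp_all add: scaleC_complex_def cinner_complex_def algebra_simps scaleR_conv_of_real)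

end

definition bounded_clinear :: "('a::chilbert_space \<Rightarrow> 'b::chilbert_space) \<Rightarrow> bool"
  where "bounded_clinear f \<longleftrightarrow> bounded_linear f \<and> (\<forall>c x. f (c *\<^sub>C x) = c *\<^sub>C f x)"

text \<open>The bounded operators with range in \<open>D\<close>; the operator norm is \<^const>\<open>onorm\<close>.\<close>

definition bounded_ops :: "'a set \<Rightarrow> ('b::chilbert_space \<Rightarrow> 'a::chilbert_space) set"
  where "bounded_ops D = {S. bounded_clinear S \<and> range S \<subseteq> D}"

text \<open>
  An unbounded operator is given by its domain \<open>D\<close> and a function \<open>L\<close>, of which only the
  values on \<open>D\<close> matter. Everywhere defined operators have \<open>D = UNIV\<close>.
\<close>

definition closed_densely_defined :: "'a::chilbert_space set \<Rightarrow> ('a \<Rightarrow> 'a) \<Rightarrow> bool"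
  where "closed_densely_defined D L \<longleftrightarrow>
    0 \<in> D \<and>
    (\<forall>x\<in>D. \<forall>y\<in>D. x + y \<in> D \<and> L (x + y) = L x + L y) \<and>
    (\<forall>c. \<forall>x\<in>D. c *\<^sub>C x \<in> D \<and> L (c *\<^sub>C x) = c *\<^sub>C L x) \<and>
    closure D = UNIV \<and>
    closed {(x, L x) | x. x \<in> D}"

definition resolvent :: "'a::chilbert_space set \<Rightarrow> ('a \<Rightarrow> 'a) \<Rightarrow> complex \<Rightarrow> 'a \<Rightarrow> 'a"
  where "resolvent D L z = inv_into D (\<lambda>x. z *\<^sub>C x - L x)"

definition spectrum :: "'a::chilbert_space set \<Rightarrow> ('a \<Rightarrow> 'a) \<Rightarrow> complex set"
  where "spectrum D L = - {z. bij_betw (\<lambda>x. z *\<^sub>C x - L x) D UNIV \<and>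
                               bounded_clinear (resolvent D L z)}"

definition resolvent_norm :: "'a::chilbert_space set \<Rightarrow> ('a \<Rightarrow> 'a) \<Rightarrow> complex \<Rightarrow> ereal"
  where "resolvent_norm D L z =
    (if z \<in> spectrum D L then \<infinity> else ereal (onorm (resolvent D L z)))"

definition pseudospectrum ::
    "real \<Rightarrow> 'a::chilbert_space set \<Rightarrow> ('a \<Rightarrow> 'a) \<Rightarrow> complex set"
  where "pseudospectrum \<epsilon> D L = {z. resolvent_norm D L z \<ge> ereal (1 / \<epsilon>)}"

definition numerical_range :: "'a::chilbert_space set \<Rightarrow> ('a \<Rightarrow> 'a) \<Rightarrow> complex set"
  where "numerical_range D L = {cinner x (L x) / cinner x x | x. x \<in> D \<and> x \<noteq> 0}"

definition sylvester ::
    "('a::chilbert_space \<Rightarrow> 'a) \<Rightarrow> ('b::chilbert_space \<Rightarrow> 'b) \<Rightarrow> ('b \<Rightarrow> 'a) \<Rightarrow> 'b \<Rightarrow> 'a"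
  where "sylvester L1 L2 S = (\<lambda>x. L1 (S x) - S (L2 x))"

text \<open>
  The infimum is taken in the extended reals, so that it is \<open>\<infinity>\<close> when there is no nonzero \<open>S\<close>,
  that is, when one of the spaces is the zero space.
\<close>

definition sep ::
    "'a::chilbert_space set \<Rightarrow> ('a \<Rightarrow> 'a) \<Rightarrow> ('b::chilbert_space \<Rightarrow> 'b) \<Rightarrow> ereal"
  where "sep D1 L1 L2 =
    (INF S \<in> bounded_ops D1 - {\<lambda>_. 0}. ereal (onorm (sylvester L1 L2 S) / onorm S))"

text \<open>Partitions \<open>0 = t 0 \<le> t 1 \<le> \<dots> \<le> t n = 1\<close> of the parameter interval of a path.\<close>

definition partition01 :: "nat \<Rightarrow> (nat \<Rightarrow> real) \<Rightarrow> bool"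
  where "partition01 n t \<longleftrightarrow> t 0 = 0 \<and> t n = 1 \<and> (\<forall>i<n. t i \<le> t (Suc i))"

definition inscribed_lengths :: "(real \<Rightarrow> complex) \<Rightarrow> real set"
  where "inscribed_lengths \<gamma> =
    {\<Sum>i<n. dist (\<gamma> (t i)) (\<gamma> (t (Suc i))) | n t. partition01 n t}"

definition rectifiable_path :: "(real \<Rightarrow> complex) \<Rightarrow> bool"
  where "rectifiable_path \<gamma> \<longleftrightarrow> path \<gamma> \<and> bdd_above (inscribed_lengths \<gamma>)"

definition arc_length :: "(real \<Rightarrow> complex) \<Rightarrow> real"
  where "arc_length \<gamma> = Sup (inscribed_lengths \<gamma>)"

text \<open>
  The Riemann--Stieltjes contour integral \<open>\<integral>\<^sub>\<gamma> F(z) dz = J\<close> of an operator-valued function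
  along a rectifiable path, convergent in operator norm. Since \<^const>\<open>onorm\<close> is only
  meaningful for bounded operators, boundedness is required along with smallness.
\<close>

definition has_op_contour_integral ::
    "(complex \<Rightarrow> 'b::chilbert_space \<Rightarrow> 'a::chilbert_space) \<Rightarrow> ('b \<Rightarrow> 'a) \<Rightarrow> (real \<Rightarrow> complex) \<Rightarrow> bool"
  where "has_op_contour_integral F J \<gamma> \<longleftrightarrow> bounded_clinear J \<and>
    (\<forall>e>0. \<exists>d>0. \<forall>n t \<tau>.
       partition01 n t \<and> (\<forall>i<n. \<tau> i \<in> {t i..t (Suc i)} \<and> t (Suc i) - t i < d) \<longrightarrow>
       (let E = (\<lambda>x. (\<Sum>i<n. (\<gamma> (t (Suc i)) - \<gamma> (t i)) *\<^sub>C F (\<gamma> (\<tau> i)) x) - J x)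
        in bounded_clinear E \<and> onorm E < e))"

text \<open>A contour \<open>\<Gamma>\<close> is a finite list of curves.\<close>

definition has_op_cycle_integral ::
    "(complex \<Rightarrow> 'b::chilbert_space \<Rightarrow> 'a::chilbert_space) \<Rightarrow> ('b \<Rightarrow> 'a) \<Rightarrow>
     (real \<Rightarrow> complex) list \<Rightarrow> bool"
  where "has_op_cycle_integral F J \<Gamma> \<longleftrightarrow>
    (\<exists>Js. list_all2 (has_op_contour_integral F) Js \<Gamma> \<and> J = (\<lambda>x. \<Sum>K\<leftarrow>Js. K x))"

definition cycle_image :: "(real \<Rightarrow> complex) list \<Rightarrow> complex set"
  where "cycle_image \<Gamma> = (\<Union>\<gamma>\<in>set \<Gamma>. path_image \<gamma>)"

definition cycle_length :: "(real \<Rightarrow> complex) list \<Rightarrow> real"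
  where "cycle_length \<Gamma> = (\<Sum>\<gamma>\<leftarrow>\<Gamma>. arc_length \<gamma>)"

text \<open>
  Closed rectifiable Jordan curves, together positively oriented, enclosing all points of \<open>B\<close>
  and no points of \<open>A\<close>. Orientation is expressed by the total winding number, so that a
  curve bounding a hole may itself run clockwise.
\<close>

definition jordan_contour ::
    "(real \<Rightarrow> complex) list \<Rightarrow> complex set \<Rightarrow> complex set \<Rightarrow> bool"
  where "jordan_contour \<Gamma> A B \<longleftrightarrow>
    (\<forall>\<gamma>\<in>set \<Gamma>. simple_path \<gamma> \<and> pathfinish \<gamma> = pathstart \<gamma> \<and> rectifiable_path \<gamma>) \<and>
    cycle_image \<Gamma> \<inter> (A \<union> B) = {} \<and>
    (\<forall>z\<in>B. (\<Sum>\<gamma>\<leftarrow>\<Gamma>. winding_number \<gamma> z) = 1) \<and>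
    (\<forall>z\<in>A. (\<Sum>\<gamma>\<leftarrow>\<Gamma>. winding_number \<gamma> z) = 0)"

end

theory Submission
  imports Defs
begin

text \<open>
  Write \<open>T1\<close> and \<open>R2\<close> for the families \<open>(L1 - z)\<^sup>-\<^sup>1\<close> and \<open>(z - L2)\<^sup>-\<^sup>1\<close>, and \<open>F z = T1 z M (R2 z)\<close> for the
  integrand. Everything about solvability follows from two algebraic identities. First,
  \<open>L1 (F z) - F z L2 = M (R2 z) + T1 z M\<close>. Second, if \<open>S\<close> solves the equation, then
  \<open>F z = S (R2 z) + T1 z S\<close>. Now integrate along a contour that winds once around \<open>\<sigma>(L2)\<close>
  and not at all around \<open>\<sigma>(L1)\<close>. The terms with \<open>T1\<close> integrate to \<open>0\<close>, since \<open>T1\<close> is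
  holomorphic off \<open>\<sigma>(L1)\<close>. The terms with \<open>R2\<close> may be moved to a large circle, where
  \<open>R2 z\<close> is nearly \<open>1 / z\<close>, and give \<open>2 \<pi> i M\<close> and \<open>2 \<pi> i S\<close>. Since
  \<open>L1\<close> is closed, it may be applied under the integral, so the first identity says that the integral
  of \<open>F\<close>, divided by \<open>2 \<pi> i\<close>, is a solution, and the second that every solution is given by this
  integral (\<open>contour_integral_solves_sylvester\<close>). That the Sylvester operator takes bounded
  values, which makes it a bijection, is a consequence of the closed graph theorem.

  The bound by pseudospectra is the trivial estimate of the integral. The bound by numerical ranges uses no
  contour: at a unit vector \<open>x\<close> that nearly maximises \<open>norm (S x)\<close>, the number
  \<open>\<langle>S x, (L1 S - S L2) x\<rangle>\<close> is nearly \<open>(norm S)\<^sup>2\<close> times the difference of a point of the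
  numerical range of \<open>L1\<close> and one of \<open>L2\<close>.

  The analytic substance is in three tools. A compact set inside an open set is surrounded by a contour
  of lattice edges (\<open>grid_contour\<close>): the edges with exactly one adjacent square that meets the compact set
  form a balanced directed graph, and such a graph splits into simple cycles. This yields the
  existence of contours and also the homology form of Cauchy's theorem for cycles of several curves
  (\<open>Cauchy_theorem_cycle\<close>). Finally, the curves are merely rectifiable and the integrals are limits of
  Riemann--Stieltjes sums. For scalar holomorphic functions such sums converge to an integral along a nearby smooth
  loop, by telescoping a primitive along the curve (\<open>smooth_loop_approximation\<close>,
  \<open>Riemann_sum_estimate\<close>). Applied to \<open>\<langle>y, F z x\<rangle>\<close>, uniformly in \<open>x\<close> and \<open>y\<close>, this gives
  convergence in operator norm (\<open>has_op_contour_integral_holomorphic\<close>).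
\<close>

section \<open>Complex Hilbert spaces\<close>

lemma cinner_add_left: "cinner (x + y) z = cinner x z + cinner y (z::'a::chilbert_space)"
  by (metis cinner_add_right cinner_commute complex_cnj_add)

lemma cinner_scaleC_left: "cinner (c *\<^sub>C x) (y::'a::chilbert_space) = cnj c * cinner x y"
  by (metis cinner_commute cinner_scaleC_right complex_cnj_mult)

lemma scaleC_minus1: "(- 1) *\<^sub>C x = - (x::'a::chilbert_space)"
  using scaleC_of_real[of "-1" x] by simp

lemma scaleC_one [simp]: "1 *\<^sub>C x = (x::'a::chilbert_space)"
  using scaleC_of_real[of "1" x] by simp

lemma scaleC_zero_left [simp]: "0 *\<^sub>C x = (0::'a::chilbert_space)"
  using scaleC_of_real[of "0" x] by simp

lemma scaleC_zero_right [simp]: "c *\<^sub>C 0 = (0::'a::chilbert_space)"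
  using scaleC_add_right[of c 0 0] by simp

lemma scaleC_minus_left: "(- c) *\<^sub>C x = - (c *\<^sub>C (x::'a::chilbert_space))"
  using scaleC_add_left[of c "-c" x] by (simp add: eq_neg_iff_add_eq_0 add.commute)

lemma scaleC_minus_right: "c *\<^sub>C (- x) = - (c *\<^sub>C (x::'a::chilbert_space))"
  using scaleC_add_right[of c x "-x"] by (simp add: eq_neg_iff_add_eq_0 add.commute)

lemma scaleC_diff_right: "c *\<^sub>C (x - y) = c *\<^sub>C x - c *\<^sub>C (y::'a::chilbert_space)"
  using scaleC_add_right[of c x "-y"] by (simp add: scaleC_minus_right)

lemma scaleC_diff_left: "(c - d) *\<^sub>C x = c *\<^sub>C x - d *\<^sub>C (x::'a::chilbert_space)"
  using scaleC_add_left[of c "-d" x] by (simp add: scaleC_minus_left)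

lemma cinner_zero_right [simp]: "cinner x (0::'a::chilbert_space) = 0"
  using cinner_add_right[of x 0 0] by simp

lemma cinner_minus_right: "cinner x (- y) = - cinner x (y::'a::chilbert_space)"
  using cinner_scaleC_right[of x "-1" y] by (simp add: scaleC_minus1)

lemma cinner_diff_right: "cinner x (y - z) = cinner x y - cinner x (z::'a::chilbert_space)"
  using cinner_add_right[of x y "-z"] by (simp add: cinner_minus_right)

lemma cinner_sum_right: "cinner x (\<Sum>i\<in>I. f i) = (\<Sum>i\<in>I. cinner x (f i :: 'a::chilbert_space))"
  by (induction I rule: infinite_finite_induct) (auto simp: cinner_add_right)

lemma norm_scaleC [simp]: "norm (c *\<^sub>C x) = cmod c * norm (x::'a::chilbert_space)"
proof -
  have "complex_of_real ((norm (c *\<^sub>C x))\<^sup>2) = of_real ((cmod c)\<^sup>2) * of_real ((norm x)\<^sup>2)"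
    by (simp only: cinner_self[of "c *\<^sub>C x", symmetric] cinner_self[of x, symmetric]
        cinner_scaleC_left cinner_scaleC_right complex_norm_square) (simp add: mult_ac)
  then have "(norm (c *\<^sub>C x))\<^sup>2 = (cmod c * norm x)\<^sup>2"
    by (metis of_real_eq_iff of_real_mult power_mult_distrib)
  then show ?thesis
    by (simp add: power2_eq_iff_nonneg)
qed

text \<open>
  Stated for semidefinite forms so as to cover, besides the inner product, the form
  \<open>s\<^sup>2 \<langle>x, y\<rangle> - \<langle>S x, S y\<rangle>\<close> with \<open>s\<close> the norm of \<open>S\<close>, which takes the place of
  \<open>s\<^sup>2 - S\<^sup>* S\<close> in the estimate by numerical ranges and so avoids adjoints.
\<close>

lemma semidefinite_form_Cauchy_Schwarz:
  fixes B :: "'a::chilbert_space \<Rightarrow> 'a \<Rightarrow> complex"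
  assumes add: "\<And>x y z. B x (y + z) = B x y + B x z"
    and scale: "\<And>x y c. B x (c *\<^sub>C y) = c * B x y"
    and herm: "\<And>x y. B x y = cnj (B y x)"
    and psd: "\<And>x. Re (B x x) \<ge> 0"
  shows "(cmod (B x y))\<^sup>2 \<le> Re (B x x) * Re (B y y)"
proof -
  define b where "b = B x y"
  have add_left: "B (x + y) z = B x z + B y z" for x y z
    by (metis add complex_cnj_add herm)
  have scale_left: "B (c *\<^sub>C x) y = cnj c * B x y" for c x y
    by (metis complex_cnj_mult herm scale)
  \<comment> \<open>Positivity at \<open>y - t b x\<close>, a quadratic in the real parameter \<open>t\<close>.\<close>
  have quad: "0 \<le> t\<^sup>2 * (cmod b)\<^sup>2 * Re (B x x) - 2 * t * (cmod b)\<^sup>2 + Re (B y y)" for t :: real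
  proof -
    define c where "c = - (of_real t * b)"
    have yx: "B y x = cnj b" using herm b_def by metis
    have "B (c *\<^sub>C x + y) (c *\<^sub>C x + y) =
       cnj c * c * B x x + cnj c * b + c * cnj b + B y y"
      by (simp add: add add_left scale scale_left yx b_def[symmetric] algebra_simps)
    also have "cnj c * c = of_real (t\<^sup>2 * (cmod b)\<^sup>2)"
      by (simp only: complex_norm_square of_real_mult of_real_power c_def)
         (simp add: power2_eq_square complex_norm_square[symmetric] algebra_simps)
    also have "cnj c * b = of_real (- t * (cmod b)\<^sup>2)"
      by (simp only: complex_norm_square of_real_mult c_def) (simp add: algebra_simps)
    also have "c * cnj b = of_real (- t * (cmod b)\<^sup>2)"
      by (simp only: complex_norm_square of_real_mult c_def) (simp add: algebra_simps)
    finally have "Re (B (c *\<^sub>C x + y) (c *\<^sub>C x + y)) =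
        t\<^sup>2 * (cmod b)\<^sup>2 * Re (B x x) - 2 * t * (cmod b)\<^sup>2 + Re (B y y)"
      by (simp del: of_real_mult of_real_power)
    then show ?thesis
      using psd by metis
  qed
  show ?thesis
  proof (cases "Re (B x x) = 0")
    case True
    have "b = 0"
    proof (rule ccontr)
      assume "b \<noteq> 0"
      then show False
        \<comment> \<open>Here the quadratic is affine in \<open>t\<close>, and this \<open>t\<close> makes it equal to \<open>- 1\<close>.\<close>
        using quad[of "(Re (B y y) + 1) / (2 * (cmod b)\<^sup>2)"] True by simp
    qed
    then show ?thesis
      using True b_def by simp
  next
    case False
    then have pos: "Re (B x x) > 0" using psd[of x] by simp
    \<comment> \<open>The vertex of the parabola.\<close>
    have "0 \<le> Re (B y y) - (cmod b)\<^sup>2 / Re (B x x)"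
      using quad[of "1 / Re (B x x)"] pos by (simp add: field_simps power2_eq_square)
    then show ?thesis
      using pos by (simp add: b_def field_simps)
  qed
qed

lemma norm_cinner_le: "cmod (cinner x y) \<le> norm x * norm (y::'a::chilbert_space)"
proof -
  have "(cmod (cinner x y))\<^sup>2 \<le> Re (cinner x x) * Re (cinner y y)"
    by (rule semidefinite_form_Cauchy_Schwarz)
       (auto simp: cinner_add_right cinner_scaleC_right cinner_self
             intro: cinner_commute)
  then have "(cmod (cinner x y))\<^sup>2 \<le> (norm x * norm y)\<^sup>2"
    by (simp add: cinner_self power_mult_distrib)
  then show ?thesis
    by (rule power2_le_imp_le) simp
qed

lemma bounded_linear_cinner_right: "bounded_linear (cinner (x::'a::chilbert_space))"
proof (rule bounded_linear_intro[where K = "norm x"])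
  fix r y show "cinner x (r *\<^sub>R y) = r *\<^sub>R cinner x y"
    by (simp add: scaleC_of_real[of r y, symmetric] cinner_scaleC_right scaleR_conv_of_real)
next
  fix y show "norm (cinner x y) \<le> norm y * norm x"
    using norm_cinner_le[of x y] by (simp add: mult.commute)
qed (simp add: cinner_add_right)

lemma cinner_ext: "(\<And>z. cinner z x = cinner z y) \<Longrightarrow> x = (y::'a::chilbert_space)"
  using cinner_self[of "x - y"] cinner_diff_right[of "x - y" x y] by simp

lemma bounded_linear_scaleC_right: "bounded_linear ((*\<^sub>C) c :: 'a::chilbert_space \<Rightarrow> 'a)"
proof (rule bounded_linear_intro[where K = "cmod c"])
  fix r and x :: 'a show "c *\<^sub>C r *\<^sub>R x = r *\<^sub>R c *\<^sub>C x"
    by (simp add: scaleC_of_real[symmetric] scaleC_scaleC mult.commute)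
qed (auto simp: scaleC_add_right)

lemma bounded_clinear_bounded_linear: "bounded_clinear f \<Longrightarrow> bounded_linear f"
  by (simp add: bounded_clinear_def)

lemma bounded_clinear_simps:
  assumes "bounded_clinear f"
  shows "f (x + y) = f x + f y" "f (x - y) = f x - f y" "f (- x) = - f x" "f 0 = 0"
    "f (c *\<^sub>C x) = c *\<^sub>C f x"
  using assms
  by (auto simp: bounded_clinear_def bounded_linear.linear linear_add linear_diff linear_neg linear_0)

lemma bounded_clinear_norm_le: "bounded_clinear f \<Longrightarrow> norm (f x) \<le> onorm f * norm x"
  by (simp add: bounded_clinear_def onorm)

lemma bounded_clinearI:
  assumes "\<And>x y. f (x + y) = f x + f y" "\<And>c x. f (c *\<^sub>C x) = c *\<^sub>C f x"
    and "\<And>x. norm (f x) \<le> K * norm x"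
  shows "bounded_clinear f"
  unfolding bounded_clinear_def
proof
  show "bounded_linear f"
  proof (rule bounded_linear_intro[where K = K])
    fix r x show "f (r *\<^sub>R x) = r *\<^sub>R f x"
      using assms(2)[of "of_real r" x] by (simp add: scaleC_of_real)
    show "norm (f x) \<le> norm x * K" for x using assms(3)[of x] by (simp add: mult.commute)
  qed (use assms in auto)
qed (use assms in auto)

lemma bounded_clinear_const0 [simp]: "bounded_clinear (\<lambda>x. 0)"
  by (rule bounded_clinearI[where K = 0]) auto

lemma bounded_clinear_ident [simp]: "bounded_clinear (\<lambda>x. x)"
  by (rule bounded_clinearI[where K = 1]) auto

lemma bounded_clinear_compose:
  "bounded_clinear f \<Longrightarrow> bounded_clinear g \<Longrightarrow> bounded_clinear (\<lambda>x. f (g x))"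
  by (auto simp: bounded_clinear_def intro: bounded_linear_compose)

lemma bounded_clinear_add:
  "bounded_clinear f \<Longrightarrow> bounded_clinear g \<Longrightarrow> bounded_clinear (\<lambda>x. f x + g x)"
  by (auto simp: bounded_clinear_def scaleC_add_right intro: bounded_linear_add)

lemma bounded_clinear_diff:
  "bounded_clinear f \<Longrightarrow> bounded_clinear g \<Longrightarrow> bounded_clinear (\<lambda>x. f x - g x)"
  by (auto simp: bounded_clinear_def scaleC_diff_right intro: bounded_linear_sub)

lemma bounded_clinear_minus: "bounded_clinear f \<Longrightarrow> bounded_clinear (\<lambda>x. - f x)"
  by (auto simp: bounded_clinear_def scaleC_minus_right intro: bounded_linear_minus)

lemma bounded_clinear_scaleC: "bounded_clinear f \<Longrightarrow> bounded_clinear (\<lambda>x. c *\<^sub>C f x)"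
  by (auto simp: bounded_clinear_def scaleC_scaleC mult.commute
      intro: bounded_linear_compose[OF bounded_linear_scaleC_right])

lemma bounded_clinear_sum:
  "(\<And>i. i \<in> I \<Longrightarrow> bounded_clinear (f i)) \<Longrightarrow> bounded_clinear (\<lambda>x. \<Sum>i\<in>I. f i x)"
  by (induction I rule: infinite_finite_induct) (auto intro: bounded_clinear_add)

section \<open>The closed graph theorem\<close>

text \<open>
  By Baire, the closure of some set \<open>{x. norm (f x) \<le> n}\<close> contains a ball, and by convexity and
  symmetry one about \<open>0\<close>. A point of that ball is then the sum of a series whose images under
  \<open>f\<close> are geometrically small; closedness of the graph identifies the image of the sum.
\<close>

theorem closed_graph_theorem:
  fixes f :: "'b::banach \<Rightarrow> 'a::banach"
  assumes lin: "linear f" and closed_graph: "closed {(x, f x) | x. True}"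
  shows "bounded_linear f"
proof -
  define A where "A n = {x. norm (f x) \<le> n}" for n :: real
  have scaleA: "r *\<^sub>R x \<in> A (\<bar>r\<bar> * n)" if "x \<in> A n" for r x n
    using that by (simp add: A_def linear_scale[OF lin] mult_left_mono)
  have "\<exists>n::nat. interior (closure (A (real n))) \<noteq> {}"
  proof (rule ccontr)
    assume neg: "\<not> ?thesis"
    have "euclidean interior_of (\<Union>n::nat. closure (A (real n))) = {}"
    proof (rule Baire_category_alt)
      show "completely_metrizable_space (euclidean :: 'b topology) \<or>
          locally_compact_space (euclidean :: 'b topology) \<and> regular_space (euclidean :: 'b topology)"
        by (simp add: completely_metrizable_space_euclidean)
      fix T assume "T \<in> range (\<lambda>n::nat. closure (A (real n)))"
      then show "closedin euclidean T \<and> euclidean interior_of T = {}"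
        using neg by auto
    qed simp
    moreover have "(\<Union>n::nat. closure (A (real n))) = UNIV"
    proof -
      have "x \<in> closure (A (real (nat \<lceil>norm (f x)\<rceil>)))" for x
        using closure_subset by (fastforce simp: A_def)
      then show ?thesis by blast
    qed
    ultimately show False by simp
  qed
  then obtain n :: nat and x0 r where r: "r > 0" and ball: "ball x0 r \<subseteq> closure (A (real n))"
    by (meson ex_in_conv mem_interior)
  \<comment> \<open>\<open>N\<close> replaces \<open>n\<close> in order to be positive.\<close>
  define N where "N = real n + 1"
  have N: "N > 0" by (simp add: N_def)
  have ball': "ball x0 r \<subseteq> closure (A N)"
  proof -
    have "A (real n) \<subseteq> A N" by (auto simp: A_def N_def)
    then show ?thesis using ball closure_mono by blast
  qed
  have approx1: "\<exists>y\<in>A N. norm (x - y) < e" if x: "norm x < r" and e: "e > 0" for x e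
  proof -
    have "x0 + x \<in> closure (A N)" "x0 - x \<in> closure (A N)"
      using ball' x by (auto simp: dist_norm subset_iff)
    then obtain u v where uv: "u \<in> A N" "v \<in> A N" "dist u (x0 + x) < e" "dist v (x0 - x) < e"
      using e unfolding closure_approachable by meson
    define y where "y = (1/2) *\<^sub>R (u - v)"
    have "norm (f u - f v) \<le> N + N"
      using uv norm_triangle_ineq4[of "f u" "f v"] by (simp add: A_def)
    then have "y \<in> A N"
      by (simp add: A_def y_def linear_scale[OF lin] linear_diff[OF lin])
    moreover have "x - y = (1/2) *\<^sub>R ((x0 + x - u) - (x0 - x - v))"
      by (simp add: y_def algebra_simps flip: scaleR_add_left)
    then have "norm (x - y) \<le> 1/2 * (norm (x0 + x - u) + norm (x0 - x - v))"
      by (metis norm_scaleR abs_of_pos half_gt_zero_iff mult_le_cancel_left_pos norm_triangle_ineq4 zero_less_one)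
    ultimately show ?thesis
      using uv by (auto simp: dist_norm norm_minus_commute intro!: bexI[of _ y])
  qed
  have approx: "\<exists>y\<in>A (N / 2 ^ k). norm (x - y) < r / 2 ^ Suc k" if x: "norm x < r / 2 ^ k" for x k
  proof -
    have "norm (2 ^ k *\<^sub>R x) < r"
      using x by (simp add: field_simps)
    from approx1[OF this, of "r / 2"] r obtain y
      where y: "y \<in> A N" "norm (2 ^ k *\<^sub>R x - y) < r / 2"
      by auto
    have "x - (1 / 2 ^ k) *\<^sub>R y = (1 / 2 ^ k) *\<^sub>R (2 ^ k *\<^sub>R x - y)"
      by (simp add: algebra_simps)
    then have "norm (x - (1 / 2 ^ k) *\<^sub>R y) = norm (2 ^ k *\<^sub>R x - y) / 2 ^ k"
      by (metis (no_types, lifting) abs_of_nonneg divide_inverse inverse_eq_divide mult.commute norm_scaleR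
          zero_le_divide_1_iff zero_le_numeral zero_le_power)
    also have "\<dots> < r / 2 ^ Suc k"
      using y(2) by (simp add: field_simps)
    finally show ?thesis
      using scaleA[OF y(1), of "1 / 2 ^ k"] by (auto intro!: bexI[of _ "(1 / 2 ^ k) *\<^sub>R y"])
  qed
  have bound: "norm (f x) \<le> 2 * N" if x: "norm x < r" for x
  proof -
    \<comment> \<open>\<open>s k\<close> is the remainder of \<open>x\<close> after \<open>k\<close> approximation steps.\<close>
    have "\<exists>s. s 0 = x \<and> (\<forall>k. norm (s k) < r / 2 ^ k \<and> s k - s (Suc k) \<in> A (N / 2 ^ k))"
    proof -
      have "\<exists>s. \<forall>k. (norm (s k) < r / 2 ^ k \<and> (k = 0 \<longrightarrow> s k = x)) \<and> s k - s (Suc k) \<in> A (N / 2 ^ k)"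
      proof (rule dependent_nat_choice)
        show "\<exists>y. norm y < r / 2 ^ 0 \<and> (0 = (0::nat) \<longrightarrow> y = x)" using x by auto
        fix z :: 'b and k :: nat assume "norm z < r / 2 ^ k \<and> (k = 0 \<longrightarrow> z = x)"
        then obtain y where "y \<in> A (N / 2 ^ k)" "norm (z - y) < r / 2 ^ Suc k"
          using approx by blast
        then show "\<exists>z'. (norm z' < r / 2 ^ Suc k \<and> (Suc k = 0 \<longrightarrow> z' = x)) \<and> z - z' \<in> A (N / 2 ^ k)"
          by (auto intro!: exI[of _ "z - y"])
      qed
      then show ?thesis by blast
    qed
    then obtain s where s0: "s 0 = x" and s: "\<And>k. norm (s k) < r / 2 ^ k"
      and sA: "\<And>k. s k - s (Suc k) \<in> A (N / 2 ^ k)" by blast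
    define d where "d k = f (s k - s (Suc k))" for k
    have dle: "norm (d k) \<le> N * (1/2) ^ k" for k
      using sA[of k] by (simp add: A_def d_def power_one_over field_simps)
    have sum_bound: "summable (\<lambda>k. N * (1/2) ^ k)"
      by (intro summable_mult summable_geometric) simp
    have smd: "summable d"
      by (rule summable_comparison_test'[OF sum_bound dle])
    have partial: "(\<Sum>k<m. d k) = f (x - s m)" for m
      by (induction m) (simp_all add: s0 d_def linear_diff[OF lin] linear_0[OF lin])
    have "(\<lambda>m. f (x - s m)) \<longlonglongrightarrow> suminf d"
      using summable_LIMSEQ[OF smd] by (simp add: partial)
    moreover have "s \<longlonglongrightarrow> 0"
    proof (rule Lim_null_comparison)
      show "eventually (\<lambda>k. norm (s k) \<le> r * (1/2) ^ k) sequentially"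
        using s by (auto simp: less_imp_le power_one_over field_simps intro!: always_eventually)
      show "(\<lambda>k. r * (1 / 2) ^ k) \<longlonglongrightarrow> 0"
        by (intro tendsto_mult_right_zero LIMSEQ_power_zero) simp
    qed
    then have "(\<lambda>m. x - s m) \<longlonglongrightarrow> x - 0" by (intro tendsto_intros)
    ultimately have "(\<lambda>m. (x - s m, f (x - s m))) \<longlonglongrightarrow> (x, suminf d)"
      by (auto intro: tendsto_Pair)
    then have "(x, suminf d) \<in> {(x, f x) | x. True}"
      by (rule closed_sequentially[OF closed_graph, rotated]) auto
    then have "f x = suminf d" by auto
    also have "norm \<dots> \<le> (\<Sum>k. N * (1/2) ^ k)"
      by (rule norm_suminf_le[OF dle sum_bound])
    also have "\<dots> = 2 * N"
      by (simp add: suminf_mult suminf_geometric)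
    finally show ?thesis .
  qed
  show ?thesis
  proof (rule bounded_linear_intro[where K = "4 * N / r"])
    fix x
    show "norm (f x) \<le> norm x * (4 * N / r)"
    proof (cases "x = 0")
      case False
      define c where "c = r / (2 * norm x)"
      have c: "c > 0" using False r by (simp add: c_def)
      have "norm (c *\<^sub>R x) < r" using False r by (simp add: c_def)
      from bound[OF this] have "c * norm (f x) \<le> 2 * N"
        using c by (simp add: linear_scale[OF lin])
      then have "norm (f x) \<le> 2 * N / c"
        using c by (simp add: field_simps)
      then show ?thesis by (simp add: c_def mult_ac)
    qed (simp add: linear_0[OF lin])
  qed (auto simp: linear_add[OF lin] linear_scale[OF lin])
qed

section \<open>Closed operators and the Sylvester operator\<close>

lemma cdd_simps:
  assumes "closed_densely_defined D L"
  shows "0 \<in> D" "x \<in> D \<Longrightarrow> y \<in> D \<Longrightarrow> x + y \<in> D"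
    "x \<in> D \<Longrightarrow> y \<in> D \<Longrightarrow> L (x + y) = L x + L y"
    "x \<in> D \<Longrightarrow> c *\<^sub>C x \<in> D" "x \<in> D \<Longrightarrow> L (c *\<^sub>C x) = c *\<^sub>C L x"
  using assms unfolding closed_densely_defined_def by blast+

lemma cdd_closed_graph:
  assumes "closed_densely_defined D L" "\<And>n. u n \<in> D" "u \<longlonglongrightarrow> x" "(\<lambda>n. L (u n)) \<longlonglongrightarrow> y"
  shows "x \<in> D \<and> L x = y"
proof -
  have "closed {(x, L x) | x. x \<in> D}" using assms by (simp add: closed_densely_defined_def)
  then have "(x, y) \<in> {(x, L x) | x. x \<in> D}"
    by (rule closed_sequentially[where f = "\<lambda>n. (u n, L (u n))"])
       (use assms in \<open>auto intro: tendsto_Pair\<close>)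
  then show ?thesis by auto
qed

lemma cdd_bounded_clinear:
  fixes L :: "'a::chilbert_space \<Rightarrow> 'a"
  assumes "bounded_clinear L"
  shows "closed_densely_defined UNIV L"
proof -
  have cont: "continuous_on UNIV L"
    using assms by (simp add: bounded_clinear_bounded_linear linear_continuous_on)
  have "closed {p. snd p = L (fst p)}"
    by (rule closed_Collect_eq) (auto intro!: continuous_on_snd continuous_on_id continuous_on_compose2[OF cont] continuous_on_fst)
  also have "{p. snd p = L (fst p)} = {(x, L x) | x. x \<in> UNIV}"
  proof (rule set_eqI)
    fix p show "p \<in> {p. snd p = L (fst p)} \<longleftrightarrow> p \<in> {(x, L x) | x. x \<in> UNIV}"
      by (cases p) simp
  qed
  finally have "closed {(x, L x) | x. x \<in> UNIV}" .
  moreover have "closure UNIV = (UNIV :: 'a set)" by simp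
  ultimately show ?thesis
    unfolding closed_densely_defined_def
    by (intro conjI ballI allI UNIV_I bounded_clinear_simps[OF assms])
qed

lemma bounded_opsD:
  "S \<in> bounded_ops D \<Longrightarrow> bounded_clinear S" "S \<in> bounded_ops D \<Longrightarrow> S x \<in> D"
  by (auto simp: bounded_ops_def)

text \<open>
  That \<open>sylvester L1 L2 S\<close> is bounded is not immediate, since \<open>L1\<close> may be unbounded. But \<open>L1 \<circ> S\<close> is
  everywhere defined and inherits a closed graph from \<open>L1\<close>.
\<close>

lemma sylvester_bounded:
  fixes S :: "'b::chilbert_space \<Rightarrow> 'a::chilbert_space"
  assumes L1: "closed_densely_defined D1 L1" and L2: "bounded_clinear L2" and S: "S \<in> bounded_ops D1"
  shows "bounded_clinear (sylvester L1 L2 S)"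
proof -
  note S' = bounded_clinear_simps[OF bounded_opsD(1)[OF S]] bounded_opsD(2)[OF S]
  have scale: "L1 (S (c *\<^sub>C x)) = c *\<^sub>C L1 (S x)" for c x
    by (simp add: S' cdd_simps[OF L1])
  have lin: "linear (\<lambda>x. L1 (S x))"
  proof (rule linearI)
    fix r x show "L1 (S (r *\<^sub>R x)) = r *\<^sub>R L1 (S x)"
      using scale[of "of_real r" x] by (simp only: scaleC_of_real)
  qed (simp add: S' cdd_simps[OF L1])
  have "bounded_linear (\<lambda>x. L1 (S x))"
  proof (rule closed_graph_theorem[OF lin])
    show "closed {(x, L1 (S x)) | x. True}"
      unfolding closed_sequential_limits
    proof (intro allI impI, elim conjE)
      fix u :: "nat \<Rightarrow> 'b \<times> 'a" and l
      assume u: "\<forall>n. u n \<in> {(x, L1 (S x)) | x. True}" and lim: "u \<longlonglongrightarrow> l"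
      have u2: "snd (u n) = L1 (S (fst (u n)))" for n
        using u by (auto dest!: spec[of _ n])
      have "(\<lambda>n. S (fst (u n))) \<longlonglongrightarrow> S (fst l)"
        using bounded_linear.tendsto[OF bounded_clinear_bounded_linear[OF bounded_opsD(1)[OF S]] tendsto_fst[OF lim]] .
      moreover have "(\<lambda>n. L1 (S (fst (u n)))) \<longlonglongrightarrow> snd l"
        using tendsto_snd[OF lim] by (simp add: u2)
      ultimately have "L1 (S (fst l)) = snd l"
        using cdd_closed_graph[OF L1, of "\<lambda>n. S (fst (u n))"] S'(6) by blast
      then show "l \<in> {(x, L1 (S x)) | x. True}"
        by (cases l) simp
    qed
  qed
  then have "bounded_clinear (\<lambda>x. L1 (S x))"
    by (simp add: bounded_clinear_def scale)
  then show ?thesis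
    unfolding sylvester_def
    by (intro bounded_clinear_diff bounded_clinear_compose[OF bounded_opsD(1)[OF S] L2])
qed

section \<open>The lower bound by numerical ranges\<close>

lemma near_maximizer_onorm:
  fixes S :: "'b::chilbert_space \<Rightarrow> 'a::chilbert_space"
  assumes S: "bounded_clinear S" and e: "0 \<le> e" "e < onorm S"
  shows "\<exists>x. norm x = 1 \<and> e < norm (S x)"
proof -
  obtain x where x: "e * norm x < norm (S x)"
    using onorm_bound[OF e(1), of S] e(2) by (meson not_le)
  then have "x \<noteq> 0" using bounded_clinear_simps(4)[OF S] by auto
  then have "norm ((1 / norm x) *\<^sub>R x) = 1" "e < norm (S ((1 / norm x) *\<^sub>R x))"
    using x by (simp_all add: linear_scale[OF bounded_linear.linear[OF bounded_clinear_bounded_linear[OF S]]] field_simps)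
  then show ?thesis by blast
qed

text \<open>
  Let \<open>x\<close> be a unit vector nearly maximising \<open>norm (S x)\<close>, and put \<open>s = onorm S\<close>. Then \<open>S\<^sup>* S x\<close> is
  close to \<open>s\<^sup>2 x\<close>, so \<open>\<langle>S x, S L2 x\<rangle>\<close> is close to \<open>s\<^sup>2 \<langle>x, L2 x\<rangle>\<close>, and
  \<open>\<langle>S x, (L1 S - S L2) x\<rangle>\<close> is close to \<open>s\<^sup>2\<close> times a difference of two points of the numerical
  ranges. The Cauchy--Schwarz inequality for the form \<open>s\<^sup>2 \<langle>x, y\<rangle> - \<langle>S x, S y\<rangle>\<close> makes this precise
  without the adjoint.
\<close>

lemma sep_ge_setdist_numerical_range:
  fixes D1 :: "'a::chilbert_space set" and L2 :: "'b::chilbert_space \<Rightarrow> 'b"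
  assumes L1: "closed_densely_defined D1 L1" and L2: "bounded_clinear L2"
  shows "sep D1 L1 L2 \<ge> ereal (setdist (numerical_range D1 L1) (numerical_range UNIV L2))"
  unfolding sep_def
proof (rule INF_greatest)
  fix S :: "'b \<Rightarrow> 'a" assume "S \<in> bounded_ops D1 - {\<lambda>_. 0}"
  then have S: "S \<in> bounded_ops D1" "S \<noteq> (\<lambda>_. 0)" by auto
  note Sb = bounded_opsD(1)[OF S(1)]
  define T where "T = sylvester L1 L2 S"
  define s where "s = onorm S"
  define t where "t = onorm T"
  define l where "l = onorm L2"
  define \<Delta> where "\<Delta> = setdist (numerical_range D1 L1) (numerical_range UNIV L2)"
  have T: "bounded_clinear T"
    unfolding T_def using sylvester_bounded[OF L1 L2 S(1)] .
  have s: "s > 0"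
    using S onorm_pos_lt[OF bounded_clinear_bounded_linear[OF Sb]] by (auto simp: s_def fun_eq_iff)
  have \<Delta>0: "\<Delta> \<ge> 0" by (simp add: \<Delta>_def)
  have l0: "l \<ge> 0" unfolding l_def using L2 by (simp add: bounded_clinear_def onorm_pos_le)
  define B where "B x y = of_real (s\<^sup>2) * cinner x y - cinner (S x) (S y)" for x y
  have key: "\<Delta> * (s\<^sup>2 - h) \<le> s * t + l * h + s * l * sqrt h" and h0: "h \<ge> 0"
    if x: "norm x = 1" "S x \<noteq> 0" and h: "h = s\<^sup>2 - (norm (S x))\<^sup>2" for x h
  proof -
    have "norm (S x) \<le> s"
      using bounded_clinear_norm_le[OF Sb, of x] x by (simp add: s_def)
    then show h0: "h \<ge> 0" by (simp add: h power_mono)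
    define w1 where "w1 = cinner (S x) (L1 (S x)) / cinner (S x) (S x)"
    define w2 where "w2 = cinner x (L2 x)"
    have w2: "w2 \<in> numerical_range UNIV L2" unfolding numerical_range_def
      using x by (auto simp: w2_def cinner_self intro!: exI[of _ x])
    have w1: "w1 \<in> numerical_range D1 L1" unfolding numerical_range_def
      using x bounded_opsD(2)[OF S(1)] by (auto simp: w1_def)
    have dist: "\<Delta> \<le> cmod (w1 - w2)"
      unfolding \<Delta>_def using setdist_le_dist[OF w1 w2] by (simp add: dist_norm)
    have Bxx: "Re (B y y) = s\<^sup>2 * (norm y)\<^sup>2 - (norm (S y))\<^sup>2" for y
      by (simp add: B_def cinner_self)
    have nS: "norm (S y) \<le> s * norm y" for y
      using bounded_clinear_norm_le[OF Sb] by (simp add: s_def)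
    have lx: "norm (L2 x) \<le> l" using bounded_clinear_norm_le[OF L2, of x] x by (simp add: l_def)
    have "(cmod (B x (L2 x)))\<^sup>2 \<le> Re (B x x) * Re (B (L2 x) (L2 x))"
    proof (rule semidefinite_form_Cauchy_Schwarz)
      fix x y show "B x y = cnj (B y x)"
        using cinner_commute[of x y] cinner_commute[of "S x" "S y"] by (simp add: B_def)
      show "0 \<le> Re (B x x)"
        using power_mono[OF nS[of x], of 2] by (simp add: Bxx power_mult_distrib)
    qed (simp_all add: B_def bounded_clinear_simps[OF Sb] cinner_add_right cinner_scaleC_right algebra_simps)
    also have "\<dots> \<le> h * (s * l)\<^sup>2"
    proof (rule mult_mono)
      show "Re (B x x) \<le> h" by (simp add: Bxx x h)
      have "Re (B (L2 x) (L2 x)) \<le> s\<^sup>2 * (norm (L2 x))\<^sup>2" by (simp add: Bxx)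
      also have "\<dots> \<le> (s * l)\<^sup>2" using lx s by (simp add: power_mult_distrib mult_left_mono power_mono)
      finally show "Re (B (L2 x) (L2 x)) \<le> (s * l)\<^sup>2" .
      show "0 \<le> Re (B (L2 x) (L2 x))"
        using power_mono[OF nS[of "L2 x"], of 2] by (simp add: Bxx power_mult_distrib)
    qed (use h0 in auto)
    also have "\<dots> = (s * l * sqrt h)\<^sup>2" using h0 by (simp add: power_mult_distrib)
    finally have Bx: "cmod (B x (L2 x)) \<le> s * l * sqrt h"
      by (rule power2_le_imp_le) (use s l0 h0 in auto)
    have w2l: "cmod w2 \<le> l" using norm_cinner_le[of x "L2 x"] x lx by (simp add: w2_def)
    \<comment> \<open>Both quadratic forms are compared with \<open>(norm (S x))\<^sup>2\<close>, at the cost of the defect \<open>h\<close>.\<close>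
    have "cinner (S x) (T x) = w1 * of_real ((norm (S x))\<^sup>2) - cinner (S x) (S (L2 x))"
      using x by (simp add: T_def sylvester_def cinner_diff_right w1_def cinner_self)
    also have "\<dots> = (w1 - w2) * of_real ((norm (S x))\<^sup>2) - w2 * of_real h + B x (L2 x)"
      by (simp add: B_def h w2_def algebra_simps)
    finally have "(w1 - w2) * of_real ((norm (S x))\<^sup>2) = cinner (S x) (T x) + w2 * of_real h - B x (L2 x)"
      by (simp add: algebra_simps)
    then have "cmod (w1 - w2) * (norm (S x))\<^sup>2 = cmod (cinner (S x) (T x) + w2 * of_real h - B x (L2 x))"
      by (metis norm_mult norm_of_real abs_of_nonneg zero_le_power2)
    also have "\<dots> \<le> cmod (cinner (S x) (T x)) + cmod (w2 * of_real h) + cmod (B x (L2 x))"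
      by (rule norm_triangle_le_diff) (intro add_right_mono norm_triangle_ineq)
    also have "\<dots> \<le> s * t + l * h + s * l * sqrt h"
    proof (intro add_mono Bx)
      have "cmod (cinner (S x) (T x)) \<le> norm (S x) * norm (T x)" by (rule norm_cinner_le)
      also have "\<dots> \<le> s * t"
        using nS[of x] bounded_clinear_norm_le[OF T, of x] x s by (intro mult_mono) (auto simp: t_def)
      finally show "cmod (cinner (S x) (T x)) \<le> s * t" .
      show "cmod (w2 * of_real h) \<le> l * h" using w2l h0 by (simp add: norm_mult mult_right_mono)
    qed
    finally have "cmod (w1 - w2) * (norm (S x))\<^sup>2 \<le> s * t + l * h + s * l * sqrt h" .
    moreover have "\<Delta> * (norm (S x))\<^sup>2 \<le> cmod (w1 - w2) * (norm (S x))\<^sup>2"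
      using dist by (simp add: mult_right_mono)
    ultimately show "\<Delta> * (s\<^sup>2 - h) \<le> s * t + l * h + s * l * sqrt h"
      by (simp add: h)
  qed
  have "\<exists>x. norm x = 1 \<and> s - s * inverse (real (Suc n)) < norm (S x)" for n :: nat
    by (rule near_maximizer_onorm[OF Sb]) (use s in \<open>simp_all add: field_simps flip: s_def\<close>)
  then obtain x where x: "\<And>n::nat. norm (x n) = 1" "\<And>n. s - s * inverse (real (Suc n)) < norm (S (x n))" by metis
  have Sx0: "S (x n) \<noteq> 0" for n
  proof -
    have "0 \<le> s - s * inverse (real (Suc n))" using s by (simp add: field_simps)
    then show ?thesis using x(2)[of n] by auto
  qed
  have lim: "(\<lambda>n. norm (S (x n))) \<longlonglongrightarrow> s"
  proof (rule tendsto_sandwich)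
    show "(\<lambda>n. s - s * inverse (real (Suc n))) \<longlonglongrightarrow> s" using tendsto_diff[OF tendsto_const tendsto_mult[OF tendsto_const LIMSEQ_inverse_real_of_nat], of s s] by simp
    show "(\<lambda>n. s) \<longlonglongrightarrow> s" by simp
    show "\<forall>\<^sub>F n in sequentially. norm (S (x n)) \<le> s"
      using bounded_clinear_norm_le[OF Sb, of "x _"] x(1) by (simp add: s_def)
  qed (use x(2) in \<open>auto intro!: always_eventually less_imp_le\<close>)
  define h where "h n = s\<^sup>2 - (norm (S (x n)))\<^sup>2" for n
  have "(\<lambda>n. s\<^sup>2 - (norm (S (x n)))\<^sup>2) \<longlonglongrightarrow> s\<^sup>2 - s\<^sup>2" by (intro tendsto_intros lim)
  then have hlim: "h \<longlonglongrightarrow> 0" by (simp add: h_def[abs_def])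
  have "\<Delta> * (s\<^sup>2 - 0) \<le> s * t + l * 0 + s * l * sqrt 0"
  proof (rule LIMSEQ_le)
    show "(\<lambda>n. \<Delta> * (s\<^sup>2 - h n)) \<longlonglongrightarrow> \<Delta> * (s\<^sup>2 - 0)" by (intro tendsto_intros hlim)
    show "(\<lambda>n. s * t + l * h n + s * l * sqrt (h n)) \<longlonglongrightarrow> s * t + l * 0 + s * l * sqrt 0"
      by (intro tendsto_intros hlim)
    show "\<exists>N. \<forall>n\<ge>N. \<Delta> * (s\<^sup>2 - h n) \<le> s * t + l * h n + s * l * sqrt (h n)"
      using key[OF x(1) Sx0 h_def] by blast
  qed
  then have "\<Delta> * s \<le> t"
    using s by (simp add: power2_eq_square mult.left_commute)
  then show "ereal \<Delta> \<le> ereal (onorm (sylvester L1 L2 S) / onorm S)"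
    using s by (simp add: t_def s_def T_def pos_le_divide_eq)
qed

section \<open>Rectifiable paths\<close>

lemma partition01_mono:
  assumes "partition01 n t" "i \<le> j" "j \<le> n"
  shows "t i \<le> t j"
  using assms(2,3) by (induction j) (use assms(1) in \<open>auto simp: partition01_def le_Suc_eq intro: order_trans\<close>)

lemma partition01_in:
  assumes "partition01 n t" "i \<le> n" shows "t i \<in> {0..1}"
  using partition01_mono[OF assms(1), of 0 i] partition01_mono[OF assms(1), of i n] assms
  by (auto simp: partition01_def)

lemma inscribed_length_le:
  assumes "rectifiable_path \<gamma>" "partition01 n t"
  shows "(\<Sum>i<n. dist (\<gamma> (t i)) (\<gamma> (t (Suc i)))) \<le> arc_length \<gamma>"
  unfolding arc_length_def
  by (rule cSup_upper) (use assms in \<open>auto simp: rectifiable_path_def inscribed_lengths_def\<close>)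

lemma arc_length_nonneg:
  assumes "rectifiable_path \<gamma>"
  shows "0 \<le> arc_length \<gamma>"
proof -
  have "partition01 1 real" by (simp add: partition01_def)
  from inscribed_length_le[OF assms this] show ?thesis
    by (rule order_trans[rotated]) (simp add: sum_nonneg)
qed

lemma lipschitz_rectifiable:
  assumes "lipschitz_on C {0..1} \<gamma>"
  shows "rectifiable_path \<gamma>"
proof -
  have "(\<Sum>i<n. dist (\<gamma> (t i)) (\<gamma> (t (Suc i)))) \<le> C" if p: "partition01 n t" for n t
  proof -
    have "(\<Sum>i<n. dist (\<gamma> (t i)) (\<gamma> (t (Suc i)))) \<le> (\<Sum>i<n. C * (t (Suc i) - t i))"
    proof (rule sum_mono)
      fix i assume i: "i \<in> {..<n}"
      then have "dist (\<gamma> (t i)) (\<gamma> (t (Suc i))) \<le> C * dist (t i) (t (Suc i))"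
        using partition01_in[OF p] by (intro lipschitz_onD[OF assms]) auto
      then show "dist (\<gamma> (t i)) (\<gamma> (t (Suc i))) \<le> C * (t (Suc i) - t i)"
        using p i by (simp add: dist_real_def partition01_def)
    qed
    also have "\<dots> = C * (t n - t 0)"
      by (simp add: sum_lessThan_telescope flip: sum_distrib_left)
    finally show ?thesis using p by (simp add: partition01_def)
  qed
  then have "bdd_above (inscribed_lengths \<gamma>)"
    by (auto simp: inscribed_lengths_def intro!: bdd_aboveI[of _ C])
  then show ?thesis
    using lipschitz_on_continuous_on[OF assms] by (simp add: rectifiable_path_def path_def)
qed

section \<open>Cycles in balanced directed graphs\<close>

text \<open>
  Edges of a directed graph are abstract; \<open>s\<close> and \<open>t\<close> give source and target. A set of edges is
  balanced if every vertex occurs equally often as a source and as a target, that is, if the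
  multisets of sources and of targets agree. In this form balance survives the removal of a cycle
  by cancellation of multisets.
\<close>

definition walk :: "('e \<Rightarrow> 'v) \<Rightarrow> ('e \<Rightarrow> 'v) \<Rightarrow> 'e list \<Rightarrow> bool"
  where "walk s t es \<longleftrightarrow> (\<forall>i. Suc i < length es \<longrightarrow> t (es ! i) = s (es ! Suc i))"

definition simple_cycle :: "('e \<Rightarrow> 'v) \<Rightarrow> ('e \<Rightarrow> 'v) \<Rightarrow> 'e list \<Rightarrow> bool"
  where "simple_cycle s t es \<longleftrightarrow> es \<noteq> [] \<and> walk s t es \<and> t (last es) = s (hd es) \<and> distinct (map s es)"

lemma walk_Cons: "walk s t (e # es) \<longleftrightarrow> (es \<noteq> [] \<longrightarrow> t e = s (hd es)) \<and> walk s t es"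
  unfolding walk_def by (cases es) (auto simp: nth_Cons split: nat.splits)

lemma walk_targets: "walk s t (e # es) \<Longrightarrow> map t (e # es) = map s es @ [t (last (e # es))]"
  by (induction es arbitrary: e) (auto simp: walk_Cons)

text \<open>
  The targets of a cycle are its sources, rotated by one place.
\<close>

lemma simple_cycle_balanced:
  assumes "simple_cycle s t es"
  shows "image_mset t (mset es) = image_mset s (mset es)"
proof -
  obtain e fs where es: "es = e # fs" using assms by (cases es) (auto simp: simple_cycle_def)
  have "map t es = map s fs @ [s e]"
    using walk_targets[of s t e fs] assms by (simp add: es simple_cycle_def)
  then have "mset (map t es) = mset (map s es)" by (simp add: es)
  then show ?thesis by simp
qed

text \<open>
  Extend a walk with distinct sources as long as possible. The last edge has a successor by
  balance, and maximality makes the successor start at the source of an edge of the walk, where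
  the cycle closes.
\<close>

lemma balanced_has_simple_cycle:
  assumes fin: "finite E" and ne: "E \<noteq> {}"
    and bal: "image_mset t (mset_set E) = image_mset s (mset_set E)"
  obtains es where "simple_cycle s t es" "set es \<subseteq> E"
proof -
  have sub: "t ` E = s ` E"
    using arg_cong[OF bal, of set_mset] fin by simp
  define W where "W = {es. es \<noteq> [] \<and> set es \<subseteq> E \<and> walk s t es \<and> distinct (map s es)}"
  have "W \<subseteq> {es. set es \<subseteq> E \<and> length es \<le> card E}"
    using fin by (auto simp: W_def distinct_map card_mono simp flip: distinct_card)
  then have "finite W"
    by (rule finite_subset) (rule finite_lists_length_le[OF fin])
  moreover obtain e where "e \<in> E" using ne by blast
  then have "[e] \<in> W" by (simp add: W_def walk_def)
  ultimately obtain es where es: "es \<in> W" and max: "\<And>fs. fs \<in> W \<Longrightarrow> length fs \<le> length es"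
    using Max_in[of "length ` W"] Max_ge[of "length ` W"] by (metis (no_types, lifting) empty_iff finite_imageI image_iff image_is_empty)
  have es': "es \<noteq> []" "set es \<subseteq> E" "walk s t es" "distinct (map s es)"
    using es by (auto simp: W_def)
  have "t (last es) \<in> s ` E"
    using es' sub by (metis image_eqI last_in_set subsetD)
  then obtain f where f: "f \<in> E" "t (last es) = s f" by auto
  have "\<exists>i<length es. s (es ! i) = s f"
  proof (rule ccontr)
    assume neg: "\<not> ?thesis"
    then have "s f \<notin> s ` set es" by (metis imageE in_set_conv_nth)
    moreover have "walk s t (es @ [f])"
      unfolding walk_def
    proof (intro allI impI)
      fix i assume "Suc i < length (es @ [f])"
      then show "t ((es @ [f]) ! i) = s ((es @ [f]) ! Suc i)"
      proof (cases "Suc i = length es")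
        case True
        then have "i = length es - 1" by simp
        with True show ?thesis using es'(1) f(2) by (simp add: nth_append last_conv_nth)
      qed (use es'(3) in \<open>auto simp: walk_def nth_append\<close>)
    qed
    ultimately have "es @ [f] \<in> W" using es' f by (auto simp: W_def)
    from max[OF this] show False by simp
  qed
  then obtain i where i: "i < length es" "s (es ! i) = s f" by auto
  have "simple_cycle s t (drop i es)"
    unfolding simple_cycle_def
  proof (intro conjI)
    show "walk s t (drop i es)" using es'(3) by (auto simp: walk_def)
    show "distinct (map s (drop i es))" using es'(4) by (metis distinct_drop drop_map)
    show "t (last (drop i es)) = s (hd (drop i es))"
      using i f by (simp add: hd_drop_conv_nth)
  qed (use i in auto)
  moreover have "set (drop i es) \<subseteq> E" using es'(2) set_drop_subset by fast
  ultimately show ?thesis using that by blast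
qed

text \<open>
  Split off a simple cycle; what remains is balanced and has fewer edges.
\<close>

lemma balanced_cycle_decomposition:
  assumes "finite E" "image_mset t (mset_set E) = image_mset s (mset_set E)"
  shows "\<exists>Cs. (\<forall>C\<in>set Cs. simple_cycle s t C) \<and> distinct (concat Cs) \<and> set (concat Cs) = E"
  using assms
proof (induction "card E" arbitrary: E rule: less_induct)
  case less
  show ?case
  proof (cases "E = {}")
    case True then show ?thesis by (intro exI[of _ "[]"]) simp
  next
    case False
    then obtain C where C: "simple_cycle s t C" "set C \<subseteq> E"
      using balanced_has_simple_cycle less.prems by metis
    have dC: "distinct C" using C by (simp add: simple_cycle_def distinct_map)
    have split: "mset_set E = mset_set (E - set C) + mset C"
      using C(2) less.prems(1) dC
      by (metis finite_set mset_set_Diff mset_set_set subset_imp_msubset_mset_set subset_mset.diff_add)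
    have "image_mset t (mset_set (E - set C)) = image_mset s (mset_set (E - set C))"
      using less.prems(2) simple_cycle_balanced[OF C(1)] by (simp add: split)
    moreover have "card (E - set C) < card E"
    proof (rule psubset_card_mono)
      obtain c where "c \<in> set C" using C by (cases C) (auto simp: simple_cycle_def)
      then show "E - set C \<subset> E" using C(2) by blast
    qed (use less.prems in simp)
    ultimately obtain Cs where Cs: "\<forall>C\<in>set Cs. simple_cycle s t C" "distinct (concat Cs)"
        "set (concat Cs) = E - set C"
      using less.hyps[of "E - set C"] less.prems(1) by auto
    then show ?thesis
      using C dC by (intro exI[of _ "C # Cs"]) auto
  qed
qed

section \<open>Lattice edges and polygons\<close>

text \<open>
  A directed edge of the integer lattice is encoded by the unit square to its left, named by its
  lower left corner, and the number of the side of that square, counted anticlockwise from the bottom.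
  Each directed edge has exactly one such code, and the boundary of the square \<open>q\<close> consists of the
  edges \<open>(q, 0), \<dots>, (q, 3)\<close>. The edge \<open>grev e\<close> is \<open>e\<close> reversed, so that \<open>fst (grev e)\<close> is the
  square to the right of \<open>e\<close>.
\<close>

type_synonym grid_edge = "(int \<times> int) \<times> nat"

fun gsrc :: "grid_edge \<Rightarrow> int \<times> int" where
  "gsrc ((m, n), k) = (if k = 0 then (m, n) else if k = 1 then (m + 1, n)
     else if k = 2 then (m + 1, n + 1) else (m, n + 1))"

fun gtgt :: "grid_edge \<Rightarrow> int \<times> int" where
  "gtgt ((m, n), k) = (if k = 0 then (m + 1, n) else if k = 1 then (m + 1, n + 1)
     else if k = 2 then (m, n + 1) else (m, n))"

fun grev :: "grid_edge \<Rightarrow> grid_edge" where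
  "grev ((m, n), k) = (if k = 0 then ((m, n - 1), 2) else if k = 1 then ((m + 1, n), 3)
     else if k = 2 then ((m, n + 1), 0) else ((m - 1, n), 1))"

definition gpt :: "real \<Rightarrow> int \<times> int \<Rightarrow> complex" where
  "gpt \<delta> v = Complex (\<delta> * of_int (fst v)) (\<delta> * of_int (snd v))"

lemma less_4_cases: "k < (4::nat) \<longleftrightarrow> k = 0 \<or> k = 1 \<or> k = 2 \<or> k = 3" by auto

lemma grev_props:
  assumes "snd e < 4"
  shows "grev (grev e) = e" "gsrc (grev e) = gtgt e" "gtgt (grev e) = gsrc e" "snd (grev e) < 4"
  using assms by (cases e rule: grev.cases; auto simp: less_4_cases)+

lemma grid_edge_inj:
  assumes "snd e < 4" "snd f < 4" "gsrc e = gsrc f" "gtgt e = gtgt f"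
  shows "e = f"
  using assms by (cases e rule: grev.cases; cases f rule: grev.cases) (auto simp: less_4_cases)

definition gseg :: "real \<Rightarrow> grid_edge \<Rightarrow> complex set" where
  "gseg \<delta> e = closed_segment (gpt \<delta> (gsrc e)) (gpt \<delta> (gtgt e))"

lemma gpt_inj: "\<delta> > 0 \<Longrightarrow> gpt \<delta> u = gpt \<delta> v \<longleftrightarrow> u = v"
  by (auto simp: gpt_def prod_eq_iff)

lemma gseg_shape:
  assumes d: "\<delta> > 0" and e: "snd e < 4" and z: "z \<in> gseg \<delta> e"
  shows "\<exists>m n. {gsrc e, gtgt e} = {(m, n), (m + 1, n)} \<and>
      Im z = \<delta> * of_int n \<and> \<delta> * of_int m \<le> Re z \<and> Re z \<le> \<delta> * (of_int m + 1) \<or>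
    {gsrc e, gtgt e} = {(m, n), (m, n + 1)} \<and>
      Re z = \<delta> * of_int m \<and> \<delta> * of_int n \<le> Im z \<and> Im z \<le> \<delta> * (of_int n + 1)"
proof -
  obtain m n k where ek: "e = ((m, n), k)" by (metis prod.collapse)
  have le: "\<delta> * of_int i \<le> \<delta> * (of_int i + 1)" for i :: int using d by simp
  have neg: "\<not> \<delta> * (of_int i + 1) \<le> \<delta> * of_int i" for i :: int using d by simp
  have "k < 4" using e ek by simp
  then consider "k = 0" | "k = 1" | "k = 2" | "k = 3" by (auto simp: less_4_cases)
  then show ?thesis
  proof cases
    case 1 then show ?thesis using le z
      by (intro exI[of _ m] exI[of _ n] disjI1)
         (auto simp: ek gseg_def gpt_def closed_segment_same_Im closed_segment_eq_real_ivl)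
  next
    case 2 then show ?thesis using le z
      by (intro exI[of _ "m + 1"] exI[of _ n] disjI2)
         (auto simp: ek gseg_def gpt_def closed_segment_same_Re closed_segment_eq_real_ivl)
  next
    case 3 then show ?thesis using neg z
      by (intro exI[of _ m] exI[of _ "n + 1"] disjI1)
         (auto simp: ek gseg_def gpt_def closed_segment_same_Im closed_segment_eq_real_ivl)
  next
    case 4 then show ?thesis using neg z
      by (intro exI[of _ m] exI[of _ n] disjI2)
         (auto simp: ek gseg_def gpt_def closed_segment_same_Re closed_segment_eq_real_ivl)
  qed
qed

lemma unit_intervals_meet:
  assumes "i \<noteq> j" "real_of_int i \<le> u" "u \<le> of_int i + 1" "real_of_int j \<le> u" "u \<le> of_int j + 1"
  shows "u = of_int i \<and> i = j + 1 \<or> u = of_int j \<and> j = i + 1"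
  using assms by linarith

lemma unit_interval_int:
  assumes "real_of_int i \<le> u" "u \<le> of_int i + 1" "u = of_int j"
  shows "j = i \<or> j = i + 1"
  using assms by linarith

text \<open>
  In coordinates, parallel edges can only meet if they lie on the same line, where distinct unit
  intervals with integer end points share at most an end point. A horizontal and a vertical edge meet
  in a point with two integer coordinates, which is an end point of both.
\<close>

lemma gseg_Int:
  assumes d: "\<delta> > 0" and e: "snd e < 4" and f: "snd f < 4" and ne: "e \<noteq> f" "e \<noteq> grev f"
    and z: "z \<in> gseg \<delta> e" "z \<in> gseg \<delta> f"
  shows "\<exists>v. z = gpt \<delta> v \<and> v \<in> {gsrc e, gtgt e} \<and> v \<in> {gsrc f, gtgt f}"
proof -
  define x y where "x = Re z / \<delta>" and "y = Im z / \<delta>"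
  have zz: "Re z = \<delta> * x" "Im z = \<delta> * y" using d by (auto simp: x_def y_def)
  have zg: "z = gpt \<delta> v" if "x = of_int (fst v)" "y = of_int (snd v)" for v
    using that by (auto simp: complex_eq_iff gpt_def zz)
  have ends: "{gsrc e, gtgt e} \<noteq> {gsrc f, gtgt f}"
    using grid_edge_inj[OF e f] grid_edge_inj[OF e grev_props(4)[OF f]] ne grev_props[OF f]
    by (auto simp: doubleton_eq_iff)
  have "\<exists>m n. {gsrc e, gtgt e} = {(m, n), (m + 1, n)} \<and> y = of_int n \<and> of_int m \<le> x \<and> x \<le> of_int m + 1
      \<or> {gsrc e, gtgt e} = {(m, n), (m, n + 1)} \<and> x = of_int m \<and> of_int n \<le> y \<and> y \<le> of_int n + 1"
    using gseg_shape[OF d e z(1)] d by (simp add: zz)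
  then obtain m n where E: "{gsrc e, gtgt e} = {(m, n), (m + 1, n)} \<and> y = of_int n \<and> of_int m \<le> x \<and> x \<le> of_int m + 1
      \<or> {gsrc e, gtgt e} = {(m, n), (m, n + 1)} \<and> x = of_int m \<and> of_int n \<le> y \<and> y \<le> of_int n + 1"
    by blast
  have "\<exists>m' n'. {gsrc f, gtgt f} = {(m', n'), (m' + 1, n')} \<and> y = of_int n' \<and> of_int m' \<le> x \<and> x \<le> of_int m' + 1
      \<or> {gsrc f, gtgt f} = {(m', n'), (m', n' + 1)} \<and> x = of_int m' \<and> of_int n' \<le> y \<and> y \<le> of_int n' + 1"
    using gseg_shape[OF d f z(2)] d by (simp add: zz)
  then obtain m' n' where F: "{gsrc f, gtgt f} = {(m', n'), (m' + 1, n')} \<and> y = of_int n' \<and> of_int m' \<le> x \<and> x \<le> of_int m' + 1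
      \<or> {gsrc f, gtgt f} = {(m', n'), (m', n' + 1)} \<and> x = of_int m' \<and> of_int n' \<le> y \<and> y \<le> of_int n' + 1"
    by blast
  have "\<exists>v. x = of_int (fst v) \<and> y = of_int (snd v) \<and> v \<in> {gsrc e, gtgt e} \<and> v \<in> {gsrc f, gtgt f}"
    using E
  proof (elim disjE conjE)
    assume E': "{gsrc e, gtgt e} = {(m, n), (m + 1, n)}" "y = of_int n" "of_int m \<le> x" "x \<le> of_int m + 1"
    show ?thesis using F
    proof (elim disjE conjE)
      assume F': "{gsrc f, gtgt f} = {(m', n'), (m' + 1, n')}" "y = of_int n'" "of_int m' \<le> x" "x \<le> of_int m' + 1"
      have n: "n' = n" using E' F' by simp
      then have "m \<noteq> m'" using ends E' F' by auto
      from unit_intervals_meet[OF this E'(3,4) F'(3,4)] show ?thesis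
        unfolding E'(1) F'(1) n using E'(2) by (auto intro: exI[of _ "(m, n)"] exI[of _ "(m', n)"])
    next
      assume F': "{gsrc f, gtgt f} = {(m', n'), (m', n' + 1)}" "x = of_int m'" "of_int n' \<le> y" "y \<le> of_int n' + 1"
      show ?thesis
        unfolding E'(1) F'(1) using unit_interval_int[OF E'(3,4) F'(2)] unit_interval_int[OF F'(3,4) E'(2)] E'(2) F'(2)
        by (intro exI[of _ "(m', n)"]) auto
    qed
  next
    assume E': "{gsrc e, gtgt e} = {(m, n), (m, n + 1)}" "x = of_int m" "of_int n \<le> y" "y \<le> of_int n + 1"
    show ?thesis using F
    proof (elim disjE conjE)
      assume F': "{gsrc f, gtgt f} = {(m', n'), (m' + 1, n')}" "y = of_int n'" "of_int m' \<le> x" "x \<le> of_int m' + 1"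
      show ?thesis
        unfolding E'(1) F'(1) using unit_interval_int[OF E'(3,4) F'(2)] unit_interval_int[OF F'(3,4) E'(2)] E'(2) F'(2)
        by (intro exI[of _ "(m, n')"]) auto
    next
      assume F': "{gsrc f, gtgt f} = {(m', n'), (m', n' + 1)}" "x = of_int m'" "of_int n' \<le> y" "y \<le> of_int n' + 1"
      have m: "m' = m" using E' F' by simp
      then have "n \<noteq> n'" using ends E' F' by auto
      from unit_intervals_meet[OF this E'(3,4) F'(3,4)] show ?thesis
        unfolding E'(1) F'(1) m using E'(2) by (auto intro: exI[of _ "(m, n)"] exI[of _ "(m, n')"])
    qed
  qed
  then show ?thesis using zg by blast
qed

text \<open>
  The polygonal path along a list of edges that is meant to be a walk. The empty list gets a default
  value.
\<close>

fun polygon :: "('e \<Rightarrow> complex) \<Rightarrow> ('e \<Rightarrow> complex) \<Rightarrow> 'e list \<Rightarrow> real \<Rightarrow> complex" where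
  "polygon a b [] = linepath 0 0"
| "polygon a b [e] = linepath (a e) (b e)"
| "polygon a b (e # es) = linepath (a e) (b e) +++ polygon a b es"

lemma polygon_Cons: "es \<noteq> [] \<Longrightarrow> polygon a b (e # es) = linepath (a e) (b e) +++ polygon a b es"
  by (cases es) auto

lemma walk_image: "walk s t es \<Longrightarrow> walk (\<lambda>e. f (s e)) (\<lambda>e. f (t e)) es"
  by (auto simp: walk_def)

lemma polygon_ends:
  "es \<noteq> [] \<Longrightarrow> pathstart (polygon a b es) = a (hd es) \<and> pathfinish (polygon a b es) = b (last es)"
  by (induction es rule: induct_list012) (auto simp: polygon_Cons)

lemma polygon_props:
  assumes "es \<noteq> []" "walk a b es"
  shows "valid_path (polygon a b es) \<and> path_image (polygon a b es) = (\<Union>e\<in>set es. closed_segment (a e) (b e)) \<and>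
     (\<exists>C. lipschitz_on C {0..1} (polygon a b es))"
  using assms
proof (induction es)
  case (Cons e es)
  show ?case
  proof (cases "es = []")
    case True
    have "dist (linepath (a e) (b e) s) (linepath (a e) (b e) t) \<le> norm (b e - a e) * dist s t" for s t
    proof -
      have "linepath (a e) (b e) s - linepath (a e) (b e) t = (s - t) *\<^sub>R (b e - a e)"
        by (simp add: linepath_def algebra_simps)
      then show ?thesis by (simp add: dist_norm mult.commute)
    qed
    then show ?thesis
      using True by (auto intro!: exI[of _ "norm (b e - a e)"] lipschitz_onI)
  next
    case False
    let ?p = "polygon a b es" and ?l = "linepath (a e) (b e)"
    have IH: "valid_path ?p" "path_image ?p = (\<Union>e\<in>set es. closed_segment (a e) (b e))"
      "\<exists>C. lipschitz_on C {0..1} ?p" and be: "b e = a (hd es)"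
      using Cons False by (auto simp: walk_Cons)
    obtain C where C: "lipschitz_on C {0..1} ?p" using IH by blast
    have "dist (?l s) (?l t) \<le> norm (b e - a e) * dist s t" for s t
    proof -
      have "?l s - ?l t = (s - t) *\<^sub>R (b e - a e)"
        by (simp add: linepath_def algebra_simps)
      then show ?thesis by (simp add: dist_norm mult.commute)
    qed
    then have l: "lipschitz_on (norm (b e - a e)) {0..1} ?l" by (intro lipschitz_onI) auto
    have dbl: "\<bar>2 * x - 2 * y\<bar> = 2 * \<bar>x - y\<bar>" for x y :: real by (simp add: abs_if)
    have l1: "lipschitz_on (norm (b e - a e) * 2) {0..1/2} (\<lambda>x. ?l (2 * x))"
      by (rule lipschitz_on_compose2[of 2 _ "\<lambda>x. 2 * x"])
         (auto intro!: lipschitz_onI lipschitz_on_subset[OF l] simp: dist_real_def dbl)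
    have l2: "lipschitz_on (C * 2) {1/2..1} (\<lambda>x. ?p (2 * x - 1))"
      by (rule lipschitz_on_compose2[of 2 _ "\<lambda>x. 2 * x - 1"])
         (auto intro!: lipschitz_onI lipschitz_on_subset[OF C] simp: dist_real_def dbl)
    have mid: "?l (2 * (1/2)) = ?p (2 * (1/2) - 1)"
      using polygon_ends[OF False, of a b] be by (simp add: pathstart_def linepath_def)
    have "\<exists>C. lipschitz_on C {0..1} (?l +++ ?p)"
      using lipschitz_on_concat_max[OF l1 l2 mid] unfolding joinpaths_def by blast
    moreover have "valid_path (?l +++ ?p)"
      using IH be polygon_ends[OF False, of a b] by (intro valid_path_join) auto
    moreover have "path_image (?l +++ ?p) = (\<Union>e\<in>set (e # es). closed_segment (a e) (b e))"
      using IH be polygon_ends[OF False, of a b] by (subst path_image_join) auto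
    ultimately show ?thesis using False by (simp add: polygon_Cons)
  qed
qed simp

lemma polygon_integral:
  assumes "es \<noteq> []" "walk a b es" "\<And>e. e \<in> set es \<Longrightarrow> continuous_on (closed_segment (a e) (b e)) g"
  shows "g contour_integrable_on polygon a b es \<and>
    contour_integral (polygon a b es) g = (\<Sum>e\<leftarrow>es. contour_integral (linepath (a e) (b e)) g)"
  using assms
proof (induction es)
  case (Cons e es)
  show ?case
  proof (cases "es = []")
    case True then show ?thesis using Cons.prems by (simp add: contour_integrable_continuous_linepath)
  next
    case False
    have w: "walk a b es" using Cons.prems by (simp add: walk_Cons)
    have IH: "g contour_integrable_on polygon a b es"
       "contour_integral (polygon a b es) g = (\<Sum>e\<leftarrow>es. contour_integral (linepath (a e) (b e)) g)"
      using Cons.IH[OF False w] Cons.prems by auto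
    have "g contour_integrable_on linepath (a e) (b e)"
      using Cons.prems by (intro contour_integrable_continuous_linepath) auto
    then show ?thesis
      using IH polygon_props[OF False w] by (simp add: polygon_Cons[OF False] contour_integrable_joinI)
  qed
qed simp

lemma polygon_arc:
  assumes "es \<noteq> []" "walk a b es" "distinct (map a es @ [b (last es)])"
    and "\<And>e f. e \<in> set es \<Longrightarrow> f \<in> set es \<Longrightarrow> e \<noteq> f \<Longrightarrow>
      closed_segment (a e) (b e) \<inter> closed_segment (a f) (b f) \<subseteq> {a e, b e} \<inter> {a f, b f}"
  shows "arc (polygon a b es)"
  using assms
proof (induction es)
  case (Cons e es)
  show ?case
  proof (cases "es = []")
    case True then show ?thesis using Cons.prems by (simp add: arc_linepath)
  next
    case False
    have w: "walk a b es" and be: "b e = a (hd es)" using Cons.prems False by (auto simp: walk_Cons)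
    note ends = polygon_ends[OF False, of a b]
    have "arc (polygon a b es)"
      using Cons.IH[OF False w] Cons.prems False by auto
    moreover have ne: "a e \<noteq> b e"
      using be Cons.prems(3) hd_in_set[OF False] by auto
    then have "arc (linepath (a e) (b e))" by (simp add: arc_linepath)
    moreover have "path_image (linepath (a e) (b e)) \<inter> path_image (polygon a b es) \<subseteq> {pathstart (polygon a b es)}"
    proof
      fix z assume z: "z \<in> path_image (linepath (a e) (b e)) \<inter> path_image (polygon a b es)"
      then obtain f where f: "f \<in> set es" "z \<in> closed_segment (a f) (b f)" "z \<in> closed_segment (a e) (b e)"
        using polygon_props[OF False w] by auto
      have "e \<noteq> f" using f Cons.prems(3) by auto
      then have zz: "z \<in> {a e, b e}" "z \<in> {a f, b f}"
        using Cons.prems(4)[of e f] f by auto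
      have "b f \<in> a ` set es \<union> {b (last es)}"
      proof -
        obtain x xs where x: "es = x # xs" using False by (cases es) auto
        have "b f \<in> set (map b es)" using f(1) by simp
        also have "\<dots> = set (map a xs @ [b (last es)])"
          using walk_targets[of a b x xs] w by (simp only: x)
        finally show ?thesis by (auto simp: x)
      qed
      then have "a e \<noteq> b f" "a e \<noteq> a f" using Cons.prems(3) False f(1) by auto
      then have "z = b e" using zz by auto
      then show "z \<in> {pathstart (polygon a b es)}" using ends be by simp
    qed
    ultimately show ?thesis
      using ends be by (simp add: polygon_Cons[OF False] arc_join)
  qed
qed simp

text \<open>
  Without its first edge the polygon is an arc, as no vertex repeats; the first edge closes
  the arc to a loop.
\<close>

lemma polygon_simple_cycle:
  assumes c: "simple_cycle a b es" and ne: "\<And>e. e \<in> set es \<Longrightarrow> a e \<noteq> b e"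
    and int: "\<And>e f. e \<in> set es \<Longrightarrow> f \<in> set es \<Longrightarrow> e \<noteq> f \<Longrightarrow>
      closed_segment (a e) (b e) \<inter> closed_segment (a f) (b f) \<subseteq> {a e, b e} \<inter> {a f, b f}"
  shows "simple_path (polygon a b es)" "pathfinish (polygon a b es) = pathstart (polygon a b es)"
proof -
  have es: "es \<noteq> []" "walk a b es" "b (last es) = a (hd es)" "distinct (map a es)"
    using c by (auto simp: simple_cycle_def)
  show "pathfinish (polygon a b es) = pathstart (polygon a b es)"
    using polygon_ends[OF es(1), of a b] es by simp
  obtain e fs where e: "es = e # fs" using es by (cases es) auto
  have fs: "fs \<noteq> []" using es ne e by auto
  have w: "walk a b fs" "b e = a (hd fs)" using es fs by (auto simp: e walk_Cons)
  note ends = polygon_ends[OF fs, of a b]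
  have "arc (polygon a b fs)"
    using es fs e int by (intro polygon_arc w) auto
  moreover have "arc (linepath (a e) (b e))" using ne[of e] by (simp add: e arc_linepath)
  moreover have "path_image (linepath (a e) (b e)) \<inter> path_image (polygon a b fs) \<subseteq> {a e, b e}"
  proof
    fix z assume z: "z \<in> path_image (linepath (a e) (b e)) \<inter> path_image (polygon a b fs)"
    then obtain f where f: "f \<in> set fs" "z \<in> closed_segment (a f) (b f)" "z \<in> closed_segment (a e) (b e)"
      using polygon_props[OF fs w(1)] by auto
    moreover have "e \<noteq> f" using f es(4) by (auto simp: e)
    ultimately show "z \<in> {a e, b e}" using int[of e f] by (auto simp: e)
  qed
  ultimately show "simple_path (polygon a b es)"
    unfolding e polygon_Cons[OF fs]
    using ends w es fs by (intro simple_path_join_loop) (auto simp: e)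
qed

section \<open>Grid contours around compact sets\<close>

definition boundary_edges :: "(int \<times> int) set \<Rightarrow> grid_edge set" where
  "boundary_edges Q = {e \<in> Q \<times> {..<4}. grev e \<notin> Q \<times> {..<4}}"

text \<open>
  Reversal pairs off the edges that have squares of \<open>Q\<close> on both sides.
\<close>

lemma inner_edges_grev:
  fixes Q defines "A \<equiv> Q \<times> {..<4::nat}"
  shows "bij_betw grev {e \<in> A. grev e \<in> A} {e \<in> A. grev e \<in> A}"
proof -
  have A: "e \<in> A \<longleftrightarrow> fst e \<in> Q \<and> snd e < 4" for e by (simp add: A_def mem_Times_iff)
  show ?thesis
    by (rule bij_betwI[where g = grev]) (simp_all add: A grev_props Pi_def)
qed

lemma sum_boundary_edges:
  fixes h :: "grid_edge \<Rightarrow> complex"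
  assumes fin: "finite Q" and anti: "\<And>e. e \<in> Q \<times> {..<4} \<Longrightarrow> h (grev e) = - h e"
  shows "sum h (boundary_edges Q) = (\<Sum>q\<in>Q. \<Sum>k<4. h (q, k))"
proof -
  define A where "A = Q \<times> {..<4::nat}"
  define I where "I = {e \<in> A. grev e \<in> A}"
  have finA: "finite A" using fin by (simp add: A_def)
  have "sum h I = (\<Sum>e\<in>I. h (grev e))"
    using sum.reindex_bij_betw[OF inner_edges_grev[of Q], of h] by (simp add: I_def A_def)
  also have "\<dots> = (\<Sum>e\<in>I. - h e)"
    by (rule sum.cong) (use anti in \<open>auto simp: I_def A_def\<close>)
  finally have "sum h I = 0" by (simp add: sum_negf)
  moreover have "sum h A = sum h I + sum h (A - I)"
    using finA by (metis (no_types, lifting) I_def mem_Collect_eq subsetI sum.subset_diff add.commute)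
  moreover have "A - I = boundary_edges Q" by (auto simp: A_def I_def boundary_edges_def)
  moreover have "sum h A = (\<Sum>q\<in>Q. \<Sum>k<4. h (q, k))"
    by (simp add: A_def sum.cartesian_product)
  ultimately show ?thesis by simp
qed

text \<open>
  The sides of each square form a cycle, so the set of all sides of squares in \<open>Q\<close> is balanced. The
  inner edges are balanced too, being closed under reversal. Hence so is their difference.
\<close>

lemma boundary_edges_balanced:
  assumes fin: "finite Q"
  shows "image_mset gtgt (mset_set (boundary_edges Q)) = image_mset gsrc (mset_set (boundary_edges Q))"
proof -
  define A where "A = Q \<times> {..<4::nat}"
  define I where "I = {e \<in> A. grev e \<in> A}"
  define nxt where "nxt e = (fst e, (snd e + 1) mod 4)" for e :: grid_edge
  have finA: "finite A" using fin by (simp add: A_def)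
  have finI: "finite I" using finA by (simp add: I_def)
  have reidx: "image_mset f (mset_set X) = image_mset (\<lambda>e. f (p e)) (mset_set X)"
    if "bij_betw p X X" for f :: "grid_edge \<Rightarrow> int \<times> int" and p X
  proof -
    have "image_mset p (mset_set X) = mset_set X"
      using that image_mset_mset_set[of p X] by (simp add: bij_betw_def)
    then have "image_mset f (mset_set X) = image_mset f (image_mset p (mset_set X))" by simp
    then show ?thesis by (simp only: image_mset.compositionality comp_def)
  qed
  have "bij_betw nxt A A"
  proof (rule bij_betwI[where g = "\<lambda>e. (fst e, (snd e + 3) mod 4)"])
    show "nxt \<in> A \<rightarrow> A" "(\<lambda>e. (fst e, (snd e + 3) mod 4)) \<in> A \<rightarrow> A"
      by (auto simp: A_def nxt_def)
    show "(fst (nxt e), (snd (nxt e) + 3) mod 4) = e" if "e \<in> A" for e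
      using that by (auto simp: A_def nxt_def less_4_cases)
    show "nxt (fst e, (snd e + 3) mod 4) = e" if "e \<in> A" for e
      using that by (auto simp: A_def nxt_def less_4_cases)
  qed
  from reidx[OF this, of gsrc]
  have "image_mset gsrc (mset_set A) = image_mset (\<lambda>e. gsrc (nxt e)) (mset_set A)" .
  also have "\<dots> = image_mset gtgt (mset_set A)"
    by (rule image_mset_cong) (use finA in \<open>auto simp: A_def nxt_def less_4_cases\<close>)
  finally have balA: "image_mset gsrc (mset_set A) = image_mset gtgt (mset_set A)" .
  have "image_mset gsrc (mset_set I) = image_mset (\<lambda>e. gsrc (grev e)) (mset_set I)"
    by (rule reidx) (use inner_edges_grev[of Q] in \<open>simp add: I_def A_def\<close>)
  also have "\<dots> = image_mset gtgt (mset_set I)"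
    by (rule image_mset_cong) (use finI in \<open>auto simp: I_def A_def grev_props\<close>)
  finally have balI: "image_mset gsrc (mset_set I) = image_mset gtgt (mset_set I)" .
  have "mset_set A = mset_set (A - I) + mset_set I"
    using finA by (metis (no_types, lifting) I_def mem_Collect_eq mset_set_Diff subsetI
        subset_imp_msubset_mset_set subset_mset.diff_add)
  moreover have "A - I = boundary_edges Q" by (auto simp: A_def I_def boundary_edges_def)
  ultimately show ?thesis using balA balI by simp
qed

definition gsquare :: "real \<Rightarrow> int \<times> int \<Rightarrow> complex set" where
  "gsquare \<delta> q = cbox (gpt \<delta> q) (gpt \<delta> (fst q + 1, snd q + 1))"

abbreviation gloop :: "real \<Rightarrow> int \<times> int \<Rightarrow> real \<Rightarrow> complex" where
  "gloop \<delta> q \<equiv> rectpath (gpt \<delta> q) (gpt \<delta> (fst q + 1, snd q + 1))"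

abbreviation gline :: "real \<Rightarrow> grid_edge \<Rightarrow> real \<Rightarrow> complex" where
  "gline \<delta> e \<equiv> linepath (gpt \<delta> (gsrc e)) (gpt \<delta> (gtgt e))"

lemma in_gsquare: "\<delta> > 0 \<Longrightarrow> z \<in> gsquare \<delta> (m, n) \<longleftrightarrow>
    \<delta> * of_int m \<le> Re z \<and> Re z \<le> \<delta> * (of_int m + 1) \<and> \<delta> * of_int n \<le> Im z \<and> Im z \<le> \<delta> * (of_int n + 1)"
  by (auto simp: gsquare_def gpt_def in_cbox_complex_iff)

lemma gseg_subset_gsquare: "\<delta> > 0 \<Longrightarrow> k < 4 \<Longrightarrow> gseg \<delta> (q, k) \<subseteq> gsquare \<delta> q"
proof -
  assume d: "\<delta> > 0" and k: "k < 4"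
  obtain m n where q: "q = (m, n)" by fastforce
  have "gpt \<delta> (gsrc (q, k)) \<in> gsquare \<delta> q" "gpt \<delta> (gtgt (q, k)) \<in> gsquare \<delta> q"
    using d k by (auto simp: q in_gsquare gpt_def less_4_cases)
  then show ?thesis
    unfolding gseg_def by (intro closed_segment_subset) (auto simp: gsquare_def convex_box)
qed

lemma gloop_integral:
  assumes "\<And>k. k < 4 \<Longrightarrow> continuous_on (gseg \<delta> (q, k)) g"
  shows "contour_integral (gloop \<delta> q) g = (\<Sum>k<4. contour_integral (gline \<delta> (q, k)) g)"
proof -
  obtain m n where q: "q = (m, n)" by fastforce
  have "g contour_integrable_on gline \<delta> (q, k)" if "k < 4" for k
    using assms[OF that] by (intro contour_integrable_continuous_linepath) (simp add: gseg_def)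
  from this[of 0] this[of 1] this[of 2] this[of 3] show ?thesis
    by (simp add: q rectpath_def Let_def gpt_def eval_nat_numeral contour_integrable_joinI valid_path_join algebra_simps)
qed

text \<open>
  Choose a fine grid and let \<open>Q\<close> be the finite set of closed squares that meet \<open>K\<close>; they lie in
  \<open>U\<close>. An edge between two squares of \<open>Q\<close> is traversed in both directions, so integrals
  over the boundary edges equal sums over the boundaries of squares. A boundary edge does not meet \<open>K\<close>,
  since the square on its other side is not in \<open>Q\<close>.
\<close>

lemma grid_contour:
  assumes K: "compact K" and U: "open U" and KU: "K \<subseteq> U"
  obtains \<Gamma> es where
    "\<And>\<gamma>. \<gamma> \<in> set \<Gamma> \<Longrightarrow> simple_path \<gamma> \<and> pathfinish \<gamma> = pathstart \<gamma> \<and> valid_path \<gamma> \<and> rectifiable_path \<gamma>"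
    "cycle_image \<Gamma> \<subseteq> U - K" "cycle_image \<Gamma> = (\<Union>(a, b)\<in>set es. closed_segment a b)"
    "\<And>g. continuous_on (cycle_image \<Gamma>) g \<Longrightarrow>
       (\<Sum>\<gamma>\<leftarrow>\<Gamma>. contour_integral \<gamma> g) = (\<Sum>(a, b)\<leftarrow>es. contour_integral (linepath a b) g)"
    "\<And>g. g holomorphic_on U \<Longrightarrow> (\<Sum>\<gamma>\<leftarrow>\<Gamma>. contour_integral \<gamma> g) = 0"
    "\<And>z. z \<in> K \<Longrightarrow> (\<Sum>\<gamma>\<leftarrow>\<Gamma>. winding_number \<gamma> z) = 1"
proof -
  obtain d where d: "d > 0" and sep: "\<And>x y. x \<in> K \<Longrightarrow> y \<in> - U \<Longrightarrow> d \<le> dist x y"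
  proof -
    have "K \<inter> - U = {}" using KU by auto
    then show ?thesis using separate_compact_closed[OF K, of "- U"] U that by (auto simp: closed_Compl)
  qed
  \<comment> \<open>Two points of a square of side \<open>\<delta>\<close> have distance at most \<open>2 \<delta> < d\<close>.\<close>
  define \<delta> where "\<delta> = d / 3"
  have \<delta>: "\<delta> > 0" using d by (simp add: \<delta>_def)
  define Q where "Q = {q. gsquare \<delta> q \<inter> K \<noteq> {}}"
  define E where "E = boundary_edges Q"
  have QU: "gsquare \<delta> q \<subseteq> U" if "q \<in> Q" for q
  proof
    fix z assume z: "z \<in> gsquare \<delta> q"
    obtain m n where q: "q = (m, n)" by fastforce
    obtain w where w: "w \<in> gsquare \<delta> q" "w \<in> K" using \<open>q \<in> Q\<close> by (auto simp: Q_def)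
    have "\<bar>Re (w - z)\<bar> \<le> \<delta>" "\<bar>Im (w - z)\<bar> \<le> \<delta>"
      using z w \<delta> by (auto simp: q in_gsquare abs_le_iff algebra_simps)
    then have "dist w z \<le> 2 * \<delta>" using cmod_le[of "w - z"] by (simp add: dist_norm)
    then have "\<not> d \<le> dist w z" using d by (simp add: \<delta>_def)
    then show "z \<in> U" using sep[OF w(2), of z] by auto
  qed
  have finQ: "finite Q"
  proof -
    obtain B where B: "\<And>z. z \<in> K \<Longrightarrow> cmod z \<le> B"
      using compact_imp_bounded[OF K] by (auto simp: bounded_iff)
    define N where "N = \<lceil>B / \<delta>\<rceil> + 1"
    have "Q \<subseteq> {-N..N} \<times> {-N..N}"
    proof
      fix q assume "q \<in> Q"
      then obtain w where w: "w \<in> gsquare \<delta> q" "w \<in> K" by (auto simp: Q_def)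
      obtain m n where q: "q = (m, n)" by fastforce
      have "\<bar>Re w\<bar> \<le> B" "\<bar>Im w\<bar> \<le> B"
        using B[OF w(2)] abs_Re_le_cmod[of w] abs_Im_le_cmod[of w] by auto
      then have ub: "\<delta> * of_int m \<le> B" "- B \<le> \<delta> * (of_int m + 1)" "\<delta> * of_int n \<le> B" "- B \<le> \<delta> * (of_int n + 1)"
        using w(1) \<delta> by (auto simp: q in_gsquare abs_le_iff)
      have "real_of_int m \<le> B / \<delta>" "- (B / \<delta>) \<le> of_int m + 1" "real_of_int n \<le> B / \<delta>" "- (B / \<delta>) \<le> of_int n + 1"
        using ub \<delta> by (auto simp: field_simps)
      then show "q \<in> {-N..N} \<times> {-N..N}"
        unfolding q N_def by (simp; linarith)
    qed
    then show ?thesis by (rule finite_subset) auto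
  qed
  have E4: "snd e < 4" "fst e \<in> Q" if "e \<in> E" for e
    using that by (auto simp: E_def boundary_edges_def)
  have EU: "gseg \<delta> e \<subseteq> U" if "e \<in> Q \<times> {..<4}" for e
    using gseg_subset_gsquare[OF \<delta>, of "snd e" "fst e"] QU[of "fst e"] that
    by (simp add: mem_Times_iff)
  have EK: "gseg \<delta> e \<inter> K = {}" if e: "e \<in> E" for e
  proof (rule ccontr)
    assume meet: "gseg \<delta> e \<inter> K \<noteq> {}"
    have "gseg \<delta> e = gseg \<delta> (grev e)"
      using grev_props[OF E4(1)[OF e]] by (simp add: gseg_def closed_segment_commute)
    also have "\<dots> \<subseteq> gsquare \<delta> (fst (grev e))"
      using gseg_subset_gsquare[OF \<delta>, of "snd (grev e)" "fst (grev e)"] grev_props[OF E4(1)[OF e]] by simp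
    finally have "fst (grev e) \<in> Q" using meet by (auto simp: Q_def)
    then have "grev e \<in> Q \<times> {..<4}"
      using grev_props(4)[OF E4(1)[OF e]] by (simp add: mem_Times_iff)
    then show False using e by (simp add: E_def boundary_edges_def)
  qed
  have finE: "finite E" using finQ by (auto simp: E_def boundary_edges_def)
  obtain Cs where Cs: "\<And>C. C \<in> set Cs \<Longrightarrow> simple_cycle gsrc gtgt C" "distinct (concat Cs)" "set (concat Cs) = E"
    using balanced_cycle_decomposition[OF finE, of gtgt gsrc] boundary_edges_balanced[OF finQ] by (auto simp: E_def)
  define a b where "a e = gpt \<delta> (gsrc e)" and "b e = gpt \<delta> (gtgt e)" for e
  define \<Gamma> where "\<Gamma> = map (polygon a b) Cs"
  define es where "es = map (\<lambda>e. (a e, b e)) (concat Cs)"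
  have seg: "closed_segment (a e) (b e) = gseg \<delta> e" for e by (simp add: a_def b_def gseg_def)
  have inE: "e \<in> E" if "C \<in> set Cs" "e \<in> set C" for C e using Cs(3) that by auto
  have cyc: "simple_cycle a b C" if "C \<in> set Cs" for C
    using Cs(1)[OF that] \<delta> walk_image[of gsrc gtgt C "gpt \<delta>"]
    by (auto simp: simple_cycle_def a_def[abs_def] b_def[abs_def] distinct_map inj_on_def gpt_inj)
  then have C: "C \<noteq> []" "walk a b C" if "C \<in> set Cs" for C
    using that by (auto simp: simple_cycle_def)
  have props: "simple_path \<gamma> \<and> pathfinish \<gamma> = pathstart \<gamma> \<and> valid_path \<gamma> \<and> rectifiable_path \<gamma>"
    if "\<gamma> \<in> set \<Gamma>" for \<gamma>
  proof -
    obtain C where CC: "C \<in> set Cs" "\<gamma> = polygon a b C" using \<open>\<gamma> \<in> set \<Gamma>\<close> by (auto simp: \<Gamma>_def)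
    have ne: "a e \<noteq> b e" if "e \<in> set C" for e
      using E4(1)[OF inE[OF CC(1) that]] \<delta>
      by (cases e rule: gsrc.cases) (auto simp: a_def b_def gpt_inj less_4_cases)
    have int: "closed_segment (a e) (b e) \<inter> closed_segment (a f) (b f) \<subseteq> {a e, b e} \<inter> {a f, b f}"
      if "e \<in> set C" "f \<in> set C" "e \<noteq> f" for e f
    proof
      fix z assume z: "z \<in> closed_segment (a e) (b e) \<inter> closed_segment (a f) (b f)"
      have E: "e \<in> E" "f \<in> E" using inE[OF CC(1)] that by auto
      have "e \<in> Q \<times> {..<4}" "grev f \<notin> Q \<times> {..<4}"
        using E by (simp_all only: E_def boundary_edges_def mem_Collect_eq not_False_eq_True)
      then have "e \<noteq> grev f" by blast
      from gseg_Int[OF \<delta> E4(1)[OF E(1)] E4(1)[OF E(2)] that(3) this, of z] z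
      obtain v where "z = gpt \<delta> v" "v \<in> {gsrc e, gtgt e}" "v \<in> {gsrc f, gtgt f}"
        unfolding seg by blast
      then show "z \<in> {a e, b e} \<inter> {a f, b f}" by (auto simp: a_def b_def)
    qed
    show ?thesis
      using polygon_simple_cycle[OF cyc[OF CC(1)] ne int] polygon_props[OF C[OF CC(1)]] lipschitz_rectifiable
      by (auto simp: CC(2))
  qed
  have img: "cycle_image \<Gamma> = (\<Union>e\<in>E. gseg \<delta> e)"
    using polygon_props[OF C] by (simp add: cycle_image_def \<Gamma>_def seg flip: Cs(3))
  have int: "(\<Sum>\<gamma>\<leftarrow>\<Gamma>. contour_integral \<gamma> g) = (\<Sum>(a, b)\<leftarrow>es. contour_integral (linepath a b) g)"
    "(\<Sum>\<gamma>\<leftarrow>\<Gamma>. contour_integral \<gamma> g) = (\<Sum>e\<in>E. contour_integral (gline \<delta> e) g)"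
    if g: "continuous_on (cycle_image \<Gamma>) g" for g
  proof -
    have "continuous_on (gseg \<delta> e) g" if "e \<in> E" for e
      using continuous_on_subset[OF g] that by (auto simp: img)
    then have "contour_integral (polygon a b C) g = (\<Sum>e\<leftarrow>C. contour_integral (linepath (a e) (b e)) g)"
      if "C \<in> set Cs" for C
      using polygon_integral[OF C[OF that], of g] inE[OF that] by (auto simp: seg)
    then have "(\<Sum>\<gamma>\<leftarrow>\<Gamma>. contour_integral \<gamma> g) = (\<Sum>C\<leftarrow>Cs. \<Sum>e\<leftarrow>C. contour_integral (linepath (a e) (b e)) g)"
      by (simp add: \<Gamma>_def cong: map_cong)
    also have "\<dots> = (\<Sum>e\<leftarrow>concat Cs. contour_integral (linepath (a e) (b e)) g)"
      by (induction Cs) auto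
    finally have *: "(\<Sum>\<gamma>\<leftarrow>\<Gamma>. contour_integral \<gamma> g) = (\<Sum>e\<leftarrow>concat Cs. contour_integral (linepath (a e) (b e)) g)" .
    then show "(\<Sum>\<gamma>\<leftarrow>\<Gamma>. contour_integral \<gamma> g) = (\<Sum>(a, b)\<leftarrow>es. contour_integral (linepath a b) g)"
      by (simp add: es_def o_def)
    show "(\<Sum>\<gamma>\<leftarrow>\<Gamma>. contour_integral \<gamma> g) = (\<Sum>e\<in>E. contour_integral (gline \<delta> e) g)"
      unfolding * using Cs(2,3) by (simp add: sum_list_distinct_conv_sum_set a_def b_def)
  qed
  have squares: "(\<Sum>\<gamma>\<leftarrow>\<Gamma>. contour_integral \<gamma> g) = (\<Sum>q\<in>Q. contour_integral (gloop \<delta> q) g)"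
    if g: "\<And>e. e \<in> Q \<times> {..<4} \<Longrightarrow> continuous_on (gseg \<delta> e) g" for g
  proof -
    have "continuous_on (cycle_image \<Gamma>) g"
      unfolding img by (rule continuous_on_closed_Union)
        (use finE g in \<open>auto simp: gseg_def E_def boundary_edges_def\<close>)
    then have "(\<Sum>\<gamma>\<leftarrow>\<Gamma>. contour_integral \<gamma> g) = (\<Sum>e\<in>boundary_edges Q. contour_integral (gline \<delta> e) g)"
      using int(2) by (simp add: E_def)
    also have "\<dots> = (\<Sum>q\<in>Q. \<Sum>k<4. contour_integral (gline \<delta> (q, k)) g)"
    proof (rule sum_boundary_edges[OF finQ])
      fix e assume e: "e \<in> Q \<times> {..<4::nat}"
      then have "snd e < 4" by auto
      note p = grev_props[OF this]
      show "contour_integral (gline \<delta> (grev e)) g = - contour_integral (gline \<delta> e) g"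
        using g[OF e] unfolding p by (intro contour_integral_reverse_linepath) (simp add: gseg_def closed_segment_commute)
    qed
    also have "\<dots> = (\<Sum>q\<in>Q. contour_integral (gloop \<delta> q) g)"
      by (intro sum.cong refl gloop_integral[symmetric] g) auto
    finally show ?thesis .
  qed
  have zero: "(\<Sum>\<gamma>\<leftarrow>\<Gamma>. contour_integral \<gamma> g) = 0" if g: "g holomorphic_on U" for g
  proof -
    have "contour_integral (gloop \<delta> q) g = 0" if q: "q \<in> Q" for q
    proof (rule contour_integral_unique, rule Cauchy_theorem_convex_simple)
      show "g holomorphic_on gsquare \<delta> q" using g QU[OF q] holomorphic_on_subset by blast
      show "convex (gsquare \<delta> q)" by (simp add: gsquare_def convex_box)
      show "path_image (gloop \<delta> q) \<subseteq> gsquare \<delta> q"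
        using \<delta> unfolding gsquare_def by (intro path_image_rectpath_subset_cbox) (auto simp: gpt_def)
    qed auto
    then have "(\<Sum>q\<in>Q. contour_integral (gloop \<delta> q) g) = 0" by simp
    then show ?thesis
      using squares[of g] EU holomorphic_on_imp_continuous_on[OF g] continuous_on_subset by metis
  qed
  have wind: "(\<Sum>\<gamma>\<leftarrow>\<Gamma>. winding_number \<gamma> z) = 1" if z: "z \<in> K" for z
  proof -
    have "z \<notin> cycle_image \<Gamma>" using EK z by (auto simp: img)
    moreover have "closed (cycle_image \<Gamma>)" unfolding img using finE by (auto simp: gseg_def)
    ultimately obtain r where r: "r > 0" "ball z r \<subseteq> - cycle_image \<Gamma>"
      by (meson ComplI open_Compl openE)
    define m n where "m = \<lfloor>Re z / \<delta>\<rfloor>" and "n = \<lfloor>Im z / \<delta>\<rfloor>"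
    have mn: "\<delta> * of_int m \<le> Re z" "Re z < \<delta> * (of_int m + 1)" "\<delta> * of_int n \<le> Im z" "Im z < \<delta> * (of_int n + 1)"
      using \<delta> floor_correct[of "Re z / \<delta>"] floor_correct[of "Im z / \<delta>"]
      unfolding m_def[symmetric] n_def[symmetric] by (auto simp: field_simps)
    have "z \<in> gsquare \<delta> (m, n)" using mn \<delta> by (simp add: in_gsquare)
    then have mnQ: "(m, n) \<in> Q" using z by (auto simp: Q_def)
    \<comment> \<open>Winding numbers are constant on \<open>ball z r\<close>, so \<open>z\<close> may be moved to a point \<open>z'\<close> off all grid lines,
      in the interior of a square that contains \<open>z\<close>.\<close>
    define M where "M = min r (min (\<delta> * (of_int m + 1) - Re z) (\<delta> * (of_int n + 1) - Im z))"
    define t where "t = M / 3"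
    have "M > 0" "M \<le> r" "M \<le> \<delta> * (of_int m + 1) - Re z" "M \<le> \<delta> * (of_int n + 1) - Im z"
      using r mn by (auto simp: M_def)
    then have t: "t > 0" "2 * t < r" "t < \<delta> * (of_int m + 1) - Re z" "t < \<delta> * (of_int n + 1) - Im z"
      unfolding t_def by linarith+
    define z' where "z' = z + Complex t t"
    have z': "\<delta> * of_int m < Re z'" "Re z' < \<delta> * (of_int m + 1)" "\<delta> * of_int n < Im z'" "Im z' < \<delta> * (of_int n + 1)"
      using mn t by (auto simp: z'_def)
    have other: "(i, j) = (m, n)" if "z' \<in> gsquare \<delta> (i, j)" for i j
    proof -
      have "\<delta> * of_int i < \<delta> * (of_int m + 1)" "\<delta> * of_int m < \<delta> * (of_int i + 1)"
        "\<delta> * of_int j < \<delta> * (of_int n + 1)" "\<delta> * of_int n < \<delta> * (of_int j + 1)"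
        using that z' unfolding in_gsquare[OF \<delta>] by linarith+
      then show ?thesis using \<delta> by simp
    qed
    have off: "z' \<notin> gseg \<delta> e" if "snd e < 4" for e
    proof
      assume "z' \<in> gseg \<delta> e"
      from gseg_shape[OF \<delta> that this] obtain i :: int where "Re z' = \<delta> * of_int i \<or> Im z' = \<delta> * of_int i"
        by blast
      then show False
      proof
        assume i: "Re z' = \<delta> * of_int i"
        show False using z'(1,2) \<delta> unfolding i by simp
      next
        assume i: "Im z' = \<delta> * of_int i"
        show False using z'(3,4) \<delta> unfolding i by simp
      qed
    qed
    have z'r: "z' \<in> ball z r"
      using t cmod_le[of "Complex t t"] by (simp add: z'_def dist_norm)
    have wn: "winding_number \<gamma> z = winding_number \<gamma> z'" if "\<gamma> \<in> set \<Gamma>" for \<gamma>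
    proof (rule winding_number_eq[where S = "ball z r"])
      show "ball z r \<inter> path_image \<gamma> = {}" using r that by (auto simp: cycle_image_def)
    qed (use props[OF that] r z'r in \<open>auto simp: valid_path_imp_path\<close>)
    have wn': "winding_number \<gamma> z' = 1 / (2 * pi * \<i>) * contour_integral \<gamma> (\<lambda>w. 1 / (w - z'))" if "\<gamma> \<in> set \<Gamma>" for \<gamma>
      using props[OF that] z'r r that by (intro winding_number_valid_path) (auto simp: cycle_image_def)
    have sq: "1 / (2 * pi * \<i>) * contour_integral (gloop \<delta> q) (\<lambda>w. 1 / (w - z')) = (if q = (m, n) then 1 else 0)" for q
    proof -
      have im: "path_image (gloop \<delta> q) \<subseteq> (\<Union>k<4. gseg \<delta> (q, k))"
        by (cases q) (auto simp: rectpath_def Let_def path_image_join eval_nat_numeral lessThan_Suc gseg_def gpt_def)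
      then have "z' \<notin> path_image (gloop \<delta> q)" using off[of "(q, _)"] by fastforce
      then have "1 / (2 * pi * \<i>) * contour_integral (gloop \<delta> q) (\<lambda>w. 1 / (w - z')) = winding_number (gloop \<delta> q) z'"
        by (simp add: winding_number_valid_path)
      also have "\<dots> = (if q = (m, n) then 1 else 0)"
      proof (cases "q = (m, n)")
        case True
        then show ?thesis
          using z' by (auto intro!: winding_number_rectpath simp: gpt_def in_box_complex_iff)
      next
        case False
        then have "z' \<notin> gsquare \<delta> q" using other[of "fst q" "snd q"] by auto
        then show ?thesis using False \<delta>
          by (auto intro!: winding_number_rectpath_outside simp: gsquare_def gpt_def)
      qed
      finally show ?thesis .
    qed
    have "(\<Sum>\<gamma>\<leftarrow>\<Gamma>. winding_number \<gamma> z) = (\<Sum>\<gamma>\<leftarrow>\<Gamma>. 1 / (2 * pi * \<i>) * contour_integral \<gamma> (\<lambda>w. 1 / (w - z')))"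
      by (intro arg_cong[of _ _ sum_list] map_cong refl) (simp only: wn wn')
    also have "\<dots> = 1 / (2 * pi * \<i>) * (\<Sum>\<gamma>\<leftarrow>\<Gamma>. contour_integral \<gamma> (\<lambda>w. 1 / (w - z')))"
      by (rule sum_list_const_mult)
    also have "\<dots> = (\<Sum>q\<in>Q. 1 / (2 * pi * \<i>) * contour_integral (gloop \<delta> q) (\<lambda>w. 1 / (w - z')))"
      by (subst squares) (use off in \<open>auto intro!: continuous_intros simp: sum_distrib_left\<close>)
    also have "\<dots> = 1" unfolding sq using mnQ finQ by simp
    finally show ?thesis .
  qed
  show ?thesis
  proof (rule that[of \<Gamma> es])
    show "cycle_image \<Gamma> \<subseteq> U - K"
      using EK EU E4 by (fastforce simp: img)
    show "cycle_image \<Gamma> = (\<Union>(a, b)\<in>set es. closed_segment a b)"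
      using Cs(3) by (auto simp: img es_def seg)
  qed (use props int(1) zero wind in auto)
qed

section \<open>Cauchy's theorem for cycles\<close>

lemma has_contour_integral_sum_list:
  assumes "\<And>x. x \<in> set xs \<Longrightarrow> (f x has_contour_integral i x) \<gamma>"
  shows "((\<lambda>w. \<Sum>x\<leftarrow>xs. f x w) has_contour_integral (\<Sum>x\<leftarrow>xs. i x)) \<gamma>"
  using assms by (induction xs) (auto intro: has_contour_integral_add has_contour_integral_0)

lemma sum_list_swap:
  fixes f :: "'a \<Rightarrow> 'b \<Rightarrow> 'c::comm_monoid_add"
  shows "(\<Sum>x\<leftarrow>xs. \<Sum>y\<leftarrow>ys. f x y) = (\<Sum>y\<leftarrow>ys. \<Sum>x\<leftarrow>xs. f x y)"
  by (induction xs) (auto simp: sum_list_addf)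

text \<open>
  Supplies the integrability of the outer integrands in the proof of Cauchy's theorem below.
\<close>

lemma holomorphic_Cauchy_integral_linepath:
  assumes f: "continuous_on (closed_segment a b) f"
  shows "(\<lambda>z. contour_integral (linepath a b) (\<lambda>w. f w / (w - z))) holomorphic_on - closed_segment a b"
proof (rule holomorphic_onI)
  fix z assume z: "z \<in> - closed_segment a b"
  define G where "G z = contour_integral (linepath a b) (\<lambda>w. f w / (w - z))" for z
  have int: "((\<lambda>w. f w / (w - z) ^ 1) has_contour_integral G z) (linepath a b)"
    if "z \<in> UNIV - path_image (linepath a b)" for z
    using that f unfolding G_def
    by (auto intro!: has_contour_integral_integral contour_integrable_continuous_linepath continuous_intros)
  have "(G has_field_derivative
      (of_nat 1 * contour_integral (linepath a b) (\<lambda>w. f w / (w - z) ^ Suc 1))) (at z)"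
    by (rule Cauchy_next_derivative(2)[where B = "norm (b - a)" and S = UNIV])
       (use f z int in auto)
  then show "G field_differentiable at z within - closed_segment a b"
    by (meson field_differentiable_at_within field_differentiable_def)
qed

text \<open>
  Let \<open>K\<close> consist of the curves and of all points about which their winding
  numbers do not sum to \<open>0\<close>. It is a compact subset of \<open>U\<close>,
  and Cauchy's formula over a grid contour \<open>\<Gamma>\<close> around \<open>K\<close> represents \<open>f\<close> on the curves.
  After exchanging the two integrations the inner integrals are multiples of winding numbers about
  points of \<open>\<Gamma>\<close>, which sum to \<open>0\<close>.
\<close>

theorem Cauchy_theorem_cycle:
  assumes U: "open U" and f: "f holomorphic_on U"
    and ps: "\<And>p. p \<in> set ps \<Longrightarrow> valid_path p \<and> pathfinish p = pathstart p \<and> path_image p \<subseteq> U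
       \<and> continuous_on {0..1} (\<lambda>t. vector_derivative p (at t))"
    and wind: "\<And>z. z \<notin> U \<Longrightarrow> (\<Sum>p\<leftarrow>ps. winding_number p z) = 0"
  shows "(\<Sum>p\<leftarrow>ps. contour_integral p f) = 0"
proof -
  define X where "X = cycle_image ps"
  define W where "W z = (\<Sum>p\<leftarrow>ps. winding_number p z)" for z
  define K where "K = - {z. z \<notin> X \<and> W z = 0}"
  have path: "path p" if "p \<in> set ps" for p using ps[OF that] by (simp add: valid_path_imp_path)
  have X: "compact X" unfolding X_def cycle_image_def using path by (auto intro!: compact_UN compact_path_image)
  have XU: "X \<subseteq> U" using ps by (auto simp: X_def cycle_image_def)
  have KU: "K \<subseteq> U" using XU wind by (auto simp: K_def W_def)
  have "open (- K)"
    unfolding open_contains_ball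
  proof
    fix z assume "z \<in> - K"
    then have z: "z \<notin> X" "W z = 0" by (auto simp: K_def)
    obtain r where r: "r > 0" "ball z r \<subseteq> - X"
      using z(1) X by (meson ComplI compact_imp_closed open_Compl openE)
    have "W w = W z" if w: "w \<in> ball z r" for w
    proof -
      have "winding_number p w = winding_number p z" if p: "p \<in> set ps" for p
        by (rule winding_number_eq[where S = "ball z r"])
           (use path[OF p] ps[OF p] p r w in \<open>auto simp: X_def cycle_image_def\<close>)
      then show ?thesis by (simp add: W_def cong: map_cong)
    qed
    then show "\<exists>e>0. ball z e \<subseteq> - K" using r z by (auto simp: K_def)
  qed
  moreover obtain B where B: "X \<subseteq> ball 0 B"
    using compact_imp_bounded[OF X] bounded_subset_ballD by blast
  have "W z = 0" if "z \<notin> ball 0 B" for z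
  proof -
    have "winding_number p z = 0" if p: "p \<in> set ps" for p
      by (rule winding_number_zero_outside[where s = "ball 0 B"])
         (use path[OF p] ps[OF p] p B \<open>z \<notin> ball 0 B\<close> in \<open>auto simp: X_def cycle_image_def\<close>)
    then show ?thesis by (simp add: W_def cong: map_cong)
  qed
  then have "K \<subseteq> ball 0 B" using B by (auto simp: K_def)
  ultimately have K: "compact K"
    using bounded_subset[OF bounded_ball] by (auto simp: compact_eq_bounded_closed closed_def)
  obtain \<Gamma> es where \<Gamma>: "\<And>\<gamma>. \<gamma> \<in> set \<Gamma> \<Longrightarrow> valid_path \<gamma>"
    and img: "cycle_image \<Gamma> \<subseteq> U - K" "cycle_image \<Gamma> = (\<Union>(a, b)\<in>set es. closed_segment a b)"
    and edges: "\<And>g. continuous_on (cycle_image \<Gamma>) g \<Longrightarrow>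
       (\<Sum>\<gamma>\<leftarrow>\<Gamma>. contour_integral \<gamma> g) = (\<Sum>(a, b)\<leftarrow>es. contour_integral (linepath a b) g)"
    and zero: "\<And>g. g holomorphic_on U \<Longrightarrow> (\<Sum>\<gamma>\<leftarrow>\<Gamma>. contour_integral \<gamma> g) = 0"
    and one: "\<And>z. z \<in> K \<Longrightarrow> (\<Sum>\<gamma>\<leftarrow>\<Gamma>. winding_number \<gamma> z) = 1"
    using grid_contour[OF K U KU] by metis
  have contf: "continuous_on U f" using f by (rule holomorphic_on_imp_continuous_on)
  have eU: "closed_segment a b \<subseteq> U - K" if "(a, b) \<in> set es" for a b
    using img that by auto
  have XK: "X \<subseteq> K" by (auto simp: K_def)
  define I where "I = (\<lambda>z (a, b). contour_integral (linepath a b) (\<lambda>w. f w / (w - z)))"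
  have repr: "2 * pi * \<i> * f z = (\<Sum>e\<leftarrow>es. I z e)" if z: "z \<in> X" for z
  proof -
    have zK: "z \<in> K" using XK z by blast
    \<comment> \<open>The difference quotient of \<open>f\<close> is holomorphic on all of \<open>U\<close>, so its integral over \<open>\<Gamma>\<close> vanishes and
      \<open>f w / (w - z)\<close> has the same integral as \<open>f z / (w - z)\<close>.\<close>
    define h where "h w = (if w = z then deriv f z else (f w - f z) / (w - z))" for w
    have h: "h holomorphic_on U" unfolding h_def by (rule pole_lemma_open[OF f U])
    have off: "z \<notin> path_image \<gamma>" "path_image \<gamma> \<subseteq> U" if "\<gamma> \<in> set \<Gamma>" for \<gamma>
      using that img(1) zK by (auto simp: cycle_image_def)
    have wn: "((\<lambda>w. 1 / (w - z)) has_contour_integral (2 * pi * \<i> * winding_number \<gamma> z)) \<gamma>" if "\<gamma> \<in> set \<Gamma>" for \<gamma>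
      using \<Gamma>[OF that] off(1)[OF that] by (rule has_contour_integral_winding_number)
    have "contour_integral \<gamma> (\<lambda>w. f w / (w - z)) = contour_integral \<gamma> h + f z * (2 * pi * \<i> * winding_number \<gamma> z)"
      if g: "\<gamma> \<in> set \<Gamma>" for \<gamma>
    proof (rule contour_integral_unique)
      have "(h has_contour_integral contour_integral \<gamma> h) \<gamma>"
        using \<Gamma>[OF g] off[OF g] h U by (intro has_contour_integral_integral contour_integrable_holomorphic_simple)
      from has_contour_integral_add[OF this has_contour_integral_lmul[OF wn[OF g], of "f z"]]
      show "((\<lambda>w. f w / (w - z)) has_contour_integral contour_integral \<gamma> h + f z * (2 * pi * \<i> * winding_number \<gamma> z)) \<gamma>"
        by (rule has_contour_integral_eq) (use off[OF g] in \<open>auto simp: h_def diff_divide_distrib\<close>)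
    qed
    then have "(\<Sum>\<gamma>\<leftarrow>\<Gamma>. contour_integral \<gamma> (\<lambda>w. f w / (w - z))) =
       (\<Sum>\<gamma>\<leftarrow>\<Gamma>. contour_integral \<gamma> h) + (\<Sum>\<gamma>\<leftarrow>\<Gamma>. f z * (2 * pi * \<i>) * winding_number \<gamma> z)"
      by (simp add: sum_list_addf mult.assoc cong: map_cong)
    also have "\<dots> = f z * (2 * pi * \<i>)"
      unfolding zero[OF h] sum_list_const_mult one[OF zK] by simp
    finally have "2 * pi * \<i> * f z = (\<Sum>\<gamma>\<leftarrow>\<Gamma>. contour_integral \<gamma> (\<lambda>w. f w / (w - z)))"
      by (simp add: mult_ac)
    also have "\<dots> = (\<Sum>e\<leftarrow>es. I z e)"
      unfolding I_def using img(1) zK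
      by (subst edges) (auto intro!: continuous_intros continuous_on_subset[OF contf])
    finally show ?thesis .
  qed
  have swap: "contour_integral p (\<lambda>z. I z (a, b)) = - (2 * pi * \<i>) * contour_integral (linepath a b) (\<lambda>w. f w * winding_number p w)"
    and pint: "(\<lambda>z. I z (a, b)) contour_integrable_on p"
    and wint: "(\<lambda>w. f w * winding_number p w) contour_integrable_on linepath a b"
    if p: "p \<in> set ps" and ab: "(a, b) \<in> set es" for p a b
  proof -
    have pX: "path_image p \<subseteq> X" using p by (auto simp: X_def cycle_image_def)
    then have disj: "path_image p \<inter> closed_segment a b = {}"
      using eU[OF ab] XK by blast
    have cf: "continuous_on (closed_segment a b) f"
      using eU[OF ab] by (intro continuous_on_subset[OF contf]) auto
    show "(\<lambda>z. I z (a, b)) contour_integrable_on p"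
      unfolding I_def prod.case
      by (rule contour_integrable_holomorphic_simple[where S = "- closed_segment a b"])
         (use holomorphic_Cauchy_integral_linepath[OF cf] ps[OF p] disj in \<open>auto simp: closed_def[symmetric]\<close>)
    have wn: "contour_integral p (\<lambda>z. f w / (w - z)) = - (2 * pi * \<i>) * (f w * winding_number p w)"
      if "w \<in> closed_segment a b" for w
    proof (rule contour_integral_unique)
      have "w \<notin> path_image p" using disj that by auto
      from has_contour_integral_lmul[OF has_contour_integral_winding_number[OF _ this], of "- f w"] ps[OF p]
      have "((\<lambda>z. - f w * (1 / (z - w))) has_contour_integral - f w * (2 * pi * \<i> * winding_number p w)) p" by blast
      moreover have "- f w * (1 / (z - w)) = f w / (w - z)" for z
        by (metis (no_types, opaque_lifting) minus_diff_eq minus_divide_divide minus_divide_left mult.right_neutral times_divide_eq_right)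
      ultimately show "((\<lambda>z. f w / (w - z)) has_contour_integral - (2 * pi * \<i>) * (f w * winding_number p w)) p"
        by (simp add: mult_ac)
    qed
    have "continuous_on (closed_segment a b) (winding_number p)"
      by (rule continuous_on_subset[OF continuous_on_winding_number[OF path[OF p]]])
         (use ps[OF p] disj in auto)
    then show "(\<lambda>w. f w * winding_number p w) contour_integrable_on linepath a b"
      by (intro contour_integrable_continuous_linepath continuous_intros cf)
    have cf': "continuous_on (path_image p \<times> closed_segment a b) (\<lambda>x. f (snd x))"
      by (rule continuous_on_compose2[OF cf]) (auto intro: continuous_intros)
    have "contour_integral p (\<lambda>z. contour_integral (linepath a b) (\<lambda>w. f w / (w - z))) =
       contour_integral (linepath a b) (\<lambda>w. contour_integral p (\<lambda>z. f w / (w - z)))"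
    proof (rule contour_integral_swap)
      show "continuous_on (path_image p \<times> path_image (linepath a b)) (\<lambda>(z, w). f w / (w - z))"
        using disj cf' by (auto simp: case_prod_unfold intro!: continuous_intros)
    qed (use ps[OF p] in auto)
    also have "\<dots> = contour_integral (linepath a b) (\<lambda>w. - (2 * pi * \<i>) * (f w * winding_number p w))"
      by (rule contour_integral_eq) (use wn in auto)
    also have "\<dots> = - (2 * pi * \<i>) * contour_integral (linepath a b) (\<lambda>w. f w * winding_number p w)"
      by (rule contour_integral_lmul) fact
    finally show "contour_integral p (\<lambda>z. I z (a, b)) = - (2 * pi * \<i>) * contour_integral (linepath a b) (\<lambda>w. f w * winding_number p w)"
      by (simp add: I_def)
  qed
  have "(\<Sum>p\<leftarrow>ps. 2 * pi * \<i> * contour_integral p f) = (\<Sum>p\<leftarrow>ps. \<Sum>(a, b)\<leftarrow>es. contour_integral p (\<lambda>z. I z (a, b)))"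
  proof (intro arg_cong[of _ _ sum_list] map_cong refl)
    fix p assume p: "p \<in> set ps"
    have "((\<lambda>z. \<Sum>e\<leftarrow>es. I z e) has_contour_integral (\<Sum>e\<leftarrow>es. contour_integral p (\<lambda>z. I z e))) p"
      by (rule has_contour_integral_sum_list) (use pint[OF p] has_contour_integral_integral in fast)
    then have "((\<lambda>z. 2 * pi * \<i> * f z) has_contour_integral (\<Sum>e\<leftarrow>es. contour_integral p (\<lambda>z. I z e))) p"
    proof (rule has_contour_integral_eq)
      fix z assume "z \<in> path_image p"
      then have "z \<in> X" using p by (auto simp: X_def cycle_image_def)
      then show "(\<Sum>e\<leftarrow>es. I z e) = 2 * pi * \<i> * f z" by (rule repr[symmetric])
    qed
    then have "contour_integral p (\<lambda>z. 2 * pi * \<i> * f z) = (\<Sum>e\<leftarrow>es. contour_integral p (\<lambda>z. I z e))"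
      by (rule contour_integral_unique)
    moreover have "contour_integral p (\<lambda>z. 2 * pi * \<i> * f z) = 2 * pi * \<i> * contour_integral p f"
      using ps[OF p] by (intro contour_integral_lmul contour_integrable_holomorphic_simple[OF f U]) auto
    ultimately show "2 * pi * \<i> * contour_integral p f = (\<Sum>(a, b)\<leftarrow>es. contour_integral p (\<lambda>z. I z (a, b)))"
      by (simp add: case_prod_unfold)
  qed
  also have "\<dots> = (\<Sum>(a, b)\<leftarrow>es. \<Sum>p\<leftarrow>ps. contour_integral p (\<lambda>z. I z (a, b)))"
    using sum_list_swap[of "\<lambda>p e. contour_integral p (\<lambda>z. I z e)" es ps] by (simp add: case_prod_unfold)
  also have "\<dots> = (\<Sum>(a, b)\<leftarrow>es. 0)"
  proof (intro arg_cong[of _ _ sum_list] map_cong refl, clarify)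
    fix a b assume ab: "(a, b) \<in> set es"
    have "(\<Sum>p\<leftarrow>ps. contour_integral p (\<lambda>z. I z (a, b))) =
        - (2 * pi * \<i>) * (\<Sum>p\<leftarrow>ps. contour_integral (linepath a b) (\<lambda>w. f w * winding_number p w))"
      unfolding sum_list_const_mult[symmetric]
      by (intro arg_cong[of _ _ sum_list] map_cong refl swap ab)
    also have "(\<Sum>p\<leftarrow>ps. contour_integral (linepath a b) (\<lambda>w. f w * winding_number p w)) =
        contour_integral (linepath a b) (\<lambda>w. \<Sum>p\<leftarrow>ps. f w * winding_number p w)"
      using wint[OF _ ab] by (intro contour_integral_unique[symmetric] has_contour_integral_sum_list has_contour_integral_integral)
    also have "\<dots> = contour_integral (linepath a b) (\<lambda>w. 0)"
    proof (rule contour_integral_eq)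
      fix w assume "w \<in> path_image (linepath a b)"
      then have "w \<notin> K" using eU[OF ab] by auto
      then have "W w = 0" by (simp add: K_def)
      then show "(\<Sum>p\<leftarrow>ps. f w * winding_number p w) = 0"
        by (simp only: sum_list_const_mult W_def[symmetric]) simp
    qed
    finally show "(\<Sum>p\<leftarrow>ps. contour_integral p (\<lambda>z. I z (a, b))) = 0" by simp
  qed
  finally have "2 * pi * \<i> * (\<Sum>p\<leftarrow>ps. contour_integral p f) = 0"
    by (simp add: sum_list_const_mult case_prod_unfold)
  then show ?thesis by simp
qed

section \<open>Riemann--Stieltjes sums along rectifiable loops\<close>

text \<open>
  The increments of \<open>\<Phi>\<close> over short parameter intervals are integrals over chords, so sums of chord
  integrals over fine partitions telescope. This is what makes Riemann--Stieltjes sums of holomorphic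
  functions converge, and identifies the limit with an integral over a smooth loop.
\<close>

lemma smooth_loop_approximation:
  assumes \<gamma>: "path \<gamma>" "pathfinish \<gamma> = pathstart \<gamma>" and U: "open U" "path_image \<gamma> \<subseteq> U"
  obtains p d where "valid_path p" "pathfinish p = pathstart p" "path_image p \<subseteq> U"
    "continuous_on {0..1} (\<lambda>t. vector_derivative p (at t))"
    "\<And>z. z \<notin> U \<Longrightarrow> winding_number p z = winding_number \<gamma> z"
    "d > 0"
    "\<And>s t. s \<in> {0..1} \<Longrightarrow> t \<in> {0..1} \<Longrightarrow> \<bar>t - s\<bar> < d \<Longrightarrow> closed_segment (\<gamma> s) (\<gamma> t) \<subseteq> U"
    "\<And>g. g holomorphic_on U \<Longrightarrow> \<exists>\<Phi>. \<Phi> 1 - \<Phi> 0 = contour_integral p g \<and>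
      (\<forall>s\<in>{0..1}. \<forall>t\<in>{0..1}. \<bar>t - s\<bar> < d \<longrightarrow> \<Phi> t - \<Phi> s = contour_integral (linepath (\<gamma> s) (\<gamma> t)) g)"
proof -
  have "path_image \<gamma> \<inter> - U = {}" using U by auto
  then obtain r where r: "r > 0" and rU: "\<And>x y. x \<in> path_image \<gamma> \<Longrightarrow> y \<in> - U \<Longrightarrow> r \<le> dist x y"
    using separate_compact_closed[OF compact_path_image[OF \<gamma>(1)], of "- U"] U by (auto simp: closed_Compl)
  have ballU: "ball (\<gamma> t) r \<subseteq> U" if "t \<in> {0..1}" for t
    using rU[of "\<gamma> t"] that by (fastforce simp: path_image_def)
  obtain p where p: "polynomial_function p" "pathstart p = pathstart \<gamma>" "pathfinish p = pathfinish \<gamma>"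
      and near: "\<And>t. t \<in> {0..1} \<Longrightarrow> norm (p t - \<gamma> t) < r / 2"
    using path_approx_polynomial_function[OF \<gamma>(1), of "r / 2"] r by (metis half_gt_zero)
  have vp: "valid_path p" using p(1) by (rule valid_path_polynomial_function)
  have pU: "path_image p \<subseteq> U"
  proof
    fix z assume "z \<in> path_image p"
    then obtain t where t: "t \<in> {0..1}" "z = p t" by (auto simp: path_image_def)
    then have "z \<in> ball (\<gamma> t) r" using near[OF t(1)] r by (simp add: dist_norm norm_minus_commute)
    then show "z \<in> U" using ballU[OF t(1)] by auto
  qed
  obtain p' where p': "polynomial_function p'" "\<And>x. (p has_vector_derivative p' x) (at x)"
    using has_vector_derivative_polynomial_function[OF p(1)] by blast
  have contp': "continuous_on {0..1} (\<lambda>t. vector_derivative p (at t))"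
    using continuous_on_polymonial_function[OF p'(1)] vector_derivative_at[OF p'(2)] by simp
  have wind: "winding_number p z = winding_number \<gamma> z" if z: "z \<notin> U" for z
  proof (rule winding_number_nearby_loops_eq)
    fix t :: real assume t: "t \<in> {0..1}"
    have "r \<le> dist (\<gamma> t) z" using t z by (intro rU) (auto simp: path_image_def)
    then show "norm (p t - \<gamma> t) < norm (\<gamma> t - z)" using near[OF t] r by (simp add: dist_norm)
  qed (use \<gamma> p vp in \<open>auto simp: valid_path_imp_path\<close>)
  have "uniformly_continuous_on {0..1} \<gamma>"
    using \<gamma>(1) by (intro compact_uniformly_continuous) (auto simp: path_def)
  then obtain d where d: "d > 0"
      and dr: "\<And>s t. s \<in> {0..1} \<Longrightarrow> t \<in> {0..1} \<Longrightarrow> \<bar>t - s\<bar> < d \<Longrightarrow> dist (\<gamma> t) (\<gamma> s) < r / 2"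
    unfolding uniformly_continuous_on_def dist_real_def using r by (metis half_gt_zero)
  have seg: "closed_segment (\<gamma> s) (\<gamma> t) \<subseteq> ball (\<gamma> s) r" if "s \<in> {0..1}" "t \<in> {0..1}" "\<bar>t - s\<bar> < d" for s t
    using dr[OF that] r by (intro closed_segment_subset) (auto simp: dist_commute)
  have "\<exists>\<Phi>. \<Phi> 1 - \<Phi> 0 = contour_integral p g \<and>
      (\<forall>s\<in>{0..1}. \<forall>t\<in>{0..1}. \<bar>t - s\<bar> < d \<longrightarrow> \<Phi> t - \<Phi> s = contour_integral (linepath (\<gamma> s) (\<gamma> t)) g)"
    if g: "g holomorphic_on U" for g
  proof -
    \<comment> \<open>A primitive of \<open>g\<close> along \<open>\<gamma>\<close>: follow the smooth loop \<open>p\<close> up to time \<open>t\<close>, then cross over to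
      \<open>\<gamma> t\<close>. Locally all these integrals are differences of one primitive \<open>G\<close> on a ball.\<close>
    define \<Phi> where "\<Phi> t = contour_integral (subpath 0 t p) g + contour_integral (linepath (p t) (\<gamma> t)) g" for t
    have gp: "g contour_integrable_on p"
      by (rule contour_integrable_holomorphic_simple[OF g U(1) vp pU])
    have "p 0 = \<gamma> 0" "p 1 = \<gamma> 1" using p by (auto simp: pathstart_def pathfinish_def)
    then have "\<Phi> 1 - \<Phi> 0 = contour_integral p g" by (simp add: \<Phi>_def)
    moreover have "\<Phi> t - \<Phi> s = contour_integral (linepath (\<gamma> s) (\<gamma> t)) g"
      if s: "s \<in> {0..1}" and t: "t \<in> {0..1}" and st: "\<bar>t - s\<bar> < d" for s t
    proof -
      have "g holomorphic_on ball (\<gamma> s) r" using g ballU[OF s] holomorphic_on_subset by blast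
      then obtain G where G: "\<And>x. x \<in> ball (\<gamma> s) r \<Longrightarrow> (G has_field_derivative g x) (at x within ball (\<gamma> s) r)"
        using holomorphic_convex_primitive'[of "ball (\<gamma> s) r" g] by (metis convex_ball open_ball)
      have int: "contour_integral q g = G (pathfinish q) - G (pathstart q)"
        if "valid_path q" "path_image q \<subseteq> ball (\<gamma> s) r" for q
        using contour_integral_primitive[OF G that] by (rule contour_integral_unique)
      have pin: "p u \<in> ball (\<gamma> s) r" if u: "u \<in> {0..1}" "\<bar>u - s\<bar> < d" for u
        using near[OF u(1)] dr[OF s u] dist_triangle_half_r[of "\<gamma> u" "\<gamma> s" r "p u"]
        by (simp add: dist_norm norm_minus_commute)
      have "path_image (subpath s t p) \<subseteq> ball (\<gamma> s) r"
      proof -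
        have "path_image (subpath s t p) = p ` closed_segment s t" by (simp add: path_image_subpath_gen)
        moreover have "u \<in> {0..1} \<and> \<bar>u - s\<bar> < d" if "u \<in> closed_segment s t" for u
          using that s t st by (auto simp: closed_segment_eq_real_ivl split: if_splits)
        ultimately show ?thesis using pin by auto
      qed
      from int[OF _ this] have 1: "contour_integral (subpath s t p) g = G (p t) - G (p s)"
        using vp s t by (simp add: valid_path_subpath)
      have 2: "contour_integral (subpath 0 t p) g = contour_integral (subpath 0 s p) g + contour_integral (subpath s t p) g"
        using contour_integral_subpath_combine[OF gp vp, of 0 s t] s t by simp
      have 3: "contour_integral (linepath (p u) (\<gamma> u)) g = G (\<gamma> u) - G (p u)" if "u \<in> {s, t}" for u
      proof -
        have u: "u \<in> {0..1}" "\<bar>u - s\<bar> < d" using that s t st d by auto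
        then have "\<gamma> u \<in> ball (\<gamma> s) r" using seg[OF s u] by auto
        then have "path_image (linepath (p u) (\<gamma> u)) \<subseteq> ball (\<gamma> s) r"
          using pin[OF u] by (simp add: closed_segment_subset)
        from int[OF _ this] show ?thesis by simp
      qed
      have 4: "contour_integral (linepath (\<gamma> s) (\<gamma> t)) g = G (\<gamma> t) - G (\<gamma> s)"
        using int[of "linepath (\<gamma> s) (\<gamma> t)"] seg[OF s t st] by simp
      show ?thesis using 1 2 3[of s] 3[of t] 4 by (simp add: \<Phi>_def)
    qed
    ultimately show ?thesis by blast
  qed
  moreover have "closed_segment (\<gamma> s) (\<gamma> t) \<subseteq> U" if "s \<in> {0..1}" "t \<in> {0..1}" "\<bar>t - s\<bar> < d" for s t
    using seg[OF that] ballU[OF that(1)] by blast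
  ultimately show ?thesis
    using that[of p d] vp p \<gamma>(2) pU contp' wind d by auto
qed

text \<open>
  The integral over each chord differs from the corresponding term of the sum by at most \<open>e\<close>
  times the length of the chord, and the integrals over the chords add up to \<open>I\<close>.
\<close>

lemma Riemann_sum_estimate:
  assumes rect: "rectifiable_path \<gamma>" and P: "partition01 n t"
    and \<Phi>: "\<Phi> 1 - \<Phi> 0 = I" "\<And>i. i < n \<Longrightarrow> \<Phi> (t (Suc i)) - \<Phi> (t i) = contour_integral (linepath (\<gamma> (t i)) (\<gamma> (t (Suc i)))) g"
    and cont: "\<And>i. i < n \<Longrightarrow> continuous_on (closed_segment (\<gamma> (t i)) (\<gamma> (t (Suc i)))) g"
    and osc: "\<And>i w. i < n \<Longrightarrow> w \<in> closed_segment (\<gamma> (t i)) (\<gamma> (t (Suc i))) \<Longrightarrow> cmod (g w - c i) \<le> e"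
    and e: "e \<ge> 0"
  shows "cmod ((\<Sum>i<n. (\<gamma> (t (Suc i)) - \<gamma> (t i)) * c i) - I) \<le> e * arc_length \<gamma>"
proof -
  have "I = (\<Sum>i<n. \<Phi> (t (Suc i)) - \<Phi> (t i))"
    using P \<Phi>(1) sum_lessThan_telescope[of "\<lambda>i. \<Phi> (t i)" n] by (simp add: partition01_def)
  also have "\<dots> = (\<Sum>i<n. contour_integral (linepath (\<gamma> (t i)) (\<gamma> (t (Suc i)))) g)"
    by (rule sum.cong) (use \<Phi>(2) in auto)
  finally have "(\<Sum>i<n. (\<gamma> (t (Suc i)) - \<gamma> (t i)) * c i) - I =
      (\<Sum>i<n. (\<gamma> (t (Suc i)) - \<gamma> (t i)) * c i - contour_integral (linepath (\<gamma> (t i)) (\<gamma> (t (Suc i)))) g)"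
    by (simp add: sum_subtractf)
  also have "cmod \<dots> \<le> (\<Sum>i<n. e * dist (\<gamma> (t i)) (\<gamma> (t (Suc i))))"
  proof (rule sum_norm_le)
    fix i assume "i \<in> {..<n}"
    then have i: "i < n" by simp
    let ?a = "\<gamma> (t i)" and ?b = "\<gamma> (t (Suc i))"
    have "((\<lambda>w. g w - c i) has_contour_integral (contour_integral (linepath ?a ?b) g - c i * (?b - ?a))) (linepath ?a ?b)"
      using cont[OF i] has_contour_integral_const_linepath[of "c i" ?b ?a]
      by (intro has_contour_integral_diff has_contour_integral_integral contour_integrable_continuous_linepath)
         (auto simp: mult.commute)
    from has_contour_integral_bound_linepath[OF this e osc[OF i]]
    show "cmod ((?b - ?a) * c i - contour_integral (linepath ?a ?b) g) \<le> e * dist ?a ?b"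
      by (simp add: dist_norm norm_minus_commute mult.commute)
  qed
  also have "\<dots> = e * (\<Sum>i<n. dist (\<gamma> (t i)) (\<gamma> (t (Suc i))))" by (simp add: sum_distrib_left)
  also have "\<dots> \<le> e * arc_length \<gamma>"
    using inscribed_length_le[OF rect P] e by (rule mult_left_mono)
  finally show ?thesis .
qed

section \<open>Holomorphic families of operators\<close>

lemma Blinfun_apply: "bounded_clinear f \<Longrightarrow> blinfun_apply (Blinfun f) = f"
  by (simp add: bounded_linear_Blinfun_apply bounded_clinear_bounded_linear)

lemma norm_Blinfun: "bounded_clinear f \<Longrightarrow> norm (Blinfun f) = onorm f"
  by (simp add: norm_blinfun.rep_eq Blinfun_apply)

lemma dist_Blinfun_le:
  assumes "bounded_clinear f" "bounded_clinear g"
  shows "norm (f x - g x) \<le> dist (Blinfun f) (Blinfun g) * norm x"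
proof -
  have "norm (blinfun_apply (Blinfun f - Blinfun g) x) \<le> norm (Blinfun f - Blinfun g) * norm x"
    by (rule norm_blinfun)
  then show ?thesis by (simp add: blinfun.diff_left Blinfun_apply assms dist_norm)
qed

text \<open>
  Holomorphy in Caratheodory's form: \<open>F w - F z = (w - z) Q w\<close> with \<open>Q\<close> continuous at \<open>z\<close> in
  operator norm. In this form products are differentiated without any limit computation.
\<close>

definition op_holomorphic_on ::
    "(complex \<Rightarrow> 'b::chilbert_space \<Rightarrow> 'a::chilbert_space) \<Rightarrow> complex set \<Rightarrow> bool" where
  "op_holomorphic_on F U \<longleftrightarrow> (\<forall>z\<in>U. bounded_clinear (F z)) \<and>
    (\<forall>z\<in>U. \<exists>Q. (\<forall>w\<in>U. bounded_clinear (Q w) \<and> (\<forall>x. F w x = F z x + (w - z) *\<^sub>C Q w x)) \<and>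
       continuous (at z within U) (\<lambda>w. Blinfun (Q w)))"

lemma op_holomorphic_bounded: "op_holomorphic_on F U \<Longrightarrow> z \<in> U \<Longrightarrow> bounded_clinear (F z)"
  by (auto simp: op_holomorphic_on_def)

lemma op_holomorphic_onE:
  assumes "op_holomorphic_on F U" "z \<in> U"
  obtains Q where "\<forall>w\<in>U. bounded_clinear (Q w)" "\<forall>w\<in>U. \<forall>x. F w x = F z x + (w - z) *\<^sub>C Q w x"
    "continuous (at z within U) (\<lambda>w. Blinfun (Q w))"
proof -
  have "\<exists>Q. (\<forall>w\<in>U. bounded_clinear (Q w) \<and> (\<forall>x. F w x = F z x + (w - z) *\<^sub>C Q w x)) \<and>
       continuous (at z within U) (\<lambda>w. Blinfun (Q w))"
    by (rule assms(1)[unfolded op_holomorphic_on_def, THEN conjunct2, THEN bspec, OF assms(2)])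
  then show ?thesis
    unfolding ball_conj_distrib by (elim exE conjE) (rule that)
qed

lemma op_holomorphic_subset:
  assumes F: "op_holomorphic_on F U" and V: "V \<subseteq> U"
  shows "op_holomorphic_on F V"
  unfolding op_holomorphic_on_def
proof (intro conjI ballI)
  show "bounded_clinear (F z)" if "z \<in> V" for z
    using op_holomorphic_bounded[OF F] V that by blast
  fix z assume "z \<in> V"
  then have z: "z \<in> U" using V by blast
  obtain Q where Q0: "\<forall>w\<in>U. bounded_clinear (Q w)"
    "\<forall>w\<in>U. \<forall>x. F w x = F z x + (w - z) *\<^sub>C Q w x" and cont: "continuous (at z within U) (\<lambda>w. Blinfun (Q w))"
    by (rule op_holomorphic_onE[OF F z]) (rule that)
  note Q = Q0[rule_format]
  show "\<exists>Q. (\<forall>w\<in>V. bounded_clinear (Q w) \<and> (\<forall>x. F w x = F z x + (w - z) *\<^sub>C Q w x)) \<and>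
       continuous (at z within V) (\<lambda>w. Blinfun (Q w))"
  proof (intro exI conjI ballI allI)
    show "continuous (at z within V) (\<lambda>w. Blinfun (Q w))"
      using continuous_within_subset[OF cont V] .
    fix w assume "w \<in> V"
    then have w: "w \<in> U" using V by blast
    show "bounded_clinear (Q w)" "\<And>x. F w x = F z x + (w - z) *\<^sub>C Q w x"
      using Q[OF w] by this
  qed
qed

lemma op_holomorphic_continuous:
  assumes F: "op_holomorphic_on F U"
  shows "continuous_on U (\<lambda>z. Blinfun (F z))"
  unfolding continuous_on_eq_continuous_within
proof
  fix z assume z: "z \<in> U"
  obtain Q where Q0: "\<forall>w\<in>U. bounded_clinear (Q w)" "\<forall>w\<in>U. \<forall>x. F w x = F z x + (w - z) *\<^sub>C Q w x"
    and cont: "continuous (at z within U) (\<lambda>w. Blinfun (Q w))"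
    by (rule op_holomorphic_onE[OF F z]) (rule that)
  note Q = Q0[rule_format]
  have bound: "dist (Blinfun (F w)) (Blinfun (F z)) \<le> cmod (w - z) * norm (Blinfun (Q w))" if w: "w \<in> U" for w
    unfolding dist_norm
  proof (rule norm_blinfun_bound)
    fix x
    have "norm (blinfun_apply (Blinfun (F w) - Blinfun (F z)) x) = cmod (w - z) * norm (Q w x)"
      using Q(2)[OF w, of x] op_holomorphic_bounded[OF F] w z by (simp add: blinfun.diff_left Blinfun_apply)
    also have "\<dots> \<le> cmod (w - z) * norm (Blinfun (Q w)) * norm x"
      using bounded_clinear_norm_le[OF Q(1)[OF w], of x] by (simp add: norm_Blinfun Q(1)[OF w] mult_left_mono mult.assoc)
    finally show "norm (blinfun_apply (Blinfun (F w) - Blinfun (F z)) x) \<le> cmod (w - z) * norm (Blinfun (Q w)) * norm x" .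
  qed simp
  have lim: "((\<lambda>w. cmod (w - z) * norm (Blinfun (Q w))) \<longlongrightarrow> cmod (z - z) * norm (Blinfun (Q z))) (at z within U)"
    by (intro tendsto_intros cont[unfolded continuous_within])
  have "((\<lambda>w. dist (Blinfun (F w)) (Blinfun (F z))) \<longlongrightarrow> 0) (at z within U)"
  proof (rule tendsto_sandwich[of "\<lambda>_. 0" _ _ "\<lambda>w. cmod (w - z) * norm (Blinfun (Q w))"])
    show "((\<lambda>w. cmod (w - z) * norm (Blinfun (Q w))) \<longlongrightarrow> 0) (at z within U)"
      using lim by simp
    show "\<forall>\<^sub>F w in at z within U. dist (Blinfun (F w)) (Blinfun (F z)) \<le> cmod (w - z) * norm (Blinfun (Q w))"
      unfolding eventually_at_filter using bound by (intro always_eventually allI impI)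
    show "((\<lambda>w. 0) \<longlongrightarrow> (0::real)) (at z within U)" by (rule tendsto_const)
  qed (simp add: always_eventually)
  then show "continuous (at z within U) (\<lambda>z. Blinfun (F z))"
    unfolding continuous_within by (rule iffD2[OF tendsto_dist_iff])
qed

lemma op_holomorphic_cinner:
  assumes F: "op_holomorphic_on F U"
  shows "(\<lambda>z. cinner y (F z x)) holomorphic_on U"
proof (rule holomorphic_onI)
  fix z assume z: "z \<in> U"
  obtain Q where Q0: "\<forall>w\<in>U. bounded_clinear (Q w)" "\<forall>w\<in>U. \<forall>x. F w x = F z x + (w - z) *\<^sub>C Q w x"
    and cont: "continuous (at z within U) (\<lambda>w. Blinfun (Q w))"
    by (rule op_holomorphic_onE[OF F z]) (rule that)
  note Q = Q0[rule_format]
  have "((\<lambda>w. blinfun_apply (Blinfun (Q w)) x) \<longlongrightarrow> blinfun_apply (Blinfun (Q z)) x) (at z within U)"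
    using cont by (intro tendsto_intros) (simp add: continuous_within)
  then have "((\<lambda>w. cinner y (blinfun_apply (Blinfun (Q w)) x)) \<longlongrightarrow> cinner y (blinfun_apply (Blinfun (Q z)) x)) (at z within U)"
    by (rule bounded_linear.tendsto[OF bounded_linear_cinner_right])
  moreover have "\<forall>\<^sub>F w in at z within U. cinner y (blinfun_apply (Blinfun (Q w)) x) =
      (cinner y (F w x) - cinner y (F z x)) / (w - z)"
    unfolding eventually_at_filter
    by (intro always_eventually allI impI)
       (simp add: Blinfun_apply Q(1) Q(2)[of _ x] cinner_add_right cinner_scaleC_right)
  ultimately have "((\<lambda>w. (cinner y (F w x) - cinner y (F z x)) / (w - z)) \<longlongrightarrow> cinner y (blinfun_apply (Blinfun (Q z)) x)) (at z within U)"
    by (rule Lim_transform_eventually)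
  then have "((\<lambda>z. cinner y (F z x)) has_field_derivative cinner y (blinfun_apply (Blinfun (Q z)) x)) (at z within U)"
    by (simp add: has_field_derivative_iff)
  then show "(\<lambda>z. cinner y (F z x)) field_differentiable at z within U"
    by (auto simp: field_differentiable_def)
qed

lemma op_holomorphic_const: "bounded_clinear M \<Longrightarrow> op_holomorphic_on (\<lambda>z. M) U"
  unfolding op_holomorphic_on_def
  by (intro conjI ballI exI[of _ "\<lambda>w x. 0"] allI) simp_all

text \<open>
  The product rule: if \<open>P\<close> and \<open>Q\<close> are the difference quotients of \<open>F\<close> and \<open>G\<close> at \<open>z\<close>, then
  \<open>P w (G w) + F z (Q w)\<close> is that of the product.
\<close>

lemma op_holomorphic_compose:
  assumes F: "op_holomorphic_on F U" and G: "op_holomorphic_on G U"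
  shows "op_holomorphic_on (\<lambda>z x. F z (G z x)) U"
  unfolding op_holomorphic_on_def
proof (intro conjI ballI)
  note Fb = op_holomorphic_bounded[OF F] and Gb = op_holomorphic_bounded[OF G]
  show "bounded_clinear (\<lambda>x. F z (G z x))" if "z \<in> U" for z
    by (rule bounded_clinear_compose[OF Fb[OF that] Gb[OF that]])
  fix z assume z: "z \<in> U"
  obtain P where P0: "\<forall>w\<in>U. bounded_clinear (P w)" "\<forall>w\<in>U. \<forall>x. F w x = F z x + (w - z) *\<^sub>C P w x"
    and contP: "continuous (at z within U) (\<lambda>w. Blinfun (P w))"
    by (rule op_holomorphic_onE[OF F z]) (rule that)
  note P = P0[rule_format]
  obtain Q where Q0: "\<forall>w\<in>U. bounded_clinear (Q w)" "\<forall>w\<in>U. \<forall>x. G w x = G z x + (w - z) *\<^sub>C Q w x"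
    and contQ: "continuous (at z within U) (\<lambda>w. Blinfun (Q w))"
    by (rule op_holomorphic_onE[OF G z]) (rule that)
  note Q = Q0[rule_format]
  define R where "R w x = P w (G w x) + F z (Q w x)" for w x
  have Rb: "bounded_clinear (R w)" if "w \<in> U" for w
    unfolding R_def[abs_def]
    by (rule bounded_clinear_add[OF bounded_clinear_compose[OF P(1) Gb] bounded_clinear_compose[OF Fb Q(1)]])
       (use that z in auto)
  have R: "F w (G w x) = F z (G z x) + (w - z) *\<^sub>C R w x" if w: "w \<in> U" for w x
  proof -
    have "F w (G w x) = F z (G w x) + (w - z) *\<^sub>C P w (G w x)" by (rule P(2)[OF w])
    also have "F z (G w x) = F z (G z x) + (w - z) *\<^sub>C F z (Q w x)"
      by (simp add: Q(2)[OF w, of x] bounded_clinear_simps[OF Fb[OF z]])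
    finally show ?thesis by (simp add: R_def scaleC_add_right add_ac)
  qed
  have Req: "Blinfun (R w) = (Blinfun (P w) o\<^sub>L Blinfun (G w)) + (Blinfun (F z) o\<^sub>L Blinfun (Q w))" if "w \<in> U" for w
    by (rule blinfun_eqI)
       (use that z P(1) Q(1) Rb Fb Gb in \<open>simp add: Blinfun_apply blinfun.add_left R_def\<close>)
  then have eq: "\<forall>\<^sub>F w in at z within U. (Blinfun (P w) o\<^sub>L Blinfun (G w)) + (Blinfun (F z) o\<^sub>L Blinfun (Q w)) = Blinfun (R w)"
    unfolding eventually_at_filter by (intro always_eventually allI impI) (rule sym)
  have contG: "continuous (at z within U) (\<lambda>w. Blinfun (G w))"
    using op_holomorphic_continuous[OF G] z unfolding continuous_on_eq_continuous_within by blast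
  have "continuous (at z within U) (\<lambda>w. (Blinfun (P w) o\<^sub>L Blinfun (G w)) + (Blinfun (F z) o\<^sub>L Blinfun (Q w)))"
    by (intro continuous_add bounded_bilinear.continuous[OF bounded_bilinear_blinfun_compose]
        contP contQ contG continuous_const)
  then have "((\<lambda>w. Blinfun (R w)) \<longlongrightarrow> (Blinfun (P z) o\<^sub>L Blinfun (G z)) + (Blinfun (F z) o\<^sub>L Blinfun (Q z))) (at z within U)"
    unfolding continuous_within by (rule Lim_transform_eventually[OF _ eq])
  then have "continuous (at z within U) (\<lambda>w. Blinfun (R w))"
    unfolding continuous_within Req[OF z] .
  then show "\<exists>R. (\<forall>w\<in>U. bounded_clinear (R w) \<and> (\<forall>x. F w (G w x) = F z (G z x) + (w - z) *\<^sub>C R w x)) \<and>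
       continuous (at z within U) (\<lambda>w. Blinfun (R w))"
    by (intro exI[of _ R] conjI ballI allI R Rb)
qed

section \<open>Contour integrals of operators\<close>

text \<open>
  The point \<open>w\<close> is not restricted to \<open>P\<close>, since it will lie on a chord of the curve \<open>P\<close>. Compactness is
  applied to a closed neighbourhood of \<open>P\<close> inside \<open>U\<close>.
\<close>

lemma uniform_continuity_near_compact:
  fixes F :: "complex \<Rightarrow> 'c::metric_space"
  assumes P: "compact P" and U: "open U" "P \<subseteq> U" and F: "continuous_on U F" and e: "e > 0"
  shows "\<exists>\<eta>>0. \<forall>z\<in>P. \<forall>w. dist w z < \<eta> \<longrightarrow> dist (F w) (F z) < e"
proof -
  have "P \<inter> - U = {}" using U by auto
  then obtain r where r: "r > 0" and rU: "\<And>x y. x \<in> P \<Longrightarrow> y \<in> - U \<Longrightarrow> r \<le> dist x y"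
    using separate_compact_closed[OF P, of "- U"] U by (auto simp: closed_Compl)
  define C where "C = {x + y | x y. x \<in> P \<and> y \<in> cball 0 (r / 2)}"
  have inC: "w \<in> C" if "z \<in> P" "dist w z \<le> r / 2" for z w
    unfolding C_def mem_Collect_eq using that by (rule_tac exI[of _ z], rule_tac exI[of _ "w - z"]) (auto simp: dist_norm norm_minus_commute)
  have "C \<subseteq> U"
  proof
    fix w assume "w \<in> C"
    then obtain x y where w: "w = x + y" "x \<in> P" "norm y \<le> r / 2" by (auto simp: C_def)
    then have "\<not> r \<le> dist x w" using r by (simp add: dist_norm)
    then show "w \<in> U" using rU[OF w(2)] by blast
  qed
  moreover have "compact C" unfolding C_def by (intro compact_sums P compact_cball)
  ultimately have "uniformly_continuous_on C F"
    using F continuous_on_subset compact_uniformly_continuous by blast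
  then obtain d where d: "d > 0" "\<And>z w. z \<in> C \<Longrightarrow> w \<in> C \<Longrightarrow> dist w z < d \<Longrightarrow> dist (F w) (F z) < e"
    unfolding uniformly_continuous_on_def using e by metis
  show ?thesis
    by (rule exI[of _ "min d (r / 2)"]) (use d r inC in auto)
qed

abbreviation op_sum ::
    "(complex \<Rightarrow> 'b::chilbert_space \<Rightarrow> 'a::chilbert_space) \<Rightarrow> (real \<Rightarrow> complex) \<Rightarrow> nat \<Rightarrow> (nat \<Rightarrow> real) \<Rightarrow> (nat \<Rightarrow> real) \<Rightarrow> 'b \<Rightarrow> 'a" where
  "op_sum F \<gamma> n t \<tau> x \<equiv> (\<Sum>i<n. (\<gamma> (t (Suc i)) - \<gamma> (t i)) *\<^sub>C F (\<gamma> (\<tau> i)) x)"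

definition fine_part :: "real \<Rightarrow> nat \<Rightarrow> (nat \<Rightarrow> real) \<Rightarrow> (nat \<Rightarrow> real) \<Rightarrow> bool" where
  "fine_part d n t \<tau> \<longleftrightarrow> partition01 n t \<and> (\<forall>i<n. \<tau> i \<in> {t i..t (Suc i)} \<and> t (Suc i) - t i < d)"

lemma has_op_contour_integral_iff:
  "has_op_contour_integral F J \<gamma> \<longleftrightarrow> bounded_clinear J \<and>
    (\<forall>e>0. \<exists>d>0. \<forall>n t \<tau>. fine_part d n t \<tau> \<longrightarrow>
      bounded_clinear (\<lambda>x. op_sum F \<gamma> n t \<tau> x - J x) \<and> onorm (\<lambda>x. op_sum F \<gamma> n t \<tau> x - J x) < e)"
  by (simp add: has_op_contour_integral_def fine_part_def Let_def)

lemma fine_part_tag_in: "fine_part d n t \<tau> \<Longrightarrow> i < n \<Longrightarrow> \<tau> i \<in> {0..1}"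
  using partition01_in[of n t i] partition01_in[of n t "Suc i"] by (fastforce simp: fine_part_def)

lemma fine_part_uniform:
  assumes "d > 0"
  shows "\<forall>\<^sub>F n in sequentially. fine_part d (Suc n) (\<lambda>i. real i / real (Suc n)) (\<lambda>i. real i / real (Suc n))"
proof -
  have "\<forall>\<^sub>F n in sequentially. inverse (real (Suc n)) < d"
    using LIMSEQ_inverse_real_of_nat assms by (rule order_tendstoD(2))
  then show ?thesis
  proof eventually_elim
    case (elim n)
    then show ?case
      by (auto simp: fine_part_def partition01_def divide_right_mono inverse_eq_divide simp flip: diff_divide_distrib)
  qed
qed

text \<open>
  The scalar integrals of \<open>\<langle>y, F z x\<rangle>\<close> give the weak estimate \<open>weak\<close>, uniform in \<open>x\<close> and \<open>y\<close>. Taking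
  for \<open>y\<close> the difference of two Riemann sums shows that the sums are Cauchy in operator norm.
\<close>

theorem has_op_contour_integral_holomorphic:
  fixes F :: "complex \<Rightarrow> 'b::chilbert_space \<Rightarrow> 'a::chilbert_space"
  assumes F: "op_holomorphic_on F U" and U: "open U" "path_image \<gamma> \<subseteq> U"
    and rect: "rectifiable_path \<gamma>" and d: "d > 0"
    and \<Phi>: "\<And>g. g holomorphic_on U \<Longrightarrow> \<exists>\<Phi>. \<Phi> 1 - \<Phi> 0 = contour_integral p g \<and>
      (\<forall>s\<in>{0..1}. \<forall>t\<in>{0..1}. \<bar>t - s\<bar> < d \<longrightarrow> \<Phi> t - \<Phi> s = contour_integral (linepath (\<gamma> s) (\<gamma> t)) g)"
    and seg: "\<And>s t. s \<in> {0..1} \<Longrightarrow> t \<in> {0..1} \<Longrightarrow> \<bar>t - s\<bar> < d \<Longrightarrow> closed_segment (\<gamma> s) (\<gamma> t) \<subseteq> U"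
  shows "\<exists>J. has_op_contour_integral F J \<gamma> \<and> (\<forall>x y. cinner y (J x) = contour_integral p (\<lambda>z. cinner y (F z x)))"
proof -
  note Fb = op_holomorphic_bounded[OF F]
  have Fg: "bounded_clinear (F (\<gamma> s))" if "s \<in> {0..1}" for s
    using Fb U(2) that unfolding path_image_def by blast
  have path: "path \<gamma>" using rect by (simp add: rectifiable_path_def)
  let ?I = "\<lambda>x y. contour_integral p (\<lambda>z. cinner y (F z x))"
  have weak: "\<exists>\<delta>>0. \<forall>n t \<tau>. fine_part \<delta> n t \<tau> \<longrightarrow> (\<forall>x y. cmod (cinner y (op_sum F \<gamma> n t \<tau> x) - ?I x y) \<le> e * norm x * norm y)"
    if e: "e > 0" for e
  proof -
    define e' where "e' = e / (arc_length \<gamma> + 1)"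
    have al: "arc_length \<gamma> \<ge> 0" using rect by (rule arc_length_nonneg)
    have e': "e' > 0" "e' * arc_length \<gamma> \<le> e" using e al by (auto simp: e'_def field_simps)
    obtain \<eta> where \<eta>: "\<eta> > 0" "\<And>z w. z \<in> path_image \<gamma> \<Longrightarrow> dist w z < \<eta> \<Longrightarrow> dist (Blinfun (F w)) (Blinfun (F z)) < e'"
      using uniform_continuity_near_compact[OF compact_path_image[OF path] U op_holomorphic_continuous[OF F] e'(1)] by blast
    have "uniformly_continuous_on {0..1} \<gamma>"
      using path by (intro compact_uniformly_continuous) (auto simp: path_def)
    then obtain d' where d': "d' > 0"
        and dr: "\<And>s t. s \<in> {0..1} \<Longrightarrow> t \<in> {0..1} \<Longrightarrow> \<bar>t - s\<bar> < d' \<Longrightarrow> dist (\<gamma> t) (\<gamma> s) < \<eta>"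
      unfolding uniformly_continuous_on_def dist_real_def using \<eta>(1) by metis
    define \<delta> where "\<delta> = min d d'"
    have "cmod (cinner y (op_sum F \<gamma> n t \<tau> x) - ?I x y) \<le> e * norm x * norm y" if fine: "fine_part \<delta> n t \<tau>" for n t \<tau> x y
    proof -
      have P: "partition01 n t" using fine by (simp add: fine_part_def)
      have tin: "t i \<in> {0..1}" "t (Suc i) \<in> {0..1}" "\<tau> i \<in> {0..1}"
          "\<bar>t (Suc i) - t i\<bar> < \<delta>" "\<bar>\<tau> i - t i\<bar> < \<delta>" "\<bar>t (Suc i) - \<tau> i\<bar> < \<delta>" if i: "i < n" for i
      proof -
        show "t i \<in> {0..1}" "t (Suc i) \<in> {0..1}" using partition01_in[OF P] i by auto
        show "\<tau> i \<in> {0..1}" using fine_part_tag_in[OF fine i] .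
        have "t i \<le> \<tau> i" "\<tau> i \<le> t (Suc i)" "t (Suc i) - t i < \<delta>" using fine i by (auto simp: fine_part_def)
        then show "\<bar>t (Suc i) - t i\<bar> < \<delta>" "\<bar>\<tau> i - t i\<bar> < \<delta>" "\<bar>t (Suc i) - \<tau> i\<bar> < \<delta>" by auto
      qed
      define g where "g z = cinner y (F z x)" for z
      have g: "g holomorphic_on U" unfolding g_def by (rule op_holomorphic_cinner[OF F])
      obtain \<Phi>' where \<Phi>': "\<Phi>' 1 - \<Phi>' 0 = contour_integral p g"
        "\<And>s t. s \<in> {0..1} \<Longrightarrow> t \<in> {0..1} \<Longrightarrow> \<bar>t - s\<bar> < d \<Longrightarrow> \<Phi>' t - \<Phi>' s = contour_integral (linepath (\<gamma> s) (\<gamma> t)) g"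
        using \<Phi>[OF g] by blast
      have segi: "closed_segment (\<gamma> (t i)) (\<gamma> (t (Suc i))) \<subseteq> U" if i: "i < n" for i
        using seg tin[OF i] by (simp add: \<delta>_def)
      have "cmod ((\<Sum>i<n. (\<gamma> (t (Suc i)) - \<gamma> (t i)) * g (\<gamma> (\<tau> i))) - contour_integral p g) \<le> (e' * norm x * norm y) * arc_length \<gamma>"
      proof (rule Riemann_sum_estimate[OF rect P \<Phi>'(1)])
        fix i assume i: "i < n"
        show "\<Phi>' (t (Suc i)) - \<Phi>' (t i) = contour_integral (linepath (\<gamma> (t i)) (\<gamma> (t (Suc i)))) g"
          using \<Phi>'(2) tin[OF i] by (simp add: \<delta>_def)
        show "continuous_on (closed_segment (\<gamma> (t i)) (\<gamma> (t (Suc i)))) g"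
          using segi[OF i] holomorphic_on_imp_continuous_on[OF g] continuous_on_subset by blast
        fix w assume w: "w \<in> closed_segment (\<gamma> (t i)) (\<gamma> (t (Suc i)))"
        have "closed_segment (\<gamma> (t i)) (\<gamma> (t (Suc i))) \<subseteq> ball (\<gamma> (\<tau> i)) \<eta>"
          using dr[of "t i" "\<tau> i"] dr[of "\<tau> i" "t (Suc i)"] tin[OF i]
          by (intro closed_segment_subset) (auto simp: \<delta>_def dist_commute)
        then have dw: "dist w (\<gamma> (\<tau> i)) < \<eta>" using w by (auto simp: dist_commute)
        have \<gamma>in: "\<gamma> (\<tau> i) \<in> path_image \<gamma>" using tin(3)[OF i] by (auto simp: path_image_def)
        have wU: "w \<in> U" using w segi[OF i] by blast
        have "cmod (g w - g (\<gamma> (\<tau> i))) \<le> norm y * norm (F w x - F (\<gamma> (\<tau> i)) x)"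
          unfolding g_def cinner_diff_right[symmetric] by (rule norm_cinner_le)
        also have "\<dots> \<le> norm y * (e' * norm x)"
        proof (intro mult_left_mono)
          have "norm (F w x - F (\<gamma> (\<tau> i)) x) \<le> dist (Blinfun (F w)) (Blinfun (F (\<gamma> (\<tau> i)))) * norm x"
            using Fb[OF wU] Fg[OF tin(3)[OF i]] by (rule dist_Blinfun_le)
          also have "\<dots> \<le> e' * norm x" using \<eta>(2)[OF \<gamma>in dw] by (simp add: mult_right_mono)
          finally show "norm (F w x - F (\<gamma> (\<tau> i)) x) \<le> e' * norm x" .
        qed simp
        finally show "cmod (g w - g (\<gamma> (\<tau> i))) \<le> e' * norm x * norm y" by (simp add: mult_ac)
      qed (use e' in auto)
      also have "\<dots> = (e' * arc_length \<gamma>) * (norm x * norm y)" by (simp add: mult_ac)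
      also have "\<dots> \<le> e * (norm x * norm y)" using e' by (intro mult_right_mono) auto
      finally show ?thesis by (simp add: g_def[abs_def] cinner_sum_right cinner_scaleC_right mult.assoc)
    qed
    then show ?thesis using d d' by (intro exI[of _ \<delta>]) (auto simp: \<delta>_def)
  qed
  define R where "R n x = op_sum F \<gamma> (Suc n) (\<lambda>i. real i / real (Suc n)) (\<lambda>i. real i / real (Suc n)) x" for n x
  have Rweak: "\<forall>\<^sub>F n in sequentially. \<forall>x y. cmod (cinner y (R n x) - ?I x y) \<le> e * norm x * norm y" if e: "e > 0" for e
  proof -
    obtain \<delta> where \<delta>: "\<delta> > 0" "\<And>n t \<tau> x y. fine_part \<delta> n t \<tau> \<Longrightarrow> cmod (cinner y (op_sum F \<gamma> n t \<tau> x) - ?I x y) \<le> e * norm x * norm y"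
      using weak[OF e] by blast
    show ?thesis
      using fine_part_uniform[OF \<delta>(1)] unfolding R_def by eventually_elim (use \<delta>(2) in blast)
  qed
  have strong: "norm v \<le> c" if "\<And>y. cmod (cinner y v) \<le> c * norm y" "c \<ge> 0" for v :: 'a and c
  proof (cases "v = 0")
    case False
    have "(norm v)\<^sup>2 \<le> c * norm v" using that(1)[of v] by (simp add: cinner_self norm_power)
    then show ?thesis using False by (simp add: power2_eq_square)
  qed (use that in simp)
  have Rb: "bounded_clinear (\<lambda>x. op_sum F \<gamma> n t \<tau> x)" if "fine_part \<delta> n t \<tau>" for \<delta> n t \<tau>
    using fine_part_tag_in[OF that] Fg by (intro bounded_clinear_sum bounded_clinear_scaleC) auto
  have "Cauchy (\<lambda>n. R n x)" for x
  proof (rule CauchyI)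
    fix \<epsilon> :: real assume "\<epsilon> > 0"
    define e where "e = \<epsilon> / (2 * norm x + 1)"
    have e: "e > 0" "2 * e * norm x < \<epsilon>"
      using \<open>\<epsilon> > 0\<close> by (auto simp: e_def field_simps add_pos_nonneg)
    obtain N where N: "\<And>n y. n \<ge> N \<Longrightarrow> cmod (cinner y (R n x) - ?I x y) \<le> e * norm x * norm y"
      using Rweak[OF e(1)] unfolding eventually_sequentially by blast
    have "norm (R m x - R n x) < \<epsilon>" if "m \<ge> N" "n \<ge> N" for m n
    proof -
      have "norm (R m x - R n x) \<le> 2 * e * norm x"
      proof (rule strong)
        fix y
        have "cmod (cinner y (R m x - R n x)) = cmod ((cinner y (R m x) - ?I x y) - (cinner y (R n x) - ?I x y))"
          by (simp add: cinner_diff_right)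
        also have "\<dots> \<le> e * norm x * norm y + e * norm x * norm y"
          using N[OF that(1), of y] N[OF that(2), of y] norm_triangle_ineq4 by (rule order_trans[OF _ add_mono, rotated])
        finally show "cmod (cinner y (R m x - R n x)) \<le> 2 * e * norm x * norm y" by (simp add: mult_ac)
      qed (use e in auto)
      then show ?thesis using e by simp
    qed
    then show "\<exists>N. \<forall>m\<ge>N. \<forall>n\<ge>N. norm (R m x - R n x) < \<epsilon>" by blast
  qed
  then have "\<exists>l. (\<lambda>n. R n x) \<longlonglongrightarrow> l" for x
    by (metis Cauchy_convergent_iff convergent_def)
  then obtain J where J: "\<And>x. (\<lambda>n. R n x) \<longlonglongrightarrow> J x" by metis
  have Jw: "cinner y (J x) = ?I x y" for x y
  proof (rule LIMSEQ_unique)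
    show "(\<lambda>n. cinner y (R n x)) \<longlonglongrightarrow> cinner y (J x)"
      by (rule bounded_linear.tendsto[OF bounded_linear_cinner_right J])
    show "(\<lambda>n. cinner y (R n x)) \<longlonglongrightarrow> ?I x y"
    proof (rule tendstoI)
      fix \<epsilon> :: real assume "\<epsilon> > 0"
      define e where "e = \<epsilon> / (norm x * norm y + 1)"
      have e: "e > 0" "e * norm x * norm y < \<epsilon>"
        using \<open>\<epsilon> > 0\<close> by (auto simp: e_def field_simps add_pos_nonneg)
      show "\<forall>\<^sub>F n in sequentially. dist (cinner y (R n x)) (?I x y) < \<epsilon>"
        using Rweak[OF e(1)]
      proof eventually_elim
        case (elim n)
        then have "cmod (cinner y (R n x) - ?I x y) \<le> e * norm x * norm y" by blast
        then show ?case using e(2) unfolding dist_norm by linarith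
      qed
    qed
  qed
  have est: "\<exists>\<delta>>0. \<forall>n t \<tau>. fine_part \<delta> n t \<tau> \<longrightarrow> (\<forall>x. norm (op_sum F \<gamma> n t \<tau> x - J x) \<le> e * norm x)"
    if e: "e > 0" for e
  proof -
    obtain \<delta> where \<delta>: "\<delta> > 0" "\<And>n t \<tau> x y. fine_part \<delta> n t \<tau> \<Longrightarrow> cmod (cinner y (op_sum F \<gamma> n t \<tau> x) - ?I x y) \<le> e * norm x * norm y"
      using weak[OF e] by blast
    have "norm (op_sum F \<gamma> n t \<tau> x - J x) \<le> e * norm x" if f: "fine_part \<delta> n t \<tau>" for n t \<tau> x
      by (rule strong) (use \<delta>(2)[OF f, of _ x] e in \<open>auto simp: cinner_diff_right Jw\<close>)
    then show ?thesis using \<delta>(1) by blast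
  qed
  have Rlin: "bounded_clinear (R n)" for n
    unfolding R_def[abs_def]
    by (rule Rb[of 2]) (auto simp: fine_part_def partition01_def divide_right_mono field_simps)
  have Jb: "bounded_clinear J"
  proof -
    obtain \<delta> where \<delta>: "\<delta> > 0" "\<And>n t \<tau> x. fine_part \<delta> n t \<tau> \<Longrightarrow> norm (op_sum F \<gamma> n t \<tau> x - J x) \<le> 1 * norm x"
      using est[of 1] by auto
    obtain n where "fine_part \<delta> (Suc n) (\<lambda>i. real i / real (Suc n)) (\<lambda>i. real i / real (Suc n))"
      using fine_part_uniform[OF \<delta>(1)] by (auto simp: eventually_sequentially)
    from \<delta>(2)[OF this] have n: "norm (R n x - J x) \<le> norm x" for x by (simp add: R_def)
    show ?thesis
    proof (rule bounded_clinearI[where K = "onorm (R n) + 1"])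
      fix x y :: 'b and c :: complex
      show "J (x + y) = J x + J y"
        using tendsto_add[OF J J, of x y] J[of "x + y"]
        by (simp add: bounded_clinear_simps[OF Rlin] LIMSEQ_unique)
      show "J (c *\<^sub>C x) = c *\<^sub>C J x"
        using bounded_linear.tendsto[OF bounded_linear_scaleC_right J, of c x] J[of "c *\<^sub>C x"]
        by (simp add: bounded_clinear_simps[OF Rlin] LIMSEQ_unique)
      have "norm (J x) \<le> norm (R n x) + norm (R n x - J x)"
        using norm_triangle_ineq4[of "R n x" "R n x - J x"] by simp
      then show "norm (J x) \<le> (onorm (R n) + 1) * norm x"
        using n[of x] bounded_clinear_norm_le[OF Rlin, of n x] by (simp add: distrib_right)
    qed
  qed
  have "has_op_contour_integral F J \<gamma>"
    unfolding has_op_contour_integral_iff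
  proof (intro conjI allI impI Jb)
    fix \<epsilon> :: real assume "\<epsilon> > 0"
    then obtain \<delta> where \<delta>: "\<delta> > 0" "\<And>n t \<tau> x. fine_part \<delta> n t \<tau> \<Longrightarrow> norm (op_sum F \<gamma> n t \<tau> x - J x) \<le> \<epsilon> / 2 * norm x"
      using est[of "\<epsilon> / 2"] by auto
    have "bounded_clinear (\<lambda>x. op_sum F \<gamma> n t \<tau> x - J x) \<and> onorm (\<lambda>x. op_sum F \<gamma> n t \<tau> x - J x) < \<epsilon>"
      if f: "fine_part \<delta> n t \<tau>" for n t \<tau>
    proof
      show "bounded_clinear (\<lambda>x. op_sum F \<gamma> n t \<tau> x - J x)" by (intro bounded_clinear_diff Rb[OF f] Jb)
      have "onorm (\<lambda>x. op_sum F \<gamma> n t \<tau> x - J x) \<le> \<epsilon> / 2"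
        by (rule onorm_bound) (use \<delta>(2)[OF f] \<open>\<epsilon> > 0\<close> in auto)
      then show "onorm (\<lambda>x. op_sum F \<gamma> n t \<tau> x - J x) < \<epsilon>" using \<open>\<epsilon> > 0\<close> by simp
    qed
    then show "\<exists>d>0. \<forall>n t \<tau>. fine_part d n t \<tau> \<longrightarrow> bounded_clinear (\<lambda>x. op_sum F \<gamma> n t \<tau> x - J x) \<and>
        onorm (\<lambda>x. op_sum F \<gamma> n t \<tau> x - J x) < \<epsilon>"
      using \<delta>(1) by blast
  qed
  then show ?thesis using Jw by blast
qed

lemma has_op_contour_integral_limit:
  assumes "has_op_contour_integral F J \<gamma>"
  shows "(\<lambda>n. op_sum F \<gamma> (Suc n) (\<lambda>i. real i / real (Suc n)) (\<lambda>i. real i / real (Suc n)) x) \<longlonglongrightarrow> J x"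
proof (rule tendstoI)
  fix \<epsilon> :: real assume "\<epsilon> > 0"
  define e where "e = \<epsilon> / (norm x + 1)"
  have e: "e > 0" "e * norm x < \<epsilon>"
    using \<open>\<epsilon> > 0\<close> by (auto simp: e_def field_simps add_pos_nonneg)
  obtain \<delta> where \<delta>: "\<delta> > 0" "\<And>n t \<tau>. fine_part \<delta> n t \<tau> \<Longrightarrow>
      bounded_clinear (\<lambda>x. op_sum F \<gamma> n t \<tau> x - J x) \<and> onorm (\<lambda>x. op_sum F \<gamma> n t \<tau> x - J x) < e"
    using assms e(1) unfolding has_op_contour_integral_iff by blast
  show "\<forall>\<^sub>F n in sequentially. dist (op_sum F \<gamma> (Suc n) (\<lambda>i. real i / real (Suc n)) (\<lambda>i. real i / real (Suc n)) x) (J x) < \<epsilon>"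
    using fine_part_uniform[OF \<delta>(1)]
  proof eventually_elim
    case (elim n)
    note E = \<delta>(2)[OF elim]
    have "norm (op_sum F \<gamma> (Suc n) (\<lambda>i. real i / real (Suc n)) (\<lambda>i. real i / real (Suc n)) x - J x) \<le> e * norm x"
      by (rule order_trans[OF bounded_clinear_norm_le[OF conjunct1[OF E]] mult_right_mono])
         (use E in auto)
    then show ?case using e(2) unfolding dist_norm by linarith
  qed
qed

lemma partition01_uniform: "partition01 (Suc n) (\<lambda>i. real i / real (Suc n))"
  by (auto simp: partition01_def divide_right_mono)

text \<open>
  Each Riemann sum satisfies the bound.
\<close>

lemma has_op_contour_integral_bound:
  assumes J: "has_op_contour_integral F J \<gamma>" and rect: "rectifiable_path \<gamma>"
    and F: "\<And>s x. s \<in> {0..1} \<Longrightarrow> norm (F (\<gamma> s) x) \<le> c * norm x" and c: "c \<ge> 0"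
  shows "norm (J x) \<le> c * arc_length \<gamma> * norm x"
proof (rule LIMSEQ_le_const2[OF tendsto_norm[OF has_op_contour_integral_limit[OF J]]], intro exI allI impI)
  fix n :: nat
  let ?t = "\<lambda>i. real i / real (Suc n)"
  have "norm (op_sum F \<gamma> (Suc n) ?t ?t x) \<le> (\<Sum>i<Suc n. c * norm x * dist (\<gamma> (?t i)) (\<gamma> (?t (Suc i))))"
  proof (rule sum_norm_le)
    fix i assume "i \<in> {..<Suc n}"
    then have "?t i \<in> {0..1}" using partition01_in[OF partition01_uniform, of i n] by simp
    from F[OF this, of x] show "norm ((\<gamma> (?t (Suc i)) - \<gamma> (?t i)) *\<^sub>C F (\<gamma> (?t i)) x) \<le> c * norm x * dist (\<gamma> (?t i)) (\<gamma> (?t (Suc i)))"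
      by (simp add: dist_norm norm_minus_commute mult_right_mono mult.commute del: of_nat_Suc)
  qed
  also have "\<dots> = c * norm x * (\<Sum>i<Suc n. dist (\<gamma> (?t i)) (\<gamma> (?t (Suc i))))"
    by (rule sum_distrib_left[symmetric])
  also have "\<dots> \<le> c * norm x * arc_length \<gamma>"
    using inscribed_length_le[OF rect partition01_uniform, of n] c by (intro mult_left_mono) auto
  finally show "norm (op_sum F \<gamma> (Suc n) ?t ?t x) \<le> c * arc_length \<gamma> * norm x" by (simp only: mult_ac)
qed

section \<open>Resolvents\<close>

lemma resolvent_props:
  assumes "z \<notin> spectrum D L"
  shows "resolvent D L z v \<in> D" "z *\<^sub>C resolvent D L z v - L (resolvent D L z v) = v"
    "x \<in> D \<Longrightarrow> resolvent D L z (z *\<^sub>C x - L x) = x" "bounded_clinear (resolvent D L z)"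
proof -
  have bij: "bij_betw (\<lambda>x. z *\<^sub>C x - L x) D UNIV" and "bounded_clinear (resolvent D L z)"
    using assms by (auto simp: spectrum_def)
  then show "bounded_clinear (resolvent D L z)" by simp
  have img: "v \<in> (\<lambda>x. z *\<^sub>C x - L x) ` D" for v using bij by (simp add: bij_betw_def)
  show "resolvent D L z v \<in> D" unfolding resolvent_def by (rule inv_into_into[OF img])
  show "z *\<^sub>C resolvent D L z v - L (resolvent D L z v) = v"
    unfolding resolvent_def using f_inv_into_f[OF img, of v] by simp
  show "resolvent D L z (z *\<^sub>C x - L x) = x" if "x \<in> D"
    unfolding resolvent_def using inv_into_f_f[of "\<lambda>x. z *\<^sub>C x - L x" D x] bij that by (simp add: bij_betw_def)
qed

lemma resolvent_eqI:
  assumes B: "bounded_clinear B" "\<And>v. B v \<in> D" "\<And>v. z *\<^sub>C B v - L (B v) = v"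
    "\<And>x. x \<in> D \<Longrightarrow> B (z *\<^sub>C x - L x) = x"
  shows "z \<notin> spectrum D L \<and> resolvent D L z = B"
proof -
  have bij: "bij_betw (\<lambda>x. z *\<^sub>C x - L x) D UNIV"
    by (rule bij_betwI[where g = B]) (use B in auto)
  have "resolvent D L z v = B v" for v
    unfolding resolvent_def using bij B by (intro inv_into_f_eq) (auto simp: bij_betw_def)
  then have "resolvent D L z = B" by (rule ext)
  then show ?thesis using bij B(1) by (simp add: spectrum_def)
qed

lemma inv_into_eq_minus_resolvent:
  assumes L: "closed_densely_defined D L" and z: "z \<notin> spectrum D L"
  shows "inv_into D (\<lambda>x. L x - z *\<^sub>C x) v = - resolvent D L z v"
proof (rule inv_into_f_eq)
  note R = resolvent_props[OF z]
  have neg: "- resolvent D L z v = (- 1) *\<^sub>C resolvent D L z v" by (simp add: scaleC_minus1)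
  show "- resolvent D L z v \<in> D" unfolding neg by (rule cdd_simps(4)[OF L R(1)])
  have "L (- resolvent D L z v) = - L (resolvent D L z v)"
    unfolding neg by (subst cdd_simps(5)[OF L R(1)]) (simp add: scaleC_minus1)
  then show "L (- resolvent D L z v) - z *\<^sub>C (- resolvent D L z v) = v"
    using R(2)[of v] by (simp add: scaleC_minus_right)
  show "inj_on (\<lambda>x. L x - z *\<^sub>C x) D"
  proof (rule inj_onI)
    fix x y assume xy: "x \<in> D" "y \<in> D" "L x - z *\<^sub>C x = L y - z *\<^sub>C y"
    then have "z *\<^sub>C x - L x = z *\<^sub>C y - L y" by (metis minus_diff_eq)
    then show "x = y" using R(3) xy by metis
  qed
qed

text \<open>
  For given \<open>v\<close>, the map \<open>u \<mapsto> v - A u\<close> is a contraction; its fixed point is \<open>(1 + A)\<^sup>-\<^sup>1 v\<close>.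
\<close>

lemma Neumann_inverse:
  fixes A :: "'a::chilbert_space \<Rightarrow> 'a"
  assumes A: "bounded_clinear A" and q: "\<And>x. norm (A x) \<le> q * norm x" "0 \<le> q" "q < 1"
  obtains B where "bounded_clinear B" "\<And>v. B v + A (B v) = v" "\<And>x. B (x + A x) = x"
    "\<And>v. norm (B v) \<le> norm v / (1 - q)"
proof -
  note As = bounded_clinear_simps[OF A]
  have "\<exists>!u\<in>UNIV. v - A u = u" for v
  proof (rule Banach_fix[OF complete_UNIV _ q(2,3)])
    fix x y
    have "dist (v - A x) (v - A y) = norm (A (y - x))" by (simp add: dist_norm As)
    then show "dist (v - A x) (v - A y) \<le> q * dist x y" using q(1)[of "y - x"] by (simp add: dist_norm norm_minus_commute)
  qed auto
  then obtain B where B: "\<And>v. v - A (B v) = B v" by metis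
  have uniq: "u = B v" if "u + A u = v" for u v
  proof -
    have "u - B v = - A (u - B v)" using that B[of v] by (simp add: As algebra_simps)
    then have "norm (u - B v) \<le> q * norm (u - B v)" using q(1)[of "u - B v"] by (metis norm_minus_cancel)
    then have "norm (u - B v) * (1 - q) \<le> 0" by (simp add: algebra_simps)
    then show ?thesis using q(3) by (simp add: mult_le_0_iff)
  qed
  have Beq: "B v + A (B v) = v" for v using B[of v] by (simp add: algebra_simps eq_diff_eq)
  have bound: "norm (B v) \<le> norm v / (1 - q)" for v
  proof -
    have "norm (B v) \<le> norm v + norm (A (B v))" using B[of v] norm_triangle_ineq4[of v "A (B v)"] by simp
    then have "norm (B v) * (1 - q) \<le> norm v" using q(1)[of "B v"] by (simp add: algebra_simps)
    then show ?thesis using q(3) by (simp add: pos_le_divide_eq)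
  qed
  have "bounded_clinear B"
  proof (rule bounded_clinearI[where K = "1 / (1 - q)"])
    show "B (x + y) = B x + B y" for x y
    proof (rule uniq[symmetric])
      have "B x + B y + A (B x + B y) = (B x + A (B x)) + (B y + A (B y))" by (simp add: As)
      then show "B x + B y + A (B x + B y) = x + y" by (simp only: Beq)
    qed
    show "B (c *\<^sub>C x) = c *\<^sub>C B x" for c x
    proof (rule uniq[symmetric])
      have "c *\<^sub>C B x + A (c *\<^sub>C B x) = c *\<^sub>C (B x + A (B x))" by (simp add: As scaleC_add_right)
      then show "c *\<^sub>C B x + A (c *\<^sub>C B x) = c *\<^sub>C x" by (simp only: Beq)
    qed
    show "norm (B x) \<le> 1 / (1 - q) * norm x" for x using bound[of x] by simp
  qed
  then show ?thesis using that Beq uniq[symmetric] bound by blast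
qed

text \<open>
  On \<open>D\<close> one has \<open>w - L = (1 + (w - z) (z - L)\<^sup>-\<^sup>1) (z - L)\<close>, and the first factor is invertible.
\<close>

lemma resolvent_near:
  assumes L: "closed_densely_defined D L" and z: "z \<notin> spectrum D L"
    and w: "cmod (w - z) * onorm (resolvent D L z) \<le> 1 / 2"
  shows "w \<notin> spectrum D L" "norm (resolvent D L w v) \<le> 2 * onorm (resolvent D L z) * norm v"
proof -
  let ?R = "resolvent D L z"
  note R = resolvent_props[OF z]
  have k: "0 \<le> onorm ?R" using R(4) by (simp add: onorm_pos_le bounded_clinear_bounded_linear)
  have Ab: "bounded_clinear (\<lambda>x. (w - z) *\<^sub>C ?R x)" by (rule bounded_clinear_scaleC[OF R(4)])
  have "norm ((w - z) *\<^sub>C ?R x) \<le> 1 / 2 * norm x" for x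
  proof -
    have "norm ((w - z) *\<^sub>C ?R x) \<le> cmod (w - z) * (onorm ?R * norm x)"
      using bounded_clinear_norm_le[OF R(4), of x] by (simp add: mult_left_mono)
    also have "\<dots> \<le> 1 / 2 * norm x" using mult_right_mono[OF w norm_ge_zero[of x]] by (simp add: mult.assoc)
    finally show ?thesis .
  qed
  then obtain B where B: "bounded_clinear B" "\<And>v. B v + (w - z) *\<^sub>C ?R (B v) = v"
      "\<And>x. B (x + (w - z) *\<^sub>C ?R x) = x" "\<And>v. norm (B v) \<le> norm v / (1 - 1 / 2)"
    using Neumann_inverse[OF Ab, of "1 / 2"] by auto
  have "w \<notin> spectrum D L \<and> resolvent D L w = (\<lambda>v. ?R (B v))"
  proof (rule resolvent_eqI)
    show "bounded_clinear (\<lambda>v. ?R (B v))" by (rule bounded_clinear_compose[OF R(4) B(1)])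
    show "?R (B v) \<in> D" for v by (rule R(1))
    show "w *\<^sub>C ?R (B v) - L (?R (B v)) = v" for v
      using R(2)[of "B v"] B(2)[of v] by (simp add: scaleC_diff_left algebra_simps)
    show "?R (B (w *\<^sub>C x - L x)) = x" if x: "x \<in> D" for x
    proof -
      have e: "w *\<^sub>C x - L x = (z *\<^sub>C x - L x) + (w - z) *\<^sub>C ?R (z *\<^sub>C x - L x)"
        using R(3)[OF x] by (simp add: scaleC_diff_left)
      show ?thesis unfolding e B(3) by (rule R(3)[OF x])
    qed
  qed
  then show "w \<notin> spectrum D L" and eq: "norm (resolvent D L w v) \<le> 2 * onorm ?R * norm v"
    using bounded_clinear_norm_le[OF R(4), of "B v"] mult_left_mono[OF B(4)[of v] k] by auto
qed

lemma closed_spectrum: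
  assumes L: "closed_densely_defined D L"
  shows "closed (spectrum D L)"
  unfolding closed_def open_contains_ball
proof
  fix z assume "z \<in> - spectrum D L"
  then have z: "z \<notin> spectrum D L" by simp
  let ?k = "onorm (resolvent D L z)"
  have k: "0 \<le> ?k" using resolvent_props(4)[OF z] by (simp add: onorm_pos_le bounded_clinear_bounded_linear)
  have "w \<notin> spectrum D L" if "dist z w < 1 / (2 * (?k + 1))" for w
  proof (rule resolvent_near(1)[OF L z])
    have "cmod (w - z) \<le> 1 / (2 * (?k + 1))" using that by (simp add: dist_norm norm_minus_commute)
    then have "cmod (w - z) * ?k \<le> 1 / (2 * (?k + 1)) * ?k" using k by (rule mult_right_mono)
    also have "\<dots> \<le> 1 / 2" using k by (simp add: field_simps)
    finally show "cmod (w - z) * ?k \<le> 1 / 2" .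
  qed
  then show "\<exists>e>0. ball z e \<subseteq> - spectrum D L"
    using k by (intro exI[of _ "1 / (2 * (?k + 1))"]) auto
qed

lemma resolvent_identity:
  assumes z: "z \<notin> spectrum D L" and w: "w \<notin> spectrum D L"
  shows "resolvent D L w v = resolvent D L z v + (w - z) *\<^sub>C - resolvent D L z (resolvent D L w v)"
proof -
  note R = resolvent_props[OF z] and Rw = resolvent_props[OF w]
  let ?u = "resolvent D L w v"
  have "?u = resolvent D L z (z *\<^sub>C ?u - L ?u)" using R(3)[OF Rw(1)] by simp
  also have "z *\<^sub>C ?u - L ?u = v + (z - w) *\<^sub>C ?u" using Rw(2)[of v] by (simp add: scaleC_diff_left algebra_simps)
  also have "resolvent D L z (v + (z - w) *\<^sub>C ?u) = resolvent D L z v + (z - w) *\<^sub>C resolvent D L z ?u"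
    by (simp only: bounded_clinear_simps[OF R(4)])
  also have "(z - w) *\<^sub>C resolvent D L z ?u = (w - z) *\<^sub>C - resolvent D L z ?u"
    by (simp add: scaleC_diff_left scaleC_minus_right)
  finally show ?thesis .
qed

text \<open>
  By the resolvent identity the difference quotient at \<open>z\<close> is \<open>w \<mapsto> - (z - L)\<^sup>-\<^sup>1 (w - L)\<^sup>-\<^sup>1\<close>, which
  is continuous because resolvents are bounded near \<open>z\<close>.
\<close>

lemma op_holomorphic_resolvent:
  fixes D :: "'a::chilbert_space set"
  assumes L: "closed_densely_defined D L"
  shows "op_holomorphic_on (resolvent D L) (- spectrum D L)"
  unfolding op_holomorphic_on_def
proof (intro conjI ballI)
  let ?R = "resolvent D L" and ?U = "- spectrum D L"
  have Rb: "bounded_clinear (?R z)" if "z \<in> ?U" for z using resolvent_props(4) that by simp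
  then show "\<And>z. z \<in> ?U \<Longrightarrow> bounded_clinear (?R z)" .
  fix z assume z: "z \<in> ?U"
  then have z': "z \<notin> spectrum D L" by simp
  define k where "k = onorm (?R z)"
  have k: "0 \<le> k" unfolding k_def using Rb[OF z] by (simp add: onorm_pos_le bounded_clinear_bounded_linear)
  have le: "dist (Blinfun (?R w)) (Blinfun (?R z)) \<le> cmod (w - z) * (k * (2 * k))"
    if w: "cmod (w - z) * k \<le> 1 / 2" for w
    unfolding dist_norm
  proof (rule norm_blinfun_bound)
    note near = resolvent_near[OF L z' w[unfolded k_def]]
    have wU: "w \<in> ?U" using near(1) by simp
    fix v
    have "blinfun_apply (Blinfun (?R w) - Blinfun (?R z)) v = (w - z) *\<^sub>C - ?R z (?R w v)"
      unfolding blinfun.diff_left Blinfun_apply[OF Rb[OF wU]] Blinfun_apply[OF Rb[OF z]]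
      using resolvent_identity[OF z' near(1), of v] by (metis add_diff_cancel_left')
    then have "norm (blinfun_apply (Blinfun (?R w) - Blinfun (?R z)) v) = cmod (w - z) * norm (?R z (?R w v))"
      by simp
    also have "\<dots> \<le> cmod (w - z) * (k * (2 * k * norm v))"
    proof (rule mult_left_mono)
      have "norm (?R z (?R w v)) \<le> k * norm (?R w v)"
        using bounded_clinear_norm_le[OF Rb[OF z]] by (simp add: k_def)
      also have "\<dots> \<le> k * (2 * k * norm v)"
        using near(2)[of v] k by (intro mult_left_mono) (simp_all add: k_def)
      finally show "norm (?R z (?R w v)) \<le> k * (2 * k * norm v)" .
    qed simp
    finally show "norm (blinfun_apply (Blinfun (?R w) - Blinfun (?R z)) v) \<le> cmod (w - z) * (k * (2 * k)) * norm v"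
      by (simp only: mult_ac)
  qed (use k in simp)
  have contR: "continuous (at z within ?U) (\<lambda>w. Blinfun (?R w))"
    unfolding continuous_within
  proof (rule iffD2[OF tendsto_dist_iff], rule tendsto_sandwich[of "\<lambda>_. 0" _ _ "\<lambda>w. cmod (w - z) * (k * (2 * k))"])
    have "((\<lambda>w. cmod (w - z) * k) \<longlongrightarrow> cmod (z - z) * k) (at z within ?U)" by (intro tendsto_intros)
    then have "\<forall>\<^sub>F w in at z within ?U. cmod (w - z) * k < 1 / 2" by (rule order_tendstoD) simp
    then show "\<forall>\<^sub>F w in at z within ?U. dist (Blinfun (?R w)) (Blinfun (?R z)) \<le> cmod (w - z) * (k * (2 * k))"
      by (rule eventually_mono) (rule le, simp)
    have "((\<lambda>w. cmod (w - z) * (k * (2 * k))) \<longlongrightarrow> cmod (z - z) * (k * (2 * k))) (at z within ?U)" by (intro tendsto_intros)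
    then show "((\<lambda>w. cmod (w - z) * (k * (2 * k))) \<longlongrightarrow> 0) (at z within ?U)" by simp
  qed (auto intro: always_eventually)
  define Q where "Q w x = - ?R z (?R w x)" for w x
  have Qb: "bounded_clinear (Q w)" if "w \<in> ?U" for w
    unfolding Q_def[abs_def] by (rule bounded_clinear_minus[OF bounded_clinear_compose[OF Rb[OF z] Rb[OF that]]])
  have Qeq: "- (Blinfun (?R z) o\<^sub>L Blinfun (?R w)) = Blinfun (Q w)" if "w \<in> ?U" for w
    by (rule blinfun_eqI) (simp add: blinfun.minus_left Blinfun_apply Rb[OF that] Rb[OF z] Qb[OF that] Q_def)
  have "continuous (at z within ?U) (\<lambda>w. - (Blinfun (?R z) o\<^sub>L Blinfun (?R w)))"
    by (intro continuous_minus bounded_bilinear.continuous[OF bounded_bilinear_blinfun_compose] contR continuous_const)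
  then have "((\<lambda>w. Blinfun (Q w)) \<longlongrightarrow> - (Blinfun (?R z) o\<^sub>L Blinfun (?R z))) (at z within ?U)"
    unfolding continuous_within
    by (rule Lim_transform_eventually) (unfold eventually_at_filter, intro always_eventually allI impI, rule Qeq)
  then have "continuous (at z within ?U) (\<lambda>w. Blinfun (Q w))"
    unfolding continuous_within Qeq[OF z] .
  moreover have "?R w x = ?R z x + (w - z) *\<^sub>C Q w x" if "w \<in> ?U" for w x
    unfolding Q_def using resolvent_identity[OF z', of w x] that by blast
  ultimately show "\<exists>Q. (\<forall>w\<in>?U. bounded_clinear (Q w) \<and> (\<forall>x. ?R w x = ?R z x + (w - z) *\<^sub>C Q w x)) \<and>
      continuous (at z within ?U) (\<lambda>w. Blinfun (Q w))"
    using Qb by (intro exI[of _ Q] conjI ballI allI)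
qed

text \<open>
  Here \<open>z - L = z (1 - L / z)\<close>.
\<close>

lemma resolvent_bounded_operator:
  fixes L :: "'a::chilbert_space \<Rightarrow> 'a"
  assumes L: "bounded_clinear L" and z: "onorm L < cmod z"
  shows "z \<notin> spectrum UNIV L" "norm (resolvent UNIV L z v) \<le> norm v / (cmod z - onorm L)"
proof -
  have l: "0 \<le> onorm L" using L by (simp add: onorm_pos_le bounded_clinear_bounded_linear)
  then have z0: "z \<noteq> 0" "cmod z > 0" using z by auto
  define q where "q = onorm L / cmod z"
  have q: "0 \<le> q" "q < 1" using l z z0 by (auto simp: q_def)
  have Ab: "bounded_clinear (\<lambda>x. - (1 / z) *\<^sub>C L x)" by (rule bounded_clinear_scaleC[OF L])
  have "norm (- (1 / z) *\<^sub>C L x) \<le> q * norm x" for x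
  proof -
    have "norm (- (1 / z) *\<^sub>C L x) = norm (L x) / cmod z" by (simp add: norm_divide)
    also have "\<dots> \<le> onorm L * norm x / cmod z"
      using bounded_clinear_norm_le[OF L, of x] by (rule divide_right_mono) simp
    finally show ?thesis by (simp add: q_def)
  qed
  then obtain B where B: "bounded_clinear B" "\<And>v. B v + - (1 / z) *\<^sub>C L (B v) = v"
      "\<And>x. B (x + - (1 / z) *\<^sub>C L x) = x" "\<And>v. norm (B v) \<le> norm v / (1 - q)"
    using Neumann_inverse[OF Ab _ q] by metis
  have "z \<notin> spectrum UNIV L \<and> resolvent UNIV L z = (\<lambda>v. (1 / z) *\<^sub>C B v)"
  proof (rule resolvent_eqI)
    show "bounded_clinear (\<lambda>v. (1 / z) *\<^sub>C B v)" by (rule bounded_clinear_scaleC[OF B(1)])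
    show "z *\<^sub>C (1 / z) *\<^sub>C B v - L ((1 / z) *\<^sub>C B v) = v" for v
      using B(2)[of v] z0 by (simp add: scaleC_scaleC bounded_clinear_simps(5)[OF L] scaleC_minus_left)
    show "(1 / z) *\<^sub>C B (z *\<^sub>C x - L x) = x" for x
    proof -
      have "(1 / z) *\<^sub>C B (z *\<^sub>C x - L x) = B ((1 / z) *\<^sub>C (z *\<^sub>C x - L x))"
        by (simp add: bounded_clinear_simps(5)[OF B(1)])
      also have "(1 / z) *\<^sub>C (z *\<^sub>C x - L x) = x + - (1 / z) *\<^sub>C L x"
        using z0 by (simp add: scaleC_diff_right scaleC_scaleC scaleC_minus_left)
      finally show ?thesis by (simp only: B(3))
    qed
  qed simp
  moreover have "norm ((1 / z) *\<^sub>C B v) \<le> norm v / (cmod z - onorm L)"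
  proof -
    have "norm ((1 / z) *\<^sub>C B v) = norm (B v) / cmod z" by (simp add: norm_divide)
    also have "\<dots> \<le> norm v / (1 - q) / cmod z" using B(4) by (rule divide_right_mono) simp
    also have "\<dots> = norm v / (cmod z - onorm L)" proof -
      have "(1 - q) * cmod z = cmod z - onorm L" using z0 by (simp add: q_def left_diff_distrib)
      then show ?thesis by (simp add: divide_divide_eq_left)
    qed
    finally show ?thesis .
  qed
  ultimately show "z \<notin> spectrum UNIV L" "norm (resolvent UNIV L z v) \<le> norm v / (cmod z - onorm L)"
    by auto
qed

lemma compact_spectrum:
  fixes L :: "'a::chilbert_space \<Rightarrow> 'a"
  assumes L: "bounded_clinear L"
  shows "compact (spectrum UNIV L)"
proof -
  have "spectrum UNIV L \<subseteq> cball 0 (onorm L)"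
  proof
    fix z assume "z \<in> spectrum UNIV L"
    then have "\<not> onorm L < cmod z" using resolvent_bounded_operator(1)[OF L, of z] by blast
    then show "z \<in> cball 0 (onorm L)" by simp
  qed
  then show ?thesis
    using closed_spectrum[OF cdd_bounded_clinear[OF L]] bounded_subset[OF bounded_cball] by (auto simp: compact_eq_bounded_closed)
qed

section \<open>Integrating the resolvent of a bounded operator\<close>

text \<open>
  From \<open>z u - L u = x\<close> for \<open>u = (z - L)\<^sup>-\<^sup>1 x\<close> one gets \<open>u = x / z + L u / z\<close>. The first term
  contributes \<open>2 \<pi> i \<langle>y, M x\<rangle>\<close>, and the second is of order \<open>1 / r\<^sup>2\<close> on the circle.
\<close>

lemma circle_integral_resolvent:
  fixes L :: "'b::chilbert_space \<Rightarrow> 'b" and M :: "'b \<Rightarrow> 'a::chilbert_space"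
  assumes L: "bounded_clinear L" and M: "bounded_clinear M" and r: "onorm L < r"
  shows "cmod (contour_integral (circlepath 0 r) (\<lambda>z. cinner y (M (resolvent UNIV L z x))) - 2 * pi * \<i> * cinner y (M x))
      \<le> 2 * pi * (norm y * onorm M * onorm L * norm x) / (r - onorm L)"
proof -
  have l: "0 \<le> onorm L" "0 \<le> onorm M"
    using L M by (simp_all add: onorm_pos_le bounded_clinear_bounded_linear)
  then have r0: "r > 0" using r by linarith
  define g where "g z = cinner y (M (resolvent UNIV L z x))" for z
  define B where "B = norm y * (onorm M * (onorm L * (norm x / (r - onorm L)) / r))"
  have g: "g holomorphic_on - spectrum UNIV L"
    unfolding g_def
    by (rule op_holomorphic_cinner[OF op_holomorphic_compose[OF op_holomorphic_const[OF M]
          op_holomorphic_resolvent[OF cdd_bounded_clinear[OF L]]]])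
  have "path_image (circlepath 0 r) \<subseteq> - spectrum UNIV L"
    using r r0 resolvent_bounded_operator(1)[OF L] by (auto simp: path_image_circlepath)
  then have gi: "(g has_contour_integral contour_integral (circlepath 0 r) g) (circlepath 0 r)"
    by (intro has_contour_integral_integral contour_integrable_holomorphic_simple[OF g])
       (auto simp: closed_spectrum[OF cdd_bounded_clinear[OF L]] closed_def[symmetric])
  have "((\<lambda>z. cinner y (M x) / (z - 0)) has_contour_integral (2 * pi * \<i> * cinner y (M x))) (circlepath 0 r)"
    using Cauchy_integral_circlepath_simple[of "\<lambda>z. cinner y (M x)" 0 r 0] r0 by simp
  from has_contour_integral_diff[OF gi this]
  have hi: "((\<lambda>z. g z - cinner y (M x) / z) has_contour_integral
      (contour_integral (circlepath 0 r) g - 2 * pi * \<i> * cinner y (M x))) (circlepath 0 r)" by simp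
  have "cmod (contour_integral (circlepath 0 r) g - 2 * pi * \<i> * cinner y (M x)) \<le> B * (2 * pi * r)"
  proof (rule has_contour_integral_bound_circlepath[OF hi _ r0])
    show "0 \<le> B" using l r r0 by (simp add: B_def)
    fix z :: complex assume "cmod (z - 0) = r"
    then have z: "cmod z = r" "z \<noteq> 0" using r0 by auto
    define u where "u = resolvent UNIV L z x"
    have out: "z \<notin> spectrum UNIV L" and nu: "norm u \<le> norm x / (r - onorm L)"
      unfolding u_def using resolvent_bounded_operator[OF L, of z] r z by auto
    have "z *\<^sub>C u - L u = x" unfolding u_def by (rule resolvent_props(2)[OF out])
    then have "(1 / z) *\<^sub>C x = (1 / z) *\<^sub>C (z *\<^sub>C u) - (1 / z) *\<^sub>C L u" by (metis scaleC_diff_right)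
    then have "u - (1 / z) *\<^sub>C x = (1 / z) *\<^sub>C L u" using z by (simp add: scaleC_scaleC)
    then have "M u - (1 / z) *\<^sub>C M x = M ((1 / z) *\<^sub>C L u)" by (metis bounded_clinear_simps(2,5)[OF M])
    then have "g z - cinner y (M x) / z = cinner y (M ((1 / z) *\<^sub>C L u))"
      using cinner_diff_right[of y "M u" "(1 / z) *\<^sub>C M x"] by (simp add: g_def u_def[symmetric] cinner_scaleC_right)
    also have "cmod \<dots> \<le> norm y * norm (M ((1 / z) *\<^sub>C L u))" by (rule norm_cinner_le)
    also have "\<dots> \<le> B"
      unfolding B_def
    proof (rule mult_left_mono)
      have "norm (M ((1 / z) *\<^sub>C L u)) \<le> onorm M * (norm (L u) / r)"
        using bounded_clinear_norm_le[OF M, of "(1 / z) *\<^sub>C L u"] z by (simp add: norm_divide)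
      also have "\<dots> \<le> onorm M * (onorm L * (norm x / (r - onorm L)) / r)"
        using bounded_clinear_norm_le[OF L, of u] mult_left_mono[OF nu l(1)] r0 l
        by (intro mult_left_mono divide_right_mono) auto
      finally show "norm (M ((1 / z) *\<^sub>C L u)) \<le> onorm M * (onorm L * (norm x / (r - onorm L)) / r)" .
    qed simp
    finally show "cmod (g z - cinner y (M x) / z) \<le> B" .
  qed
  also have "B * (2 * pi * r) = 2 * pi * (norm y * onorm M * onorm L * norm x) / (r - onorm L)"
    using r0 by (simp add: B_def)
  finally show ?thesis by (simp add: g_def[abs_def])
qed

text \<open>
  The cycle is homologous in the resolvent set to a circle of arbitrarily large radius, on which
  the resolvent is \<open>1 / z\<close> up to an error of order \<open>1 / z\<^sup>2\<close>.
\<close>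

lemma cycle_integral_resolvent:
  fixes L :: "'b::chilbert_space \<Rightarrow> 'b" and M :: "'b \<Rightarrow> 'a::chilbert_space"
  assumes L: "bounded_clinear L" and M: "bounded_clinear M"
    and ps: "\<And>p. p \<in> set ps \<Longrightarrow> valid_path p \<and> pathfinish p = pathstart p \<and> path_image p \<subseteq> - spectrum UNIV L
       \<and> continuous_on {0..1} (\<lambda>t. vector_derivative p (at t))"
    and wind: "\<And>z. z \<in> spectrum UNIV L \<Longrightarrow> (\<Sum>p\<leftarrow>ps. winding_number p z) = 1"
  shows "(\<Sum>p\<leftarrow>ps. contour_integral p (\<lambda>z. cinner y (M (resolvent UNIV L z x)))) = 2 * pi * \<i> * cinner y (M x)"
proof -
  define g where "g z = cinner y (M (resolvent UNIV L z x))" for z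
  define I where "I = (\<Sum>p\<leftarrow>ps. contour_integral p g)"
  define C where "C = 2 * pi * (norm y * onorm M * onorm L * norm x)"
  have l: "0 \<le> onorm L" "0 \<le> onorm M"
    using L M by (simp_all add: onorm_pos_le bounded_clinear_bounded_linear)
  have C0: "0 \<le> C" using l by (simp add: C_def)
  have g: "g holomorphic_on - spectrum UNIV L"
    unfolding g_def
    by (rule op_holomorphic_cinner[OF op_holomorphic_compose[OF op_holomorphic_const[OF M]
          op_holomorphic_resolvent[OF cdd_bounded_clinear[OF L]]]])
  have rev_deriv: "vector_derivative (reversepath (circlepath 0 r)) (at t) =
      - (2 * pi * \<i> * r * exp (2 * of_real pi * \<i> * of_real (1 - t)))" for r t :: real
  proof (rule vector_derivative_at)
    have "((\<lambda>t. 1 - t) has_vector_derivative - 1) (at t)" by (auto intro!: derivative_eq_intros)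
    from vector_diff_chain_at[OF this has_vector_derivative_circlepath[where z = 0 and r = r]]
    show "(reversepath (circlepath 0 r) has_vector_derivative
        - (2 * pi * \<i> * r * exp (2 * of_real pi * \<i> * of_real (1 - t)))) (at t)"
      by (simp add: reversepath_def[abs_def] o_def)
  qed
  have circ: "I = contour_integral (circlepath 0 r) g" if r: "onorm L < r" for r
  proof -
    let ?c = "reversepath (circlepath 0 r)"
    have r0: "r > 0" using r l by linarith
    have im: "path_image ?c \<subseteq> - spectrum UNIV L"
      using r r0 resolvent_bounded_operator(1)[OF L] by (auto simp: path_image_circlepath)
    have "(\<Sum>p\<leftarrow>ps @ [?c]. contour_integral p g) = 0"
    proof (rule Cauchy_theorem_cycle[OF _ g])
      show "open (- spectrum UNIV L)"
        using closed_spectrum[OF cdd_bounded_clinear[OF L]] by (simp add: open_Compl)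
      fix p assume "p \<in> set (ps @ [?c])"
      moreover have "continuous_on {0..1} (\<lambda>t. vector_derivative ?c (at t))"
        unfolding rev_deriv by (intro continuous_intros)
      ultimately show "valid_path p \<and> pathfinish p = pathstart p \<and> path_image p \<subseteq> - spectrum UNIV L
         \<and> continuous_on {0..1} (\<lambda>t. vector_derivative p (at t))"
        using ps im by auto
    next
      fix z assume "z \<notin> - spectrum UNIV L"
      then have z: "z \<in> spectrum UNIV L" by simp
      then have "cmod z < r" using resolvent_bounded_operator(1)[OF L, of z] r by (meson not_le order.strict_trans2 less_le_trans)
      then have "winding_number ?c z = - 1"
        using r0 by (subst winding_number_reversepath) (auto simp: winding_number_circlepath path_image_circlepath)
      then show "(\<Sum>p\<leftarrow>ps @ [?c]. winding_number p z) = 0" using wind[OF z] by simp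
    qed
    moreover have "contour_integral ?c g = - contour_integral (circlepath 0 r) g"
      by (rule contour_integral_reversepath) simp
    ultimately show ?thesis by (simp add: I_def)
  qed
  have "cmod (I - 2 * pi * \<i> * cinner y (M x)) \<le> 0 + e" if e: "e > 0" for e
  proof -
    define r where "r = onorm L + C / e + 1"
    have r: "onorm L < r" using C0 e by (simp add: r_def add_nonneg_pos)
    have "cmod (I - 2 * pi * \<i> * cinner y (M x)) \<le> C / (r - onorm L)"
      unfolding circ[OF r] C_def using circle_integral_resolvent[OF L M r, of y x] by (simp add: g_def[abs_def])
    also have "\<dots> \<le> e" using C0 e by (simp add: r_def field_simps)
    finally show ?thesis by simp
  qed
  then have "cmod (I - 2 * pi * \<i> * cinner y (M x)) \<le> 0" by (rule field_le_epsilon)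
  then show ?thesis by (simp add: I_def g_def[abs_def])
qed

lemma cinner_sum_list_right: "cinner y (\<Sum>i\<leftarrow>is. f i) = (\<Sum>i\<leftarrow>is. cinner y (f i :: 'a::chilbert_space))"
  by (induction "is") (auto simp: cinner_add_right)

lemma bounded_clinear_sum_list:
  "(\<And>i. i \<in> set is \<Longrightarrow> bounded_clinear (f i)) \<Longrightarrow> bounded_clinear (\<lambda>x. \<Sum>i\<leftarrow>is. f i x)"
  by (induction "is") (auto intro: bounded_clinear_add)

lemma op_holomorphic_cong:
  assumes "op_holomorphic_on F U" "\<And>z. z \<in> U \<Longrightarrow> G z = F z"
  shows "op_holomorphic_on G U"
proof -
  have "op_holomorphic_on G U \<longleftrightarrow> op_holomorphic_on F U"
    unfolding op_holomorphic_on_def using assms(2) by (simp cong: ball_cong)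
  then show ?thesis using assms(1) by simp
qed

text \<open>
  The integral of \<open>1 / (w - z)\<close> over the grid contour vanishes for \<open>z\<close> in \<open>A\<close>, since this function is
  holomorphic off \<open>A\<close>.
\<close>

lemma jordan_contour_exists:
  assumes "closed A" "compact B" "A \<inter> B = {}"
  shows "\<exists>\<Gamma>. jordan_contour \<Gamma> A B"
proof -
  have "B \<subseteq> - A" using assms(3) by auto
  from grid_contour[OF assms(2) open_Compl[OF assms(1)] this] obtain \<Gamma> where
    \<Gamma>: "\<And>\<gamma>. \<gamma> \<in> set \<Gamma> \<Longrightarrow> simple_path \<gamma> \<and> pathfinish \<gamma> = pathstart \<gamma> \<and> valid_path \<gamma> \<and> rectifiable_path \<gamma>"
    and img: "cycle_image \<Gamma> \<subseteq> - A - B"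
    and zero: "\<And>g. g holomorphic_on - A \<Longrightarrow> (\<Sum>\<gamma>\<leftarrow>\<Gamma>. contour_integral \<gamma> g) = 0"
    and one: "\<And>z. z \<in> B \<Longrightarrow> (\<Sum>\<gamma>\<leftarrow>\<Gamma>. winding_number \<gamma> z) = 1"
    by metis
  have "(\<Sum>\<gamma>\<leftarrow>\<Gamma>. winding_number \<gamma> z) = 0" if z: "z \<in> A" for z
  proof -
    have wn: "winding_number \<gamma> z = 1 / (2 * pi * \<i>) * contour_integral \<gamma> (\<lambda>w. 1 / (w - z))" if "\<gamma> \<in> set \<Gamma>" for \<gamma>
      using \<Gamma>[OF that] z img that by (intro winding_number_valid_path) (auto simp: cycle_image_def)
    have "(\<Sum>\<gamma>\<leftarrow>\<Gamma>. winding_number \<gamma> z) = (\<Sum>\<gamma>\<leftarrow>\<Gamma>. 1 / (2 * pi * \<i>) * contour_integral \<gamma> (\<lambda>w. 1 / (w - z)))"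
      by (intro arg_cong[of _ _ sum_list] map_cong refl wn)
    also have "\<dots> = 1 / (2 * pi * \<i>) * (\<Sum>\<gamma>\<leftarrow>\<Gamma>. contour_integral \<gamma> (\<lambda>w. 1 / (w - z)))"
      by (rule sum_list_const_mult)
    also have "(\<Sum>\<gamma>\<leftarrow>\<Gamma>. contour_integral \<gamma> (\<lambda>w. 1 / (w - z))) = 0"
      by (rule zero) (use z in \<open>auto intro!: holomorphic_intros\<close>)
    finally show ?thesis by simp
  qed
  then show ?thesis
    using \<Gamma> img one unfolding jordan_contour_def by (intro exI[of _ \<Gamma>]) auto
qed

section \<open>The solution as a contour integral\<close>

text \<open>
  Replaces the rectifiable curves by smooth loops \<open>P \<gamma>\<close>, which may be used in contour integrals
  of scalar functions: all integrals of operators along \<open>\<Gamma>\<close> are determined by scalar integrals along these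
  loops.
\<close>

lemma smooth_cycle_for_contour:
  fixes A B :: "complex set"
  assumes \<Gamma>: "jordan_contour \<Gamma> A B" and AB: "closed A" "closed B"
  shows "\<exists>P. (\<forall>\<gamma>\<in>set \<Gamma>. valid_path (P \<gamma>) \<and> pathfinish (P \<gamma>) = pathstart (P \<gamma>) \<and>
       path_image (P \<gamma>) \<subseteq> - (A \<union> B) \<and> continuous_on {0..1} (\<lambda>t. vector_derivative (P \<gamma>) (at t))) \<and>
    (\<forall>z\<in>A. (\<Sum>\<gamma>\<leftarrow>\<Gamma>. winding_number (P \<gamma>) z) = 0) \<and>
    (\<forall>z\<in>B. (\<Sum>\<gamma>\<leftarrow>\<Gamma>. winding_number (P \<gamma>) z) = 1) \<and>
    (\<forall>\<gamma>\<in>set \<Gamma>. \<forall>F. op_holomorphic_on F (- (A \<union> B)) \<longrightarrow>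
      (\<exists>J :: 'b::chilbert_space \<Rightarrow> 'a::chilbert_space. has_op_contour_integral F J \<gamma> \<and>
        (\<forall>x y. cinner y (J x) = contour_integral (P \<gamma>) (\<lambda>z. cinner y (F z x)))))"
proof -
  let ?U = "- (A \<union> B)"
  have U: "open ?U" using AB by (simp add: open_Compl open_Int)
  define good where "good \<gamma> p \<longleftrightarrow> (valid_path p \<and> pathfinish p = pathstart p \<and> path_image p \<subseteq> ?U \<and>
      continuous_on {0..1} (\<lambda>t. vector_derivative p (at t))) \<and>
      (\<forall>z. z \<notin> ?U \<longrightarrow> winding_number p z = winding_number \<gamma> z) \<and>
      (\<forall>F. op_holomorphic_on F ?U \<longrightarrow> (\<exists>J :: 'b \<Rightarrow> 'a. has_op_contour_integral F J \<gamma> \<and>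
        (\<forall>x y. cinner y (J x) = contour_integral p (\<lambda>z. cinner y (F z x)))))" for \<gamma> p
  have "\<exists>p. good \<gamma> p" if g: "\<gamma> \<in> set \<Gamma>" for \<gamma>
  proof -
    have rect: "rectifiable_path \<gamma>" and loop: "pathfinish \<gamma> = pathstart \<gamma>"
      and im: "path_image \<gamma> \<subseteq> ?U"
      using \<Gamma> g by (auto simp: jordan_contour_def cycle_image_def)
    have path: "path \<gamma>" using rect by (simp add: rectifiable_path_def)
    show ?thesis
    proof (rule smooth_loop_approximation[OF path loop U im])
      fix p d
      assume p: "valid_path p" "pathfinish p = pathstart p" "path_image p \<subseteq> ?U"
          "continuous_on {0..1} (\<lambda>t. vector_derivative p (at t))"
        and w: "\<And>z. z \<notin> ?U \<Longrightarrow> winding_number p z = winding_number \<gamma> z"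
        and d: "d > 0" and seg: "\<And>s t. s \<in> {0..1} \<Longrightarrow> t \<in> {0..1} \<Longrightarrow> \<bar>t - s\<bar> < d \<Longrightarrow> closed_segment (\<gamma> s) (\<gamma> t) \<subseteq> ?U"
        and \<Phi>: "\<And>g. g holomorphic_on ?U \<Longrightarrow> \<exists>\<Phi>. \<Phi> 1 - \<Phi> 0 = contour_integral p g \<and>
          (\<forall>s\<in>{0..1}. \<forall>t\<in>{0..1}. \<bar>t - s\<bar> < d \<longrightarrow> \<Phi> t - \<Phi> s = contour_integral (linepath (\<gamma> s) (\<gamma> t)) g)"
      have "good \<gamma> p"
        unfolding good_def
        by (intro conjI allI impI p w has_op_contour_integral_holomorphic[OF _ U im rect d \<Phi> seg])
      then show ?thesis by blast
    qed
  qed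
  then obtain P where good: "\<And>\<gamma>. \<gamma> \<in> set \<Gamma> \<Longrightarrow> good \<gamma> (P \<gamma>)" by metis
  note P = good[unfolded good_def, THEN conjunct1]
    and w = good[unfolded good_def, THEN conjunct2, THEN conjunct1, rule_format]
    and J = good[unfolded good_def, THEN conjunct2, THEN conjunct2, rule_format]
  have windings: "(\<Sum>\<gamma>\<leftarrow>\<Gamma>. winding_number (P \<gamma>) z) = (\<Sum>\<gamma>\<leftarrow>\<Gamma>. winding_number \<gamma> z)" if "z \<notin> ?U" for z
    by (intro arg_cong[of _ _ sum_list] map_cong refl w that)
  then have w0: "(\<Sum>\<gamma>\<leftarrow>\<Gamma>. winding_number (P \<gamma>) z) = 0" if "z \<in> A" for z
    using \<Gamma> that by (simp add: jordan_contour_def)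
  have w1: "(\<Sum>\<gamma>\<leftarrow>\<Gamma>. winding_number (P \<gamma>) z) = 1" if "z \<in> B" for z
    using \<Gamma> that windings by (simp add: jordan_contour_def)
  show ?thesis
    by (rule exI[of _ P], intro conjI ballI allI impI P[THEN conjunct1] P[THEN conjunct2, THEN conjunct1]
        P[THEN conjunct2, THEN conjunct2, THEN conjunct1] P[THEN conjunct2, THEN conjunct2, THEN conjunct2] w0 w1 J)
qed

text \<open>
  For \<open>F z = (L1 - z)\<^sup>-\<^sup>1 M (z - L2)\<^sup>-\<^sup>1\<close> one has
  \<open>L1 F z - F z L2 = M (z - L2)\<^sup>-\<^sup>1 + (L1 - z)\<^sup>-\<^sup>1 M\<close>, and for a solution \<open>S\<close> of the equation
  \<open>F z = S (z - L2)\<^sup>-\<^sup>1 + (L1 - z)\<^sup>-\<^sup>1 S\<close>. The terms with the resolvent of \<open>L2\<close> integrate to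
  \<open>2 \<pi> i M\<close> and \<open>2 \<pi> i S\<close>, the others to \<open>0\<close>.
\<close>

theorem contour_integral_solves_sylvester:
  fixes D1 :: "'a::chilbert_space set" and L1 :: "'a \<Rightarrow> 'a"
    and L2 :: "'b::chilbert_space \<Rightarrow> 'b"
  assumes L1: "closed_densely_defined D1 L1" and L2: "bounded_clinear L2" and M: "bounded_clinear M"
    and \<Gamma>: "jordan_contour \<Gamma> (spectrum D1 L1) (spectrum UNIV L2)"
  defines "F \<equiv> (\<lambda>z. inv_into D1 (\<lambda>x. L1 x - z *\<^sub>C x) \<circ> M \<circ> inv (\<lambda>x. z *\<^sub>C x - L2 x))"
  obtains J where
    "\<And>\<gamma>. \<gamma> \<in> set \<Gamma> \<Longrightarrow> has_op_contour_integral F (J \<gamma>) \<gamma>"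
    "(\<lambda>x. (1 / (2 * of_real pi * \<i>)) *\<^sub>C (\<Sum>\<gamma>\<leftarrow>\<Gamma>. J \<gamma> x)) \<in> bounded_ops D1"
    "\<And>x. L1 ((1 / (2 * of_real pi * \<i>)) *\<^sub>C (\<Sum>\<gamma>\<leftarrow>\<Gamma>. J \<gamma> x)) - (1 / (2 * of_real pi * \<i>)) *\<^sub>C (\<Sum>\<gamma>\<leftarrow>\<Gamma>. J \<gamma> (L2 x)) = M x"
    "\<And>S. S \<in> bounded_ops D1 \<Longrightarrow> (\<forall>x. L1 (S x) - S (L2 x) = M x) \<Longrightarrow>
       S = (\<lambda>x. (1 / (2 * of_real pi * \<i>)) *\<^sub>C (\<Sum>\<gamma>\<leftarrow>\<Gamma>. J \<gamma> x))"
proof -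
  define \<sigma>1 \<sigma>2 where "\<sigma>1 = spectrum D1 L1" and "\<sigma>2 = spectrum UNIV L2"
  define U where "U = - (\<sigma>1 \<union> \<sigma>2)"
  define T1 where "T1 z = inv_into D1 (\<lambda>x. L1 x - z *\<^sub>C x)" for z
  define R2 where "R2 z = resolvent UNIV L2 z" for z
  define c where "c = 1 / (2 * of_real pi * \<i>)"
  have c: "c * (2 * pi * \<i>) = 1" by (simp add: c_def)
  note cl2 = cdd_bounded_clinear[OF L2]
  have closed: "closed \<sigma>1" "closed \<sigma>2" unfolding \<sigma>1_def \<sigma>2_def by (rule closed_spectrum[OF L1], rule closed_spectrum[OF cl2])
  have F_eq: "F z x = T1 z (M (R2 z x))" for z x
    by (simp add: F_def T1_def R2_def resolvent_def)
  have T1R: "T1 z v = - resolvent D1 L1 z v" if "z \<notin> \<sigma>1" for z v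
    unfolding T1_def by (rule inv_into_eq_minus_resolvent[OF L1]) (use that in \<open>simp add: \<sigma>1_def\<close>)
  have T1: "T1 z v \<in> D1" "L1 (T1 z v) - z *\<^sub>C T1 z v = v" "\<And>x. x \<in> D1 \<Longrightarrow> T1 z (L1 x - z *\<^sub>C x) = x"
    "bounded_clinear (T1 z)" if z: "z \<notin> \<sigma>1" for z v
  proof -
    note R = resolvent_props[OF z[unfolded \<sigma>1_def]]
    have neg: "- resolvent D1 L1 z v = (- 1) *\<^sub>C resolvent D1 L1 z v" by (simp add: scaleC_minus1)
    show "T1 z v \<in> D1" unfolding T1R[OF z] neg by (rule cdd_simps(4)[OF L1 R(1)])
    have "L1 (- resolvent D1 L1 z v) = - L1 (resolvent D1 L1 z v)"
      unfolding neg by (subst cdd_simps(5)[OF L1 R(1)]) (simp add: scaleC_minus1)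
    then show "L1 (T1 z v) - z *\<^sub>C T1 z v = v"
      unfolding T1R[OF z] using R(2)[of v] by (simp add: scaleC_minus_right)
    show "T1 z (L1 x - z *\<^sub>C x) = x" if "x \<in> D1" for x
      unfolding T1R[OF z] using R(3)[OF that] bounded_clinear_simps(3)[OF R(4), of "z *\<^sub>C x - L1 x"] by simp
    have "T1 z = (\<lambda>v. - resolvent D1 L1 z v)" using T1R[OF z] by (rule ext)
    then show "bounded_clinear (T1 z)" using bounded_clinear_minus[OF R(4)] by simp
  qed
  have R2: "z *\<^sub>C R2 z v - L2 (R2 z v) = v" "R2 z (z *\<^sub>C v - L2 v) = v" if "z \<notin> \<sigma>2" for z v
    using resolvent_props(2,3)[of z UNIV L2] that by (auto simp: R2_def \<sigma>2_def)
  have hol2: "op_holomorphic_on R2 (- \<sigma>2)"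
    unfolding R2_def[abs_def] \<sigma>2_def by (rule op_holomorphic_resolvent[OF cl2])
  have hol1: "op_holomorphic_on T1 (- \<sigma>1)"
  proof (rule op_holomorphic_cong)
    show "op_holomorphic_on (\<lambda>z x. - (resolvent D1 L1 z x)) (- \<sigma>1)"
      using op_holomorphic_compose[OF op_holomorphic_const[OF bounded_clinear_minus[OF bounded_clinear_ident]]
          op_holomorphic_resolvent[OF L1]] by (simp add: \<sigma>1_def)
    show "T1 z = (\<lambda>x. - resolvent D1 L1 z x)" if "z \<in> - \<sigma>1" for z
      by (rule ext, rule T1R) (use that in simp)
  qed
  have hol1S: "op_holomorphic_on (\<lambda>z x. T1 z (S x)) (- \<sigma>1)" if "bounded_clinear S" for S :: "'b \<Rightarrow> 'a"
    by (rule op_holomorphic_compose[OF hol1 op_holomorphic_const[OF that]])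
  have hol2S: "op_holomorphic_on (\<lambda>z x. S (R2 z x)) (- \<sigma>2)" if "bounded_clinear S" for S :: "'b \<Rightarrow> 'a"
    by (rule op_holomorphic_compose[OF op_holomorphic_const[OF that] hol2])
  have UU: "U \<subseteq> - \<sigma>1" "U \<subseteq> - \<sigma>2" by (auto simp: U_def)
  have holF: "op_holomorphic_on F U"
  proof (rule op_holomorphic_cong)
    show "op_holomorphic_on (\<lambda>z x. T1 z (M (R2 z x))) U"
      by (rule op_holomorphic_compose[OF op_holomorphic_subset[OF hol1 UU(1)]
            op_holomorphic_subset[OF hol2S[OF M] UU(2)]])
  qed (use F_eq in auto)
  have "\<exists>P. (\<forall>\<gamma>\<in>set \<Gamma>. valid_path (P \<gamma>) \<and> pathfinish (P \<gamma>) = pathstart (P \<gamma>) \<and>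
       path_image (P \<gamma>) \<subseteq> U \<and> continuous_on {0..1} (\<lambda>t. vector_derivative (P \<gamma>) (at t))) \<and>
    (\<forall>z\<in>\<sigma>1. (\<Sum>\<gamma>\<leftarrow>\<Gamma>. winding_number (P \<gamma>) z) = 0) \<and>
    (\<forall>z\<in>\<sigma>2. (\<Sum>\<gamma>\<leftarrow>\<Gamma>. winding_number (P \<gamma>) z) = 1) \<and>
    (\<forall>\<gamma>\<in>set \<Gamma>. \<forall>G. op_holomorphic_on G U \<longrightarrow>
      (\<exists>J :: 'b \<Rightarrow> 'a. has_op_contour_integral G J \<gamma> \<and>
        (\<forall>x y. cinner y (J x) = contour_integral (P \<gamma>) (\<lambda>z. cinner y (G z x)))))"
    unfolding U_def by (rule smooth_cycle_for_contour[OF \<Gamma>[folded \<sigma>1_def \<sigma>2_def] closed])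
  then obtain P where P: "\<forall>\<gamma>\<in>set \<Gamma>. valid_path (P \<gamma>) \<and> pathfinish (P \<gamma>) = pathstart (P \<gamma>) \<and>
       path_image (P \<gamma>) \<subseteq> U \<and> continuous_on {0..1} (\<lambda>t. vector_derivative (P \<gamma>) (at t))"
    and w1: "\<forall>z\<in>\<sigma>1. (\<Sum>\<gamma>\<leftarrow>\<Gamma>. winding_number (P \<gamma>) z) = 0"
    and w2: "\<forall>z\<in>\<sigma>2. (\<Sum>\<gamma>\<leftarrow>\<Gamma>. winding_number (P \<gamma>) z) = 1"
    and intg: "\<forall>\<gamma>\<in>set \<Gamma>. \<forall>G. op_holomorphic_on G U \<longrightarrow>
      (\<exists>J :: 'b \<Rightarrow> 'a. has_op_contour_integral G J \<gamma> \<and>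
        (\<forall>x y. cinner y (J x) = contour_integral (P \<gamma>) (\<lambda>z. cinner y (G z x))))"
    by (elim exE conjE) (rule that)
  note P = P[rule_format] and w1 = w1[rule_format] and w2 = w2[rule_format]
  have zero: "(\<Sum>\<gamma>\<leftarrow>\<Gamma>. contour_integral (P \<gamma>) (\<lambda>z. cinner y (T1 z (S x)))) = 0"
    if S: "bounded_clinear S" for S :: "'b \<Rightarrow> 'a" and x y
  proof -
    have "(\<Sum>p\<leftarrow>map P \<Gamma>. contour_integral p (\<lambda>z. cinner y (T1 z (S x)))) = 0"
      by (rule Cauchy_theorem_cycle[OF _ op_holomorphic_cinner[OF hol1S[OF S]]])
         (use P UU w1 closed in \<open>auto simp: open_Compl o_def\<close>)
    then show ?thesis by (simp add: o_def)
  qed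
  have resid: "(\<Sum>\<gamma>\<leftarrow>\<Gamma>. contour_integral (P \<gamma>) (\<lambda>z. cinner y (S (R2 z x)))) = 2 * pi * \<i> * cinner y (S x)"
    if S: "bounded_clinear S" for S :: "'b \<Rightarrow> 'a" and x y
  proof -
    have "(\<Sum>p\<leftarrow>map P \<Gamma>. contour_integral p (\<lambda>z. cinner y (S (resolvent UNIV L2 z x)))) = 2 * pi * \<i> * cinner y (S x)"
      by (rule cycle_integral_resolvent[OF L2 S]) (use P UU w2 in \<open>auto simp: \<sigma>2_def o_def\<close>)
    then show ?thesis by (simp add: o_def R2_def)
  qed
  have integrals: "\<exists>J. \<forall>\<gamma>\<in>set \<Gamma>. has_op_contour_integral G (J \<gamma>) \<gamma> \<and>
        (\<forall>x y. cinner y (J \<gamma> x) = contour_integral (P \<gamma>) (\<lambda>z. cinner y (G z x)))"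
    if "op_holomorphic_on G U" for G :: "complex \<Rightarrow> 'b \<Rightarrow> 'a"
    by (rule bchoice) (use intg that in blast)
  obtain J where J0: "\<forall>\<gamma>\<in>set \<Gamma>. has_op_contour_integral F (J \<gamma>) \<gamma> \<and>
        (\<forall>x y. cinner y (J \<gamma> x) = contour_integral (P \<gamma>) (\<lambda>z. cinner y (F z x)))"
    using integrals[OF holF] by (elim exE) (rule that)
  note J = bspec[OF J0, THEN conjunct1] bspec[OF J0, THEN conjunct2, rule_format]
  define A where "A z x = M (R2 z x)" for z x
  define B where "B z x = T1 z (M x)" for z x
  have holA: "op_holomorphic_on A U"
    unfolding A_def[abs_def] by (rule op_holomorphic_subset[OF hol2S[OF M] UU(2)])
  obtain JA where JA0: "\<forall>\<gamma>\<in>set \<Gamma>. has_op_contour_integral A (JA \<gamma>) \<gamma> \<and>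
        (\<forall>x y. cinner y (JA \<gamma> x) = contour_integral (P \<gamma>) (\<lambda>z. cinner y (A z x)))"
    using integrals[OF holA] by (elim exE) (rule that)
  note JA = bspec[OF JA0, THEN conjunct1] bspec[OF JA0, THEN conjunct2, rule_format]
  have holB: "op_holomorphic_on B U"
    unfolding B_def[abs_def] by (rule op_holomorphic_subset[OF hol1S[OF M] UU(1)])
  obtain JB where JB0: "\<forall>\<gamma>\<in>set \<Gamma>. has_op_contour_integral B (JB \<gamma>) \<gamma> \<and>
        (\<forall>x y. cinner y (JB \<gamma> x) = contour_integral (P \<gamma>) (\<lambda>z. cinner y (B z x)))"
    using integrals[OF holB] by (elim exE) (rule that)
  note JB = bspec[OF JB0, THEN conjunct1] bspec[OF JB0, THEN conjunct2, rule_format]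
  have Jb: "bounded_clinear (J \<gamma>)" if "\<gamma> \<in> set \<Gamma>" for \<gamma>
    using J(1)[OF that] by (simp add: has_op_contour_integral_def)
  have JA_sum: "(\<Sum>\<gamma>\<leftarrow>\<Gamma>. JA \<gamma> x) = (2 * pi * \<i>) *\<^sub>C M x" for x
  proof (rule cinner_ext)
    fix y
    have "cinner y (\<Sum>\<gamma>\<leftarrow>\<Gamma>. JA \<gamma> x) = (\<Sum>\<gamma>\<leftarrow>\<Gamma>. contour_integral (P \<gamma>) (\<lambda>z. cinner y (M (R2 z x))))"
      unfolding cinner_sum_list_right by (intro arg_cong[of _ _ sum_list] map_cong refl) (simp add: JA(2) A_def)
    then show "cinner y (\<Sum>\<gamma>\<leftarrow>\<Gamma>. JA \<gamma> x) = cinner y ((2 * pi * \<i>) *\<^sub>C M x)"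
      by (simp only: resid[OF M] cinner_scaleC_right)
  qed
  have JB_sum: "(\<Sum>\<gamma>\<leftarrow>\<Gamma>. JB \<gamma> x) = 0" for x
  proof (rule cinner_ext)
    fix y
    have "cinner y (\<Sum>\<gamma>\<leftarrow>\<Gamma>. JB \<gamma> x) = (\<Sum>\<gamma>\<leftarrow>\<Gamma>. contour_integral (P \<gamma>) (\<lambda>z. cinner y (T1 z (M x))))"
      unfolding cinner_sum_list_right by (intro arg_cong[of _ _ sum_list] map_cong refl) (simp add: JB(2) B_def)
    then show "cinner y (\<Sum>\<gamma>\<leftarrow>\<Gamma>. JB \<gamma> x) = cinner y 0"
      by (simp only: zero[OF M] cinner_zero_right)
  qed
  have FD: "F z x \<in> D1" and L1F: "L1 (F z x) = F z (L2 x) + A z x + B z x" if z: "z \<in> U" for z x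
  proof -
    have z1: "z \<notin> \<sigma>1" and z2: "z \<notin> \<sigma>2" using z by (auto simp: U_def)
    note Fb = bounded_clinear_simps[OF op_holomorphic_bounded[OF holF z]]
    show "F z x \<in> D1" unfolding F_eq by (rule T1(1)[OF z1])
    have 1: "L1 (F z x) = z *\<^sub>C F z x + A z x"
      using T1(2)[OF z1, of "M (R2 z x)"] by (simp add: F_eq A_def algebra_simps)
    have "F z (z *\<^sub>C x - L2 x) = B z x" unfolding F_eq B_def R2(2)[OF z2] ..
    then have "z *\<^sub>C F z x = F z (L2 x) + B z x" unfolding Fb by (simp add: algebra_simps)
    then show "L1 (F z x) = F z (L2 x) + A z x + B z x" unfolding 1 by (simp add: algebra_simps)
  qed
  \<comment> \<open>The corresponding identity holds for the Riemann sums of \<open>F\<close>, \<open>A\<close> and \<open>B\<close>; closedness of \<open>L1\<close> carries it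
    over to the limits.\<close>
  have JD: "J \<gamma> x \<in> D1 \<and> L1 (J \<gamma> x) = J \<gamma> (L2 x) + JA \<gamma> x + JB \<gamma> x" if g: "\<gamma> \<in> set \<Gamma>" for \<gamma> x
  proof (rule cdd_closed_graph[OF L1])
    let ?t = "\<lambda>n i. real i / real (Suc n)"
    have sum: "(\<Sum>i\<in>I. k i *\<^sub>C F (\<zeta> i) x) \<in> D1 \<and> L1 (\<Sum>i\<in>I. k i *\<^sub>C F (\<zeta> i) x) =
       (\<Sum>i\<in>I. k i *\<^sub>C F (\<zeta> i) (L2 x)) + (\<Sum>i\<in>I. k i *\<^sub>C A (\<zeta> i) x) + (\<Sum>i\<in>I. k i *\<^sub>C B (\<zeta> i) x)"
      if "finite I" "\<And>i. i \<in> I \<Longrightarrow> \<zeta> i \<in> U" for I :: "nat set" and k \<zeta>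
      using that
    proof (induction I rule: finite_induct)
      case empty
      have "L1 0 = 0" using cdd_simps(5)[OF L1 cdd_simps(1)[OF L1], of 0] by simp
      then show ?case using cdd_simps(1)[OF L1] by simp
    next
      case (insert i I)
      have z: "\<zeta> i \<in> U" using insert.prems by simp
      have "\<zeta> j \<in> U" if "j \<in> I" for j using insert.prems that by simp
      note IH = insert.IH[OF this, THEN conjunct1] insert.IH[OF this, THEN conjunct2]
      let ?u = "k i *\<^sub>C F (\<zeta> i) x" and ?v = "\<Sum>i\<in>I. k i *\<^sub>C F (\<zeta> i) x"
      have u: "?u \<in> D1" by (rule cdd_simps(4)[OF L1 FD[OF z]])
      have "L1 (?u + ?v) = L1 ?u + L1 ?v" by (rule cdd_simps(3)[OF L1 u IH(1)])
      also have "L1 ?u = k i *\<^sub>C F (\<zeta> i) (L2 x) + k i *\<^sub>C A (\<zeta> i) x + k i *\<^sub>C B (\<zeta> i) x"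
        by (simp only: cdd_simps(5)[OF L1 FD[OF z]] L1F[OF z] scaleC_add_right)
      finally show ?case
        unfolding sum.insert[OF insert.hyps]
        using cdd_simps(2)[OF L1 u IH(1)] by (simp add: IH(2) add_ac)
    qed
    have "path_image \<gamma> \<subseteq> U"
      using \<Gamma> g by (auto simp: jordan_contour_def cycle_image_def U_def \<sigma>1_def \<sigma>2_def)
    moreover have "?t n i \<in> {0..1}" if "i \<in> {..<Suc n}" for n i
      using partition01_in[OF partition01_uniform, of i n] that by simp
    ultimately have inU: "\<gamma> (?t n i) \<in> U" if "i \<in> {..<Suc n}" for n i
      using that unfolding path_image_def by blast
    have S: "op_sum F \<gamma> (Suc n) (?t n) (?t n) x \<in> D1 \<and> L1 (op_sum F \<gamma> (Suc n) (?t n) (?t n) x) =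
        op_sum F \<gamma> (Suc n) (?t n) (?t n) (L2 x) + op_sum A \<gamma> (Suc n) (?t n) (?t n) x + op_sum B \<gamma> (Suc n) (?t n) (?t n) x" for n
      by (rule sum[OF finite_lessThan inU])
    show "op_sum F \<gamma> (Suc n) (?t n) (?t n) x \<in> D1" for n
      by (rule S[THEN conjunct1])
    show "(\<lambda>n. op_sum F \<gamma> (Suc n) (?t n) (?t n) x) \<longlonglongrightarrow> J \<gamma> x"
      by (rule has_op_contour_integral_limit[OF J(1)[OF g]])
    show "(\<lambda>n. L1 (op_sum F \<gamma> (Suc n) (?t n) (?t n) x)) \<longlonglongrightarrow> J \<gamma> (L2 x) + JA \<gamma> x + JB \<gamma> x"
      unfolding S[THEN conjunct2]
      by (rule tendsto_add[OF tendsto_add[OF has_op_contour_integral_limit[OF J(1)[OF g]]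
              has_op_contour_integral_limit[OF JA(1)[OF g]]] has_op_contour_integral_limit[OF JB(1)[OF g]]])
  qed
  have sumD: "(\<Sum>\<gamma>\<leftarrow>\<Gamma>'. J \<gamma> x) \<in> D1 \<and> L1 (\<Sum>\<gamma>\<leftarrow>\<Gamma>'. J \<gamma> x) =
      (\<Sum>\<gamma>\<leftarrow>\<Gamma>'. J \<gamma> (L2 x)) + (\<Sum>\<gamma>\<leftarrow>\<Gamma>'. JA \<gamma> x) + (\<Sum>\<gamma>\<leftarrow>\<Gamma>'. JB \<gamma> x)"
    if "set \<Gamma>' \<subseteq> set \<Gamma>" for \<Gamma>' x
    using that
  proof (induction \<Gamma>')
    case Nil
    have "L1 0 = 0" using cdd_simps(5)[OF L1 cdd_simps(1)[OF L1], of 0] by simp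
    then show ?case using cdd_simps(1)[OF L1] by simp
  next
    case (Cons \<gamma> \<Gamma>')
    then have "J \<gamma> x \<in> D1" "L1 (J \<gamma> x) = J \<gamma> (L2 x) + JA \<gamma> x + JB \<gamma> x" using JD by auto
    then show ?case using Cons cdd_simps(2,3)[OF L1] by (simp add: add_ac)
  qed
  have D: "(\<Sum>\<gamma>\<leftarrow>\<Gamma>. J \<gamma> x) \<in> D1"
    and eq: "L1 (\<Sum>\<gamma>\<leftarrow>\<Gamma>. J \<gamma> x) = (\<Sum>\<gamma>\<leftarrow>\<Gamma>. J \<gamma> (L2 x)) + (2 * pi * \<i>) *\<^sub>C M x" for x
    using sumD[OF subset_refl, of x] by (simp_all add: JA_sum JB_sum)
  show ?thesis
  proof (rule that[of J, folded c_def])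
    show "has_op_contour_integral F (J \<gamma>) \<gamma>" if "\<gamma> \<in> set \<Gamma>" for \<gamma> by (rule J(1)[OF that])
    show "(\<lambda>x. c *\<^sub>C (\<Sum>\<gamma>\<leftarrow>\<Gamma>. J \<gamma> x)) \<in> bounded_ops D1"
      using bounded_clinear_scaleC[OF bounded_clinear_sum_list[of \<Gamma> J, OF Jb]] cdd_simps(4)[OF L1 D]
      by (auto simp: bounded_ops_def)
    show "L1 (c *\<^sub>C (\<Sum>\<gamma>\<leftarrow>\<Gamma>. J \<gamma> x)) - c *\<^sub>C (\<Sum>\<gamma>\<leftarrow>\<Gamma>. J \<gamma> (L2 x)) = M x" for x
      unfolding cdd_simps(5)[OF L1 D] eq scaleC_add_right scaleC_scaleC c by simp
    fix S assume S: "S \<in> bounded_ops D1" "\<forall>x. L1 (S x) - S (L2 x) = M x"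
    note Sb = bounded_opsD(1)[OF S(1)]
    have F_S: "F z x = S (R2 z x) + T1 z (S x)" if z: "z \<in> U" for z x
    proof -
      have z1: "z \<notin> \<sigma>1" and z2: "z \<notin> \<sigma>2" using z by (auto simp: U_def)
      let ?u = "R2 z x"
      have "S x = z *\<^sub>C S ?u - S (L2 ?u)"
        using arg_cong[OF R2(1)[OF z2, of x], of S] by (simp add: bounded_clinear_simps[OF Sb])
      then have "M ?u = (L1 (S ?u) - z *\<^sub>C S ?u) + S x" using S(2)[rule_format, of ?u] by (simp add: algebra_simps)
      then have "F z x = T1 z (L1 (S ?u) - z *\<^sub>C S ?u) + T1 z (S x)"
        unfolding F_eq by (simp add: bounded_clinear_simps(1)[OF T1(4)[OF z1]])
      then show ?thesis unfolding T1(3)[OF z1 bounded_opsD(2)[OF S(1)]] .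
    qed
    have "S x = c *\<^sub>C (\<Sum>\<gamma>\<leftarrow>\<Gamma>. J \<gamma> x)" for x
    proof (rule cinner_ext)
      fix y
      have "cinner y (J \<gamma> x) = contour_integral (P \<gamma>) (\<lambda>z. cinner y (S (R2 z x))) + contour_integral (P \<gamma>) (\<lambda>z. cinner y (T1 z (S x)))"
        if g: "\<gamma> \<in> set \<Gamma>" for \<gamma>
      proof -
        have "contour_integral (P \<gamma>) (\<lambda>z. cinner y (F z x)) =
            contour_integral (P \<gamma>) (\<lambda>z. cinner y (S (R2 z x)) + cinner y (T1 z (S x)))"
        proof (rule contour_integral_eq)
          fix z assume "z \<in> path_image (P \<gamma>)"
          then have "z \<in> U" using P[OF g] by blast
          then show "cinner y (F z x) = cinner y (S (R2 z x)) + cinner y (T1 z (S x))"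
            by (simp only: F_S cinner_add_right)
        qed
        also have "\<dots> = contour_integral (P \<gamma>) (\<lambda>z. cinner y (S (R2 z x))) + contour_integral (P \<gamma>) (\<lambda>z. cinner y (T1 z (S x)))"
          using P[OF g] UU closed
          by (intro contour_integral_add contour_integrable_holomorphic_simple[OF op_holomorphic_cinner[OF hol2S[OF Sb]]]
              contour_integrable_holomorphic_simple[OF op_holomorphic_cinner[OF hol1S[OF Sb]]]) (auto simp: open_Compl)
        finally show ?thesis by (simp only: J(2)[OF g])
      qed
      then have "cinner y (\<Sum>\<gamma>\<leftarrow>\<Gamma>. J \<gamma> x) =
          (\<Sum>\<gamma>\<leftarrow>\<Gamma>. contour_integral (P \<gamma>) (\<lambda>z. cinner y (S (R2 z x)))) + (\<Sum>\<gamma>\<leftarrow>\<Gamma>. contour_integral (P \<gamma>) (\<lambda>z. cinner y (T1 z (S x))))"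
        unfolding cinner_sum_list_right sum_list_addf[symmetric]
        by (intro arg_cong[of _ _ sum_list] map_cong refl)
      also have "\<dots> = 2 * pi * \<i> * cinner y (S x)" unfolding resid[OF Sb] zero[OF Sb] by simp
      finally show "cinner y (S x) = cinner y (c *\<^sub>C (\<Sum>\<gamma>\<leftarrow>\<Gamma>. J \<gamma> x))"
        using c by (simp add: cinner_scaleC_right mult.assoc[symmetric])
    qed
    then show "S = (\<lambda>x. c *\<^sub>C (\<Sum>\<gamma>\<leftarrow>\<Gamma>. J \<gamma> x))" by (rule ext)
  qed
qed

section \<open>The lower bound by pseudospectra\<close>

lemma not_in_pseudospectrum:
  assumes "z \<notin> pseudospectrum \<epsilon> D L"
  shows "z \<notin> spectrum D L" "onorm (resolvent D L z) \<le> 1 / \<epsilon>"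
  using assms by (auto simp: pseudospectrum_def resolvent_norm_def split: if_splits)

text \<open>
  On the contour the two resolvents have norms at most \<open>1 / \<epsilon>1\<close> and \<open>1 / \<epsilon>2\<close>. Estimating the integral
  that represents \<open>S\<close> by the length of the contour gives
  \<open>onorm S \<le> cycle_length \<Gamma> / (2 \<pi> \<epsilon>1 \<epsilon>2) * onorm (sylvester L1 L2 S)\<close>.
\<close>

lemma sep_ge_pseudospectral_bound:
  fixes D1 :: "'a::chilbert_space set" and L1 :: "'a \<Rightarrow> 'a"
    and L2 :: "'b::chilbert_space \<Rightarrow> 'b"
  assumes L1: "closed_densely_defined D1 L1" and L2: "bounded_clinear L2"
    and \<Gamma>: "jordan_contour \<Gamma> (spectrum D1 L1) (spectrum UNIV L2)"
    and \<epsilon>: "\<epsilon>1 > 0" "\<epsilon>2 > 0"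
    and ps: "pseudospectrum \<epsilon>1 D1 L1 \<inter> cycle_image \<Gamma> = {}" "pseudospectrum \<epsilon>2 UNIV L2 \<inter> cycle_image \<Gamma> = {}"
  shows "sep D1 L1 L2 \<ge> ereal (2 * pi * \<epsilon>1 * \<epsilon>2 / cycle_length \<Gamma>)"
  unfolding sep_def
proof (rule INF_greatest)
  fix S :: "'b \<Rightarrow> 'a" assume "S \<in> bounded_ops D1 - {\<lambda>_. 0}"
  then have S: "S \<in> bounded_ops D1" "S \<noteq> (\<lambda>_. 0)" by auto
  note Sb = bounded_opsD(1)[OF S(1)]
  define M where "M = sylvester L1 L2 S"
  have M: "bounded_clinear M" unfolding M_def by (rule sylvester_bounded[OF L1 L2 S(1)])
  define m where "m = onorm M"
  have m: "0 \<le> m" unfolding m_def using M by (simp add: onorm_pos_le bounded_clinear_bounded_linear)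
  have s: "onorm S > 0"
    using S onorm_pos_lt[OF bounded_clinear_bounded_linear[OF Sb]] by (auto simp: fun_eq_iff)
  define F where "F = (\<lambda>z. inv_into D1 (\<lambda>x. L1 x - z *\<^sub>C x) \<circ> M \<circ> inv (\<lambda>x. z *\<^sub>C x - L2 x))"
  obtain J where J: "\<And>\<gamma>. \<gamma> \<in> set \<Gamma> \<Longrightarrow> has_op_contour_integral F (J \<gamma>) \<gamma>"
    and SJ: "S = (\<lambda>x. (1 / (2 * of_real pi * \<i>)) *\<^sub>C (\<Sum>\<gamma>\<leftarrow>\<Gamma>. J \<gamma> x))"
  proof (rule contour_integral_solves_sylvester[OF L1 L2 M \<Gamma>])
    fix J
    assume a: "\<And>\<gamma>. \<gamma> \<in> set \<Gamma> \<Longrightarrow> has_op_contour_integral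
        (\<lambda>z. inv_into D1 (\<lambda>x. L1 x - z *\<^sub>C x) \<circ> M \<circ> inv (\<lambda>x. z *\<^sub>C x - L2 x)) (J \<gamma>) \<gamma>"
      and b: "\<And>S. S \<in> bounded_ops D1 \<Longrightarrow> (\<forall>x. L1 (S x) - S (L2 x) = M x) \<Longrightarrow>
       S = (\<lambda>x. (1 / (2 * of_real pi * \<i>)) *\<^sub>C (\<Sum>\<gamma>\<leftarrow>\<Gamma>. J \<gamma> x))"
    show thesis
      by (rule that[of J]) (use a b[OF S(1)] in \<open>auto simp: F_def M_def sylvester_def\<close>)
  qed
  define k where "k = 1 / \<epsilon>1 * (m * (1 / \<epsilon>2))"
  have k: "0 \<le> k" using m \<epsilon> by (simp add: k_def)
  have Fbound: "norm (F z x) \<le> k * norm x" if z: "z \<in> cycle_image \<Gamma>" for z x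
  proof -
    have z1: "z \<notin> pseudospectrum \<epsilon>1 D1 L1" and z2: "z \<notin> pseudospectrum \<epsilon>2 UNIV L2" using ps z by auto
    note R1 = not_in_pseudospectrum[OF z1] and R2 = not_in_pseudospectrum[OF z2]
    have bd: "norm (resolvent D L z v) \<le> 1 / \<epsilon> * norm v"
      if "z \<notin> spectrum D L" "onorm (resolvent D L z) \<le> 1 / \<epsilon>" for D :: "'c::chilbert_space set" and L v \<epsilon>
      using bounded_clinear_norm_le[OF resolvent_props(4)[OF that(1)], of v] mult_right_mono[OF that(2) norm_ge_zero[of v]] by simp
    have "norm (F z x) = norm (resolvent D1 L1 z (M (resolvent UNIV L2 z x)))"
      by (simp add: F_def inv_into_eq_minus_resolvent[OF L1 R1(1)] resolvent_def[of UNIV])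
    also have "\<dots> \<le> 1 / \<epsilon>1 * norm (M (resolvent UNIV L2 z x))" by (rule bd[OF R1])
    also have "\<dots> \<le> 1 / \<epsilon>1 * (m * norm (resolvent UNIV L2 z x))"
      using bounded_clinear_norm_le[OF M] \<epsilon> unfolding m_def by (intro mult_left_mono) auto
    also have "\<dots> \<le> 1 / \<epsilon>1 * (m * (1 / \<epsilon>2 * norm x))"
      using bd[OF R2] m \<epsilon> by (intro mult_left_mono) auto
    finally show ?thesis by (simp only: k_def mult.assoc)
  qed
  have Jbound: "norm (\<Sum>\<gamma>\<leftarrow>\<Gamma>'. J \<gamma> x) \<le> k * (\<Sum>\<gamma>\<leftarrow>\<Gamma>'. arc_length \<gamma>) * norm x" if "set \<Gamma>' \<subseteq> set \<Gamma>" for \<Gamma>' x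
    using that
  proof (induction \<Gamma>')
    case (Cons \<gamma> \<Gamma>')
    then have g: "\<gamma> \<in> set \<Gamma>" by simp
    have "rectifiable_path \<gamma>" using \<Gamma> g by (simp add: jordan_contour_def)
    moreover have "\<gamma> s \<in> cycle_image \<Gamma>" if "s \<in> {0..1}" for s
      using that g unfolding cycle_image_def path_image_def by blast
    ultimately have "norm (J \<gamma> x) \<le> k * arc_length \<gamma> * norm x"
      by (intro has_op_contour_integral_bound[OF J[OF g] _ _ k] Fbound)
    moreover have "norm (\<Sum>\<gamma>\<leftarrow>\<Gamma>'. J \<gamma> x) \<le> k * (\<Sum>\<gamma>\<leftarrow>\<Gamma>'. arc_length \<gamma>) * norm x" using Cons by simp
    ultimately show ?case
      using norm_triangle_ineq[of "J \<gamma> x" "\<Sum>\<gamma>\<leftarrow>\<Gamma>'. J \<gamma> x"] by (simp add: algebra_simps)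
  qed simp
  have len: "cycle_length \<Gamma> \<ge> 0"
    unfolding cycle_length_def using \<Gamma> arc_length_nonneg by (intro sum_list_nonneg) (auto simp: jordan_contour_def)
  have "onorm S \<le> k * cycle_length \<Gamma> / (2 * pi)"
  proof (rule onorm_bound)
    show "0 \<le> k * cycle_length \<Gamma> / (2 * pi)" using k len by simp
    show "norm (S x) \<le> k * cycle_length \<Gamma> / (2 * pi) * norm x" for x
    proof -
      have "norm (S x) = norm (\<Sum>\<gamma>\<leftarrow>\<Gamma>. J \<gamma> x) / (2 * pi)"
        by (subst SJ) (simp add: norm_divide norm_mult)
      also have "\<dots> \<le> (k * cycle_length \<Gamma> * norm x) / (2 * pi)"
        unfolding cycle_length_def by (rule divide_right_mono[OF Jbound]) auto
      finally show ?thesis by simp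
    qed
  qed
  then have le: "2 * pi * \<epsilon>1 * \<epsilon>2 * onorm S \<le> m * cycle_length \<Gamma>"
    using \<epsilon> by (simp add: k_def field_simps)
  have "2 * pi * \<epsilon>1 * \<epsilon>2 / cycle_length \<Gamma> \<le> m / onorm S"
  \<comment> \<open>For a contour of length \<open>0\<close> the left hand side is a division by zero, with value \<open>0\<close>.\<close>
  proof (cases "cycle_length \<Gamma> = 0")
    case True
    then show ?thesis using m s by simp
  next
    case False
    then show ?thesis using le len s by (simp add: field_simps)
  qed
  then show "ereal (2 * pi * \<epsilon>1 * \<epsilon>2 / cycle_length \<Gamma>) \<le> ereal (onorm (sylvester L1 L2 S) / onorm S)"
    by (simp add: m_def M_def)
qed

section \<open>The operator Sylvester equation\<close>

theorem lemmaA1: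
  fixes D1 :: "'a::chilbert_space set" and L1 :: "'a \<Rightarrow> 'a"
    and L2 :: "'b::chilbert_space \<Rightarrow> 'b"
  assumes "closed_densely_defined D1 L1"
    and "bounded_clinear L2"
    and "spectrum D1 L1 \<inter> spectrum UNIV L2 = {}"
  shows
    "(\<forall>M \<in> bounded_ops UNIV. \<exists>!S. S \<in> bounded_ops D1 \<and> (\<forall>x. L1 (S x) - S (L2 x) = M x)) \<and>
     bij_betw (sylvester L1 L2) (bounded_ops D1) (bounded_ops UNIV) \<and>
     (\<exists>\<Gamma>. jordan_contour \<Gamma> (spectrum D1 L1) (spectrum UNIV L2)) \<and>
     (\<forall>\<Gamma>. jordan_contour \<Gamma> (spectrum D1 L1) (spectrum UNIV L2) \<longrightarrow>
        (\<forall>M \<in> bounded_ops UNIV. \<forall>S \<in> bounded_ops D1.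
           (\<forall>x. L1 (S x) - S (L2 x) = M x) \<longrightarrow>
           (\<exists>J. has_op_cycle_integral
                  (\<lambda>z. inv_into D1 (\<lambda>x. L1 x - z *\<^sub>C x) \<circ> M \<circ> inv (\<lambda>x. z *\<^sub>C x - L2 x)) J \<Gamma> \<and>
                S = (\<lambda>x. (1 / (2 * of_real pi * \<i>)) *\<^sub>C J x))) \<and>
        (\<forall>\<epsilon>1 > 0. \<forall>\<epsilon>2 > 0.
           pseudospectrum \<epsilon>1 D1 L1 \<inter> cycle_image \<Gamma> = {} \<and>
           pseudospectrum \<epsilon>2 UNIV L2 \<inter> cycle_image \<Gamma> = {} \<longrightarrow>
           sep D1 L1 L2 \<ge> ereal (2 * pi * \<epsilon>1 * \<epsilon>2 / cycle_length \<Gamma>))) \<and>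
     (\<forall>\<Delta>. numerical_range D1 L1 \<inter> numerical_range UNIV L2 = {} \<and>
          \<Delta> = setdist (numerical_range D1 L1) (numerical_range UNIV L2) \<and> \<Delta> > 0 \<longrightarrow>
          sep D1 L1 L2 \<ge> ereal \<Delta>)"
proof -
  note L1 = assms(1) and L2 = assms(2)
  obtain \<Gamma>0 where \<Gamma>0: "jordan_contour \<Gamma>0 (spectrum D1 L1) (spectrum UNIV L2)"
    using jordan_contour_exists[OF closed_spectrum[OF L1] compact_spectrum[OF L2] assms(3)] by blast
  have exun: "\<exists>!S. S \<in> bounded_ops D1 \<and> (\<forall>x. L1 (S x) - S (L2 x) = M x)" if "M \<in> bounded_ops UNIV" for M
  proof (rule contour_integral_solves_sylvester[OF L1 L2 bounded_opsD(1)[OF that] \<Gamma>0])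
    fix J :: "(real \<Rightarrow> complex) \<Rightarrow> 'b \<Rightarrow> 'a"
    let ?S = "\<lambda>x. (1 / (2 * of_real pi * \<i>)) *\<^sub>C (\<Sum>\<gamma>\<leftarrow>\<Gamma>0. J \<gamma> x)"
    assume "?S \<in> bounded_ops D1" "\<And>x. L1 (?S x) - (1 / (2 * of_real pi * \<i>)) *\<^sub>C (\<Sum>\<gamma>\<leftarrow>\<Gamma>0. J \<gamma> (L2 x)) = M x"
      "\<And>S. S \<in> bounded_ops D1 \<Longrightarrow> (\<forall>x. L1 (S x) - S (L2 x) = M x) \<Longrightarrow> S = ?S"
    then show ?thesis by (intro ex1I[of _ ?S]) blast+
  qed
  have bij: "bij_betw (sylvester L1 L2) (bounded_ops D1) (bounded_ops UNIV)"
    unfolding bij_betw_def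
  proof
    have maps: "sylvester L1 L2 S \<in> bounded_ops UNIV" if "S \<in> bounded_ops D1" for S
      using sylvester_bounded[OF L1 L2 that] by (simp add: bounded_ops_def)
    show "inj_on (sylvester L1 L2) (bounded_ops D1)"
    proof (rule inj_onI)
      fix S S' assume S: "S \<in> bounded_ops D1" "S' \<in> bounded_ops D1" "sylvester L1 L2 S = sylvester L1 L2 S'"
      have "\<forall>x. L1 (S' x) - S' (L2 x) = sylvester L1 L2 S x" unfolding S(3) by (simp add: sylvester_def)
      moreover have "\<forall>x. L1 (S x) - S (L2 x) = sylvester L1 L2 S x" by (simp add: sylvester_def)
      ultimately show "S = S'" using exun[OF maps[OF S(1)]] S(1,2) by blast
    qed
    show "sylvester L1 L2 ` bounded_ops D1 = bounded_ops UNIV"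
    proof
      show "bounded_ops UNIV \<subseteq> sylvester L1 L2 ` bounded_ops D1"
      proof
        fix M :: "'b \<Rightarrow> 'a" assume "M \<in> bounded_ops UNIV"
        then obtain S where "S \<in> bounded_ops D1" "\<forall>x. L1 (S x) - S (L2 x) = M x" using exun by blast
        then show "M \<in> sylvester L1 L2 ` bounded_ops D1" by (auto simp: sylvester_def fun_eq_iff intro!: image_eqI[of _ _ S])
      qed
    qed (use maps in blast)
  qed
  have repr: "\<exists>J. has_op_cycle_integral
                  (\<lambda>z. inv_into D1 (\<lambda>x. L1 x - z *\<^sub>C x) \<circ> M \<circ> inv (\<lambda>x. z *\<^sub>C x - L2 x)) J \<Gamma> \<and>
                S = (\<lambda>x. (1 / (2 * of_real pi * \<i>)) *\<^sub>C J x)"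
    if \<Gamma>: "jordan_contour \<Gamma> (spectrum D1 L1) (spectrum UNIV L2)" and M: "M \<in> bounded_ops UNIV"
      and S: "S \<in> bounded_ops D1" "\<forall>x. L1 (S x) - S (L2 x) = M x" for \<Gamma> M S
  proof (rule contour_integral_solves_sylvester[OF L1 L2 bounded_opsD(1)[OF M] \<Gamma>])
    fix J
    let ?F = "\<lambda>z. inv_into D1 (\<lambda>x. L1 x - z *\<^sub>C x) \<circ> M \<circ> inv (\<lambda>x. z *\<^sub>C x - L2 x)"
    assume J: "\<And>\<gamma>. \<gamma> \<in> set \<Gamma> \<Longrightarrow> has_op_contour_integral ?F (J \<gamma>) \<gamma>"
      and un: "\<And>S. S \<in> bounded_ops D1 \<Longrightarrow> (\<forall>x. L1 (S x) - S (L2 x) = M x) \<Longrightarrow>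
       S = (\<lambda>x. (1 / (2 * of_real pi * \<i>)) *\<^sub>C (\<Sum>\<gamma>\<leftarrow>\<Gamma>. J \<gamma> x))"
    have "has_op_cycle_integral ?F (\<lambda>x. \<Sum>\<gamma>\<leftarrow>\<Gamma>. J \<gamma> x) \<Gamma>"
      unfolding has_op_cycle_integral_def
    proof (rule exI[of _ "map J \<Gamma>"], intro conjI)
      show "list_all2 (has_op_contour_integral ?F) (map J \<Gamma>) \<Gamma>"
        unfolding list_all2_conv_all_nth by (intro conjI allI impI) (simp_all only: length_map nth_map J nth_mem)
    qed (simp add: o_def)
    then show ?thesis using un[OF S] by blast
  qed
  show ?thesis
    using exun bij \<Gamma>0 repr sep_ge_pseudospectral_bound[OF L1 L2] sep_ge_setdist_numerical_range[OF L1 L2] by blast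
qed

end
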